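(* Let $d\ge2$, let $N\ge0$ be an integer and $0<b<1$. Let $f\in H^2(\mathcal{B})$ have the expansion $$f(z,\theta)=\sum_{k=0}^\infty\sum_{\ell=1}^{a_k}f_{k,\ell}(z^2)z^kY_{k,\ell}(\theta)\qquad\text{for }|z|<1,\ \theta\in\mathbb{S}^{d-1}.$$ For each $(k,\ell)$ let $\{r_{k,\ell;j}\}_{j=0}^N$ be distinct points of the interval $[0,b]$, and let $p_{k,\ell}$ be the polynomial of degree $\le N$ satisfying $$p_{k,\ell}(r_{k,\ell;j}^2)=f_{k,\ell}(r_{k,\ell;j}^2)\qquad\text{for }j=0,1,\dots,N.$$ Then the function $$P_N(z,\theta)=\sum_{k=0}^\infty\sum_{\ell=1}^{a_k}p_{k,\ell}(z^2)z^kY_{k,\ell}(\theta)$$ is polyharmonic of order $N+1$ in the ball $B_b=\{x\in\mathbb{R}^d:|x|<b\}$ (as the function $x=r\theta\mapsto P_N(r,\theta)$) and belongs to the polyharmonic Hardy space $H^2(\mathcal{B}_b)$, and the following inequality holds: $$\|P_N\|_{H^2(\mathcal{B}_b)}\le C_{N,b}\,\|f\|_{H^2(\mathcal{B})},$$ where $C_{N,b}$ is a constant depending on $N$ and $b$ (for the given dimension $d$).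
   Context: $\mathbb{S}^{d-1}$ is the unit sphere of $\mathbb{R}^d$ with rotation-invariant measure $d\theta$. $\mathcal{H}_k(\mathbb{R}^d)$ is the space of harmonic homogeneous polynomials of degree $k$, $a_k=\dim\mathcal{H}_k(\mathbb{R}^d)$, and $Y_{k,\ell}$ ($\ell=1,\dots,a_k$) is a fixed basis of $\mathcal{H}_k(\mathbb{R}^d)$ orthonormal for $\int_{\mathbb{S}^{d-1}}f\overline g\,d\theta$. A function $u$ is polyharmonic of order $M$ if it is $2M$ times continuously differentiable and $\Delta^Mu=0$. For $R>0$ let $\mathbb{D}_R=\{z\in\mathbb{C}:|z|<R\}$ and $\mathcal{B}_R=\mathbb{D}_R\times\mathbb{S}^{d-1}/\mathbb{Z}_2$ (with $(z,\theta)$ and $(-z,-\theta)$ identified), the ball of radius $R$ of the Klein-Dirac quadric; $\mathcal{B}=\mathcal{B}_1$. $H^2(\mathbb{D}_R)$ is the Hardy space of analytic functions on $\mathbb{D}_R$ with $\|g\|^2_{H^2(\mathbb{D}_R)}=\sup_{r<R}\frac1{2\pi}\int_0^{2\pi}|g(re^{i\varphi})|^2d\varphi<\infty$. The polyharmonic Hardy space $H^2(\mathcal{B}_R)$ is the space of functions $f(z,\theta)=\sum_{k,\ell}F_{k,\ell}(z)Y_{k,\ell}(\theta)$ on $|z|<R$, $\theta\in\mathbb{S}^{d-1}$, with $F_{k,\ell}(z)=f_{k,\ell}(z^2)z^k\in H^2(\mathbb{D}_R)$ ($f_{k,\ell}$ analytic) and $\|f\|_{H^2(\mathcal{B}_R)}=\big(\sum_{k,\ell}\|F_{k,\ell}\|^2_{H^2(\mathbb{D}_R)}\big)^{1/2}<\infty$.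 *)

theory Defs
  imports
    "HOL-Analysis.Analysis"
    "HOL-Computational_Algebra.Polynomial"
    "HOL-Library.Function_Algebras"
begin

section \<open>Polyharmonic functions\<close>

definition partial_deriv :: "'n::finite \<Rightarrow> (real^'n \<Rightarrow> complex) \<Rightarrow> real^'n \<Rightarrow> complex" where
  "partial_deriv i u x = frechet_derivative u (at x) (axis i 1)"

text \<open>The class \<open>C\<^sup>m(S)\<close>; it is only used for open \<open>S\<close>.\<close>

primrec times_cont_diff_on :: "nat \<Rightarrow> (real^'n::finite \<Rightarrow> complex) \<Rightarrow> (real^'n) set \<Rightarrow> bool" where
  "times_cont_diff_on 0 u S \<longleftrightarrow> continuous_on S u"
| "times_cont_diff_on (Suc m) u S \<longleftrightarrow>
     u differentiable_on S \<and> (\<forall>i. times_cont_diff_on m (partial_deriv i u) S)"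

definition laplacian :: "(real^'n::finite \<Rightarrow> complex) \<Rightarrow> real^'n \<Rightarrow> complex" where
  "laplacian u x = (\<Sum>i\<in>UNIV. partial_deriv i (partial_deriv i u) x)"

definition polyharmonic_on :: "nat \<Rightarrow> (real^'n::finite) set \<Rightarrow> (real^'n \<Rightarrow> complex) \<Rightarrow> bool" where
  "polyharmonic_on M S u \<longleftrightarrow>
     times_cont_diff_on (2 * M) u S \<and> (\<forall>x\<in>S. (laplacian ^^ M) u x = 0)"

section \<open>Spherical harmonics\<close>

text \<open>Surface measure of the unit sphere, as a measure on the ambient space: \<open>CARD('n)\<close> times
  the volume of the cone \<open>{x. 0 < norm x < 1 \<and> x / norm x \<in> A}\<close> over \<open>A\<close>. The origin, a null set,
  is the only point of the ball that is not mapped to the sphere.\<close>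

definition sphere_measure :: "(real^'n::finite) measure" where
  "sphere_measure = scale_measure (ennreal (real CARD('n)))
     (distr (restrict_space lborel (ball 0 1)) borel (\<lambda>x. x /\<^sub>R norm x))"

definition fun_scale :: "complex \<Rightarrow> ('a \<Rightarrow> complex) \<Rightarrow> 'a \<Rightarrow> complex" where
  "fun_scale c f = (\<lambda>x. c * f x)"

interpretation fun_space: vector_space "fun_scale :: complex \<Rightarrow> ('a \<Rightarrow> complex) \<Rightarrow> 'a \<Rightarrow> complex"
  by unfold_locales (auto simp: fun_scale_def fun_eq_iff algebra_simps)

definition harmonic_space :: "nat \<Rightarrow> (real^'n::finite \<Rightarrow> complex) set" where
  "harmonic_space k = {q. polynomial_function q \<and>
     (\<forall>t x. q (t *\<^sub>R x) = of_real t ^ k * q x) \<and> (\<forall>x. laplacian q x = 0)}"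

definition harmonic_dim :: "'n::finite itself \<Rightarrow> nat \<Rightarrow> nat" where
  "harmonic_dim _ k = fun_space.dim (harmonic_space k :: (real^'n \<Rightarrow> complex) set)"

definition orthonormal_harmonics :: "(nat \<Rightarrow> nat \<Rightarrow> real^'n::finite \<Rightarrow> complex) \<Rightarrow> bool" where
  "orthonormal_harmonics Y \<longleftrightarrow> (\<forall>k.
     fun_space.span (Y k ` {1..harmonic_dim TYPE('n) k}) = harmonic_space k \<and>
     (\<forall>l\<in>{1..harmonic_dim TYPE('n) k}. \<forall>m\<in>{1..harmonic_dim TYPE('n) k}.
        (LINT \<theta>|sphere_measure. Y k l \<theta> * cnj (Y k m \<theta>)) = (if l = m then 1 else 0)))"

section \<open>Hardy spaces\<close>

definition hardy_mean :: "(complex \<Rightarrow> complex) \<Rightarrow> real \<Rightarrow> real" where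
  "hardy_mean g r =
     1 / (2 * pi) * integral {0..2 * pi} (\<lambda>\<phi>. (cmod (g (of_real r * cis \<phi>)))\<^sup>2)"

definition hardy_disc :: "real \<Rightarrow> (complex \<Rightarrow> complex) set" where
  "hardy_disc R = {g. g holomorphic_on ball 0 R \<and> bdd_above (hardy_mean g ` {0..<R})}"

definition hardy_disc_norm :: "real \<Rightarrow> (complex \<Rightarrow> complex) \<Rightarrow> real" where
  "hardy_disc_norm R g = sqrt (SUP r\<in>{0..<R}. hardy_mean g r)"

text \<open>Functions on the ball of radius \<open>R\<close> of the Klein-Dirac quadric are represented by functions
  of \<open>(z, \<theta>)\<close>, relevant only for \<open>cmod z < R\<close> and \<open>\<theta>\<close> in the unit sphere. Invariance under
  \<open>(z, \<theta>) \<mapsto> (-z, -\<theta>)\<close> need not be imposed: it holds for each term of the expansions below, as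
  \<open>Y k l (-\<theta>) = (-1)^k * Y k l \<theta>\<close>.\<close>

definition quadric_term ::
  "(nat \<Rightarrow> nat \<Rightarrow> real^'n::finite \<Rightarrow> complex) \<Rightarrow> (nat \<Rightarrow> nat \<Rightarrow> complex \<Rightarrow> complex)
     \<Rightarrow> complex \<Rightarrow> real^'n \<Rightarrow> nat \<Rightarrow> complex" where
  "quadric_term Y c z \<theta> k =
     (\<Sum>l = 1..harmonic_dim TYPE('n) k. c k l (z\<^sup>2) * z ^ k * Y k l \<theta>)"

text \<open>The sum over \<open>l\<close> of the squared norms of \<open>F k l z = c k l (z\<^sup>2) * z ^ k\<close>.\<close>

definition hardy_weight ::
  "'n::finite itself \<Rightarrow> real \<Rightarrow> (nat \<Rightarrow> nat \<Rightarrow> complex \<Rightarrow> complex) \<Rightarrow> nat \<Rightarrow> real" where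
  "hardy_weight _ R c k =
     (\<Sum>l = 1..harmonic_dim TYPE('n) k. (hardy_disc_norm R (\<lambda>z. c k l (z\<^sup>2) * z ^ k))\<^sup>2)"

definition hardy_expansion ::
  "real \<Rightarrow> (nat \<Rightarrow> nat \<Rightarrow> real^'n::finite \<Rightarrow> complex) \<Rightarrow> (complex \<Rightarrow> real^'n \<Rightarrow> complex)
     \<Rightarrow> (nat \<Rightarrow> nat \<Rightarrow> complex \<Rightarrow> complex) \<Rightarrow> bool" where
  "hardy_expansion R Y f c \<longleftrightarrow>
     (\<forall>k. \<forall>l\<in>{1..harmonic_dim TYPE('n) k}.
        c k l holomorphic_on ball 0 (R\<^sup>2) \<and> (\<lambda>z. c k l (z\<^sup>2) * z ^ k) \<in> hardy_disc R) \<and>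
     summable (hardy_weight TYPE('n) R c) \<and>
     (\<forall>z\<in>ball 0 R. \<forall>\<theta>\<in>sphere 0 1. quadric_term Y c z \<theta> sums f z \<theta>)"

definition polyharmonic_hardy ::
  "real \<Rightarrow> (nat \<Rightarrow> nat \<Rightarrow> real^'n::finite \<Rightarrow> complex) \<Rightarrow> (complex \<Rightarrow> real^'n \<Rightarrow> complex) set" where
  "polyharmonic_hardy R Y = {f. \<exists>c. hardy_expansion R Y f c}"

text \<open>The coefficients of a member of the space are determined by its values, for orthonormal
  \<open>Y\<close>, so the description below is unique on \<open>polyharmonic_hardy R Y\<close>.\<close>

definition polyharmonic_hardy_norm ::
  "real \<Rightarrow> (nat \<Rightarrow> nat \<Rightarrow> real^'n::finite \<Rightarrow> complex) \<Rightarrow> (complex \<Rightarrow> real^'n \<Rightarrow> complex) \<Rightarrow> real" where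
  "polyharmonic_hardy_norm R Y f =
     (THE s. \<exists>c. hardy_expansion R Y f c \<and> s = sqrt (\<Sum>k. hardy_weight TYPE('n) R c k))"

end

theory Submission
  imports Defs "HOL-Complex_Analysis.Conformal_Mappings"
begin

text \<open>The interpolation error is controlled coefficientwise. Dividing \<open>f - f x\<^sub>0\<close> by \<open>w - x\<^sub>0\<close> and using the
  maximum principle, an induction on the number of nodes bounds the interpolating polynomial on
  \<open>|w| \<le> b\<^sup>2\<close> by the supremum of \<open>f\<close> on a larger disc, independently of the position of the nodes; and
  Cauchy's formula on circles of radius close to \<open>1\<close> bounds that supremum by the Hardy norm of
  \<open>f (z\<^sup>2) z\<^sup>k\<close>, uniformly in \<open>k\<close>. Convergence and smoothness of the resulting series come from the fact
  that a homogeneous polynomial of degree \<open>k\<close> is bounded on the sphere by its \<open>L\<^sup>2\<close> norm, and its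
  derivatives by its supremum, up to factors polynomial in \<open>k\<close>, both being consequences of Bernstein's
  inequality on lines. The norm is well defined because a harmonic function vanishing on the sphere
  is zero.\<close>

section \<open>Polynomials of bounded degree\<close>

text \<open>The difficulty is uniformity in \<open>(k, l)\<close> and in the nodes. Lagrange's
  formula has differences of nodes in its denominators, and these may be arbitrarily small;
  recovering \<open>f\<close> from \<open>f (z^2) z^k\<close> on an inner circle would cost a factor
  exponential in \<open>k\<close>. The growth of the dimensions \<open>harmonic_dim\<close> is
  another possible loss; it is avoided by estimating the whole sum over \<open>l\<close> as one
  homogeneous polynomial. The losses that remain are powers of \<open>k + 1\<close>, and inside the
  disc the geometric factor \<open>(norm z / R) ^ k\<close> absorbs them, so crude exponents do no
  harm. Finally, \<open>orthonormal_harmonics\<close> relates members of equal degree only, and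
  orthogonality between degrees would call for Green's formula on the sphere. The coefficients are
  therefore separated differently: the maximum principle shows that the difference of two expansions
  vanishes in the ball, and dilations then isolate its homogeneous parts.\<close>

lemma higher_deriv_poly: "(deriv ^^ n) (poly p) = poly ((pderiv ^^ n) p)"
  for p :: "complex poly"
proof (induction n)
  case (Suc n)
  have "deriv (poly q) = poly (pderiv q)" for q :: "complex poly"
    by (rule ext, rule DERIV_imp_deriv, rule poly_DERIV)
  with Suc show ?case by simp
qed simp

text \<open>These are Cauchy's inequalities at radius 1. For a polynomial read on the unit circle
  they bound Fourier coefficients, which is how \<open>poly_increment_bound\<close> uses
  them.\<close>

lemma coeff_bound_unit_circle:
  fixes p :: "complex poly"
  assumes "\<And>z. norm z = 1 \<Longrightarrow> norm (poly p z) \<le> M"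
  shows "norm (coeff p j) \<le> M"
proof -
  have "norm ((deriv ^^ j) (poly p) 0) \<le> fact j * M / 1 ^ j"
    by (rule Cauchy_inequality) (auto intro!: assms holomorphic_intros continuous_intros)
  moreover have "(deriv ^^ j) (poly p) 0 = fact j * coeff p j"
    by (simp add: higher_deriv_poly poly_0_coeff_0 coeff_higher_pderiv pochhammer_fact flip: of_nat_fact)
  ultimately show ?thesis by (simp add: norm_mult)
qed

lemma arcsin_bound:
  fixes t :: real
  assumes "\<bar>t\<bar> \<le> 1/2"
  shows "\<bar>arcsin t\<bar> \<le> 2 * \<bar>t\<bar>"
proof -
  have "norm (arcsin t - arcsin 0) \<le> 2 * norm (t - 0)"
  proof (rule field_differentiable_bound)
    show "(arcsin has_field_derivative inverse (sqrt (1 - x\<^sup>2))) (at x within {-1/2..1/2})"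
      if "x \<in> {-1/2..1/2}" for x :: real
      using that by (intro DERIV_subset[OF DERIV_arcsin]) auto
    show "norm (inverse (sqrt (1 - x\<^sup>2))) \<le> 2" if "x \<in> {-1/2..1/2}" for x :: real
    proof -
      have "\<bar>x\<bar>\<^sup>2 \<le> (1/2)\<^sup>2" using that by (intro power_mono) auto
      then have "1/4 \<le> 1 - x\<^sup>2" by (simp add: power2_eq_square)
      then have "sqrt (1/4) \<le> sqrt (1 - x\<^sup>2)" by (rule real_sqrt_le_mono)
      then have "1/2 \<le> sqrt (1 - x\<^sup>2)" by (simp add: real_sqrt_divide)
      then show ?thesis using le_imp_inverse_le[of "1/2" "sqrt (1 - x\<^sup>2)"] by simp
    qed
  qed (use assms in auto)
  then show ?thesis by simp
qed

lemma norm_cis_diff_one: "norm (cis x - 1) \<le> \<bar>x\<bar>"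
proof -
  have "cos x = 1 - 2 * (sin (x/2))\<^sup>2" using cos_double_sin[of "x/2"] by simp
  moreover have "(norm (cis x - 1))\<^sup>2 = 2 - 2 * cos x"
    unfolding cmod_power2 using sin_cos_squared_add[of x] by (simp add: power2_diff)
  ultimately have "(norm (cis x - 1))\<^sup>2 = (2 * \<bar>sin (x/2)\<bar>)\<^sup>2" by (simp add: power_mult_distrib)
  then have "norm (cis x - 1) = 2 * \<bar>sin (x/2)\<bar>"
    by (rule power2_eq_imp_eq) auto
  then show ?thesis using abs_sin_x_le_abs_x[of "x/2"] by simp
qed

lemma poly_eq_sum_atMost:
  fixes p :: "'a::{comm_semiring_0,semiring_1} poly"
  assumes "degree p \<le> n"
  shows "poly p x = (\<Sum>i\<le>n. coeff p i * x ^ i)"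
proof -
  have "(\<Sum>i\<le>degree p. coeff p i * x ^ i) = (\<Sum>i\<le>n. coeff p i * x ^ i)"
    using assms by (intro sum.mono_neutral_left) (auto simp: coeff_eq_0)
  then show ?thesis by (simp add: poly_altdef)
qed

text \<open>Substituting \<open>t = sin \<phi>\<close> turns \<open>g\<close> into a trigonometric polynomial of degree \<open>n\<close>, all of whose
  Fourier coefficients are at most \<open>M\<close>.\<close>

lemma poly_increment_bound:
  fixes g :: "complex poly"
  assumes deg: "degree g \<le> n"
    and bound: "\<And>t::real. \<bar>t\<bar> \<le> 1 \<Longrightarrow> norm (poly g (of_real t)) \<le> M"
    and t: "\<bar>t\<bar> \<le> 1/2"
  shows "norm (poly g (of_real t) - poly g 0) \<le> 4 * (real n + 1)\<^sup>2 * M * \<bar>t\<bar>"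
proof -
  \<comment> \<open>At \<open>z = cis \<phi>\<close> the value \<open>(z^2 - 1) / (2 i)\<close> of
    \<open>s\<close> is \<open>z sin \<phi>\<close>. In \<open>G\<close> the monomial pads every
    term to the common factor \<open>cis \<phi> ^ n\<close>, which shifts the frequencies of
    \<open>g (sin \<phi>)\<close> from -n..n to 0..2n and makes \<open>G\<close> a
    polynomial.\<close>
  define s :: "complex poly" where "s = [: - 1 / (2*\<i>), 0, 1 / (2*\<i>) :]"
  define G where "G = (\<Sum>m\<le>n. smult (coeff g m) (s ^ m * monom 1 (n - m)))"
  have s: "poly s (cis \<phi>) = cis \<phi> * of_real (sin \<phi>)" for \<phi>
  proof -
    have "poly s (cis \<phi>) = (cis \<phi> * cis \<phi> - 1) / (2 * \<i>)"
      by (simp add: s_def field_simps)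
    also have "cis \<phi> * cis \<phi> - 1 = (2 * \<i>) * (cis \<phi> * of_real (sin \<phi>))"
    proof -
      have "(cos \<phi>)\<^sup>2 + (sin \<phi>)\<^sup>2 = 1" by simp
      then have "sin \<phi> * sin \<phi> + (cos \<phi> * cos \<phi> - 1) = 0"
        unfolding power2_eq_square by linarith
      then show ?thesis by (simp add: complex_eq_iff)
    qed
    finally show ?thesis by simp
  qed
  have degG: "degree G \<le> 2 * n"
    unfolding G_def
  proof (rule degree_sum_le)
    fix m assume m: "m \<in> {..n}"
    have "degree (s ^ m) \<le> degree s * m" by (rule degree_power_le)
    also have "\<dots> \<le> 2 * m" by (simp add: s_def)
    finally have "degree (s ^ m * monom 1 (n - m)) \<le> 2 * m + (n - m)"
      using degree_mult_le[of "s ^ m" "monom 1 (n - m)"] degree_monom_le[of "1::complex" "n - m"]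
      by linarith
    then show "degree (smult (coeff g m) (s ^ m * monom 1 (n - m))) \<le> 2 * n"
      using m degree_smult_le[of "coeff g m" "s ^ m * monom 1 (n - m)"] by (auto intro: order_trans)
  qed simp
  have G: "poly G (cis \<phi>) = cis \<phi> ^ n * poly g (of_real (sin \<phi>))" for \<phi>
  proof -
    have "poly G (cis \<phi>) = (\<Sum>m\<le>n. coeff g m * (cis \<phi> ^ m * of_real (sin \<phi>) ^ m * cis \<phi> ^ (n - m)))"
      by (simp add: G_def poly_sum poly_monom s power_mult_distrib)
    also have "\<dots> = (\<Sum>m\<le>n. cis \<phi> ^ n * (coeff g m * of_real (sin \<phi>) ^ m))"
    proof (rule sum.cong)
      fix m assume "m \<in> {..n}"
      then have "cis \<phi> ^ n = cis \<phi> ^ m * cis \<phi> ^ (n - m)" by (simp flip: power_add)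
      then show "coeff g m * (cis \<phi> ^ m * of_real (sin \<phi>) ^ m * cis \<phi> ^ (n - m)) =
        cis \<phi> ^ n * (coeff g m * of_real (sin \<phi>) ^ m)" by simp
    qed simp
    also have "\<dots> = cis \<phi> ^ n * poly g (of_real (sin \<phi>))"
      by (simp add: poly_eq_sum_atMost[OF deg] flip: sum_distrib_left)
    finally show ?thesis .
  qed
  have coeffG: "norm (coeff G j) \<le> M" for j
  proof (rule coeff_bound_unit_circle)
    fix z :: complex assume "norm z = 1"
    then have "z = cis (Arg2pi z)"
      using complex_norm_eq_1_exp[of z] by (simp add: cis_conv_exp)
    then obtain \<phi> where "z = cis \<phi>" by blast
    then show "norm (poly G z) \<le> M" by (simp add: G norm_mult norm_power bound)
  qed
  define \<phi> where "\<phi> = arcsin t"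
  have sin: "sin \<phi> = t" using t by (simp add: \<phi>_def)
  have T: "poly g (of_real (sin x)) = (\<Sum>j\<le>2*n. coeff G j * cis ((real j - real n) * x))" for x
  proof -
    have "poly g (of_real (sin x)) = cis (- real n * x) * poly G (cis x)"
      by (simp add: G Complex.DeMoivre cis_mult)
    also have "\<dots> = (\<Sum>j\<le>2*n. coeff G j * cis ((real j - real n) * x))"
      unfolding poly_eq_sum_atMost[OF degG] sum_distrib_left
      by (intro sum.cong) (auto simp: Complex.DeMoivre cis_mult algebra_simps)
    finally show ?thesis .
  qed
  have "M \<ge> 0" using order_trans[OF norm_ge_zero bound[of 0]] by simp
  have "poly g (of_real t) - poly g 0 = (\<Sum>j\<le>2*n. coeff G j * (cis ((real j - real n) * \<phi>) - 1))"
    using T[of \<phi>] T[of 0] sin by (simp add: right_diff_distrib sum_subtractf)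
  \<comment> \<open>There are \<open>2 n + 1\<close> terms, each moving by at most
    \<open>n |\<phi>|\<close>, and \<open>|\<phi>| \<le> 2 |t|\<close>. The sharp Bernstein factor
    would be of order \<open>n\<close>, but any polynomial growth in \<open>n\<close> is good enough
    later.\<close>
  also have "norm \<dots> \<le> (\<Sum>j\<le>2*n. M * (real n * \<bar>\<phi>\<bar>))"
  proof (rule sum_norm_le)
    fix j assume "j \<in> {..2*n}"
    then have "\<bar>real j - real n\<bar> * \<bar>\<phi>\<bar> \<le> real n * \<bar>\<phi>\<bar>" by (intro mult_right_mono) auto
    then have "norm (cis ((real j - real n) * \<phi>) - 1) \<le> real n * \<bar>\<phi>\<bar>"
      using norm_cis_diff_one[of "(real j - real n) * \<phi>"] by (simp add: abs_mult)
    then show "norm (coeff G j * (cis ((real j - real n) * \<phi>) - 1)) \<le> M * (real n * \<bar>\<phi>\<bar>)"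
      unfolding norm_mult using coeffG \<open>M \<ge> 0\<close> by (intro mult_mono) auto
  qed
  also have "\<dots> = (2 * real n + 1) * real n * (M * \<bar>\<phi>\<bar>)" by (simp add: algebra_simps)
  also have "\<dots> \<le> 2 * (real n + 1)\<^sup>2 * (M * (2 * \<bar>t\<bar>))"
  proof (rule mult_mono)
    show "(2 * real n + 1) * real n \<le> 2 * (real n + 1)\<^sup>2" by (simp add: power2_eq_square algebra_simps)
    show "M * \<bar>\<phi>\<bar> \<le> M * (2 * \<bar>t\<bar>)"
      using arcsin_bound[OF t] \<open>M \<ge> 0\<close> by (intro mult_left_mono) (auto simp: \<phi>_def)
  qed (use \<open>M \<ge> 0\<close> in auto)
  finally show ?thesis by (simp add: algebra_simps)
qed

lemma polynomial_function_real_complex: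
  fixes f :: "real \<Rightarrow> complex"
  assumes "polynomial_function f"
  obtains g where "\<And>t. f t = poly g (of_real t)"
proof -
  have "real_polynomial_function (\<lambda>t. Re (f t))" "real_polynomial_function (\<lambda>t. Im (f t))"
    using assms bounded_linear_Re bounded_linear_Im by (auto simp: polynomial_function_def o_def)
  then obtain a b m n where ab: "(\<lambda>t. Re (f t)) = (\<lambda>x. \<Sum>i\<le>m. a i * x ^ i)"
    "(\<lambda>t. Im (f t)) = (\<lambda>x. \<Sum>i\<le>n. b i * x ^ i)"
    unfolding real_polynomial_function_iff_sum by blast
  define g :: "complex poly" where
    "g = (\<Sum>i\<le>m. monom (of_real (a i)) i) + smult \<i> (\<Sum>i\<le>n. monom (of_real (b i)) i)"
  have "f t = poly g (of_real t)" for t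
    using fun_cong[OF ab(1), of t] fun_cong[OF ab(2), of t]
    by (simp add: g_def poly_sum poly_monom complex_eq_iff flip: of_real_power of_real_mult of_real_sum)
  then show ?thesis using that by blast
qed

text \<open>The leading coefficient is the value at 0 of the reversed polynomial
  \<open>t ^ degree g * g (1 / t)\<close>. If the degree exceeded \<open>n\<close>, the growth bound
  would make this of order \<open>t ^ (degree g - n)\<close> as \<open>t\<close> decreases to 0,
  hence zero in the limit.\<close>

lemma degree_le_growth:
  fixes g :: "complex poly"
  assumes "\<And>t::real. t > 0 \<Longrightarrow> norm (poly g (of_real t)) \<le> C * (1 + t) ^ n"
  shows "degree g \<le> n"
proof (rule ccontr)
  assume "\<not> degree g \<le> n"
  then have deg: "n < degree g" by simp
  have "((\<lambda>t::real. C * t ^ (degree g - n) * (t + 1) ^ n) \<longlongrightarrow> C * 0 ^ (degree g - n) * (0 + 1) ^ n) (at_right 0)"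
    by (intro tendsto_mult tendsto_power tendsto_add tendsto_const tendsto_ident_at)
  then have lim: "((\<lambda>t::real. C * t ^ (degree g - n) * (t + 1) ^ n) \<longlongrightarrow> 0) (at_right 0)"
    using deg by (simp add: power_0_left)
  have "isCont (\<lambda>t::real. norm (poly (reflect_poly g) (of_real t))) 0" by (intro continuous_intros)
  then have lim2: "((\<lambda>t::real. norm (poly (reflect_poly g) (of_real t))) \<longlongrightarrow> norm (poly (reflect_poly g) (of_real 0))) (at_right 0)"
    unfolding isCont_def by (rule filterlim_mono) (auto simp: at_within_le_at)
  have le: "norm (poly (reflect_poly g) (of_real t)) \<le> C * t ^ (degree g - n) * (t + 1) ^ n"
    if "t > 0" for t :: real
  proof -
    have "poly (reflect_poly g) (of_real t) = of_real t ^ degree g * poly g (inverse (of_real t))"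
      using that by (intro poly_reflect_poly_nz) auto
    then have "norm (poly (reflect_poly g) (of_real t)) = t ^ degree g * norm (poly g (of_real (inverse t)))"
      using that by (simp add: norm_mult norm_power)
    also have "\<dots> \<le> t ^ degree g * (C * (1 + inverse t) ^ n)"
      using assms[of "inverse t"] that by (intro mult_left_mono) auto
    also have "\<dots> = C * t ^ (degree g - n) * (t + 1) ^ n"
    proof -
      have deg': "t ^ degree g = t ^ (degree g - n) * t ^ n" using deg by (simp flip: power_add)
      have "t * (1 + inverse t) = t + 1" using that by (simp add: distrib_left)
      then have "t ^ n * (1 + inverse t) ^ n = (t + 1) ^ n" by (simp only: power_mult_distrib[symmetric])
      with deg' show ?thesis by (simp add: mult.assoc mult.left_commute)
    qed
    finally show ?thesis .
  qed
  have "norm (poly (reflect_poly g) (of_real 0)) \<le> 0"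
    by (rule tendsto_le[OF _ lim lim2]) (auto simp: eventually_at_filter le)
  then have "lead_coeff g = 0" by (simp add: poly_0_coeff_0)
  then have "g = 0" by simp
  with deg show False by simp
qed

text \<open>Degrees are measured by growth, which is inherited by restrictions to lines and by partial
  derivatives.\<close>

definition poly_degree_le :: "nat \<Rightarrow> ('a::real_normed_vector \<Rightarrow> complex) \<Rightarrow> bool" where
  "poly_degree_le n q \<longleftrightarrow> polynomial_function q \<and> (\<exists>C. \<forall>x. norm (q x) \<le> C * (1 + norm x) ^ n)"

text \<open>Growth in the norm restricts to growth in the parameter, because
  \<open>1 + norm (x + t v)\<close> is at most a constant times \<open>1 + t\<close> for positive
  \<open>t\<close>. This makes the one-variable inequality available in every direction.\<close>

lemma poly_degree_le_line:
  assumes "poly_degree_le n q"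
  obtains g where "degree g \<le> n" "\<And>t. q (x + t *\<^sub>R v) = poly g (of_real t)"
proof -
  from assms obtain C where q: "polynomial_function q"
    and C: "\<And>x. norm (q x) \<le> C * (1 + norm x) ^ n"
    by (auto simp: poly_degree_le_def)
  have "polynomial_function (q \<circ> (\<lambda>t. x + t *\<^sub>R v))"
    by (intro polynomial_function_compose polynomial_function_add polynomial_function_const
        polynomial_function_mult polynomial_function_id q)
  then obtain g where "\<And>t. (q \<circ> (\<lambda>t. x + t *\<^sub>R v)) t = poly g (of_real t)"
    by (rule polynomial_function_real_complex) blast
  then have g: "q (x + t *\<^sub>R v) = poly g (of_real t)" for t by simp
  have "C \<ge> 0" using order_trans[OF norm_ge_zero C[of 0]] by simp
  have "degree g \<le> n"
  proof (rule degree_le_growth)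
    fix t :: real assume t: "t > 0"
    have "norm (poly g (of_real t)) \<le> C * (1 + norm (x + t *\<^sub>R v)) ^ n"
      unfolding g[symmetric] by (rule C)
    also have "\<dots> \<le> C * ((1 + norm x + norm v) * (1 + t)) ^ n"
    proof (intro mult_left_mono power_mono)
      have "norm (x + t *\<^sub>R v) \<le> norm x + t * norm v"
        using t norm_triangle_ineq[of x "t *\<^sub>R v"] by simp
      moreover have "0 \<le> t * norm x" using t by auto
      moreover have "(1 + norm x + norm v) * (1 + t) = 1 + norm x + norm v + t + t * norm x + t * norm v"
        by (simp add: algebra_simps)
      ultimately show "1 + norm (x + t *\<^sub>R v) \<le> (1 + norm x + norm v) * (1 + t)"
        using t norm_ge_zero[of v] by linarith
    qed (use \<open>C \<ge> 0\<close> in auto)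
    finally show "norm (poly g (of_real t)) \<le> C * (1 + norm x + norm v) ^ n * (1 + t) ^ n"
      by (simp add: power_mult_distrib mult.assoc)
  qed
  then show ?thesis using g that by blast
qed

text \<open>This is \<open>poly_increment_bound\<close> along the line through \<open>x\<close> in
  the direction of \<open>h\<close>, with the direction vector rescaled to length
  \<open>\<delta>\<close>: parameters in [-1, 1] then stay where \<open>M\<close> is a bound, and
  \<open>x + h\<close> has the parameter \<open>norm h / \<delta>\<close>, at most 1/2.\<close>

lemma poly_degree_le_increment:
  assumes q: "poly_degree_le n q" and "\<delta> > 0"
    and bound: "\<And>y. norm (y - x) \<le> \<delta> \<Longrightarrow> norm (q y) \<le> M"
    and h: "norm h \<le> \<delta> / 2"
  shows "norm (q (x + h) - q x) \<le> 4 * (real n + 1)\<^sup>2 * M * (norm h / \<delta>)"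
proof (cases "h = 0")
  case False
  define v where "v = (\<delta> / norm h) *\<^sub>R h"
  have v: "norm v = \<delta>" "h = (norm h / \<delta>) *\<^sub>R v" using False \<open>\<delta> > 0\<close> by (auto simp: v_def)
  obtain g where g: "degree g \<le> n" "\<And>t. q (x + t *\<^sub>R v) = poly g (of_real t)"
    by (rule poly_degree_le_line[OF q]) blast
  have "norm (poly g (of_real (norm h / \<delta>)) - poly g 0) \<le> 4 * (real n + 1)\<^sup>2 * M * \<bar>norm h / \<delta>\<bar>"
  proof (rule poly_increment_bound[OF g(1)])
    show "norm (poly g (of_real t)) \<le> M" if "\<bar>t\<bar> \<le> 1" for t
      unfolding g(2)[symmetric] using that \<open>\<delta> > 0\<close> by (intro bound) (simp add: v(1) mult_left_le_one_le)
    show "\<bar>norm h / \<delta>\<bar> \<le> 1/2" using h \<open>\<delta> > 0\<close> by (simp add: field_simps)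
  qed
  moreover have "q (x + h) = poly g (of_real (norm h / \<delta>))" using g(2)[of "norm h / \<delta>"] v(2) by simp
  moreover have "q x = poly g 0" using g(2)[of 0] by simp
  ultimately show ?thesis using \<open>\<delta> > 0\<close> by simp
qed simp

lemma real_polynomial_function_derivative:
  assumes "real_polynomial_function q"
  obtains D where "\<And>x. (q has_derivative D x) (at x)" "\<And>v. real_polynomial_function (\<lambda>x. D x v)"
proof -
  from assms have "\<exists>D. (\<forall>x. (q has_derivative D x) (at x)) \<and> (\<forall>v. real_polynomial_function (\<lambda>x. D x v))"
  proof (induction q rule: real_polynomial_function.induct)
    case (linear f)
    then show ?case
      by (intro exI[of _ "\<lambda>x. f"]) (auto intro: bounded_linear_imp_has_derivative real_polynomial_function.intros(2))
  next
    case (const c)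
    then show ?case
      by (intro exI[of _ "\<lambda>x v. 0"]) (auto intro: real_polynomial_function.intros(2))
  next
    case (add f g)
    then obtain D E where "\<forall>x. (f has_derivative D x) (at x)" "\<forall>v. real_polynomial_function (\<lambda>x. D x v)"
      "\<forall>x. (g has_derivative E x) (at x)" "\<forall>v. real_polynomial_function (\<lambda>x. E x v)" by blast
    then show ?case
      by (intro exI[of _ "\<lambda>x v. D x v + E x v"]) (auto intro!: has_derivative_add real_polynomial_function.intros(3))
  next
    case (mult f g)
    then obtain D E where "\<forall>x. (f has_derivative D x) (at x)" "\<forall>v. real_polynomial_function (\<lambda>x. D x v)"
      "\<forall>x. (g has_derivative E x) (at x)" "\<forall>v. real_polynomial_function (\<lambda>x. E x v)" by blast
    with mult.hyps show ?case
      by (intro exI[of _ "\<lambda>x v. f x * E x v + D x v * g x"])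
         (auto intro!: has_derivative_mult real_polynomial_function.intros(3) real_polynomial_function.intros(4))
  qed
  then show ?thesis using that by blast
qed

lemma partial_deriv_eq:
  assumes "(u has_derivative D) (at x)"
  shows "partial_deriv i u x = D (axis i 1)"
  using frechet_derivative_at[OF assms] by (simp add: partial_deriv_def)

lemma polynomial_function_partial_deriv:
  fixes q :: "real^'n::finite \<Rightarrow> complex"
  assumes "polynomial_function q"
  shows "polynomial_function (partial_deriv i q)"
proof -
  have "real_polynomial_function (\<lambda>x. Re (q x))" "real_polynomial_function (\<lambda>x. Im (q x))"
    using assms bounded_linear_Re bounded_linear_Im by (auto simp: polynomial_function_def o_def)
  note polys = this
  obtain D where D: "\<And>x. ((\<lambda>x. Re (q x)) has_derivative D x) (at x)" "\<And>v. real_polynomial_function (\<lambda>x. D x v)"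
    by (rule real_polynomial_function_derivative[OF polys(1)]) blast
  obtain E where E: "\<And>x. ((\<lambda>x. Im (q x)) has_derivative E x) (at x)" "\<And>v. real_polynomial_function (\<lambda>x. E x v)"
    by (rule real_polynomial_function_derivative[OF polys(2)]) blast
  have "(q has_derivative (\<lambda>v. of_real (D x v) + \<i> * of_real (E x v))) (at x)" for x
  proof -
    have "((\<lambda>x. of_real (Re (q x)) + \<i> * of_real (Im (q x))) has_derivative
        (\<lambda>v. of_real (D x v) + \<i> * of_real (E x v))) (at x)"
      by (rule has_derivative_add[OF has_derivative_of_real[OF D(1)]
            has_derivative_mult_right[OF has_derivative_of_real[OF E(1)]]])
    then show ?thesis by (simp flip: complex_eq)
  qed
  then have "partial_deriv i q x = of_real (D x (axis i 1)) + \<i> * of_real (E x (axis i 1))" for x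
    by (rule partial_deriv_eq)
  then have "partial_deriv i q x = (D x (axis i 1)) *\<^sub>R 1 + (E x (axis i 1)) *\<^sub>R \<i>" for x
    by (simp add: scaleR_conv_of_real)
  then have "partial_deriv i q = (\<lambda>x. (D x (axis i 1)) *\<^sub>R 1 + (E x (axis i 1)) *\<^sub>R \<i>)" by blast
  moreover have "polynomial_function (\<lambda>x. (D x (axis i 1)) *\<^sub>R (1::complex) + (E x (axis i 1)) *\<^sub>R \<i>)"
    using D(2)[of "axis i 1"] E(2)[of "axis i 1"] unfolding real_polynomial_function_eq
    by (rule polynomial_function_add[OF polynomial_function_mult[OF _ polynomial_function_const]
          polynomial_function_mult[OF _ polynomial_function_const]])
  ultimately show ?thesis by simp
qed

lemma has_derivative_imp_line:
  assumes "(u has_derivative D) (at x)"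
  shows "((\<lambda>t::real. (u (x + t *\<^sub>R v) - u x) /\<^sub>R t) \<longlongrightarrow> D v) (at 0)"
proof -
  have lin: "linear D" using assms by (simp add: has_derivative_linear)
  have "((\<lambda>t::real. u (x + t *\<^sub>R v)) has_derivative (\<lambda>t. D (t *\<^sub>R v))) (at 0)"
    by (rule has_derivative_compose[of "\<lambda>t. x + t *\<^sub>R v", where g = u])
       (auto intro!: derivative_eq_intros assms)
  then have "((\<lambda>t::real. u (x + t *\<^sub>R v)) has_vector_derivative D v) (at 0)"
    using lin by (simp add: has_vector_derivative_def linear_scale)
  then have "((\<lambda>t. norm ((u (x + t *\<^sub>R v) - u x - t *\<^sub>R D v) /\<^sub>R \<bar>t\<bar>)) \<longlongrightarrow> 0) (at 0)"
    by (intro tendsto_norm_zero) (simp add: has_vector_derivative_def has_derivative_at2 diff_diff_eq divide_inverse)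
  moreover have "\<forall>\<^sub>F t in at 0. norm ((u (x + t *\<^sub>R v) - u x - t *\<^sub>R D v) /\<^sub>R \<bar>t\<bar>) =
      norm ((u (x + t *\<^sub>R v) - u x) /\<^sub>R t - D v)"
  proof -
    have "norm ((u (x + t *\<^sub>R v) - u x - t *\<^sub>R D v) /\<^sub>R \<bar>t\<bar>) = norm ((u (x + t *\<^sub>R v) - u x) /\<^sub>R t - D v)"
      if "t \<noteq> 0" for t
    proof -
      have "(u (x + t *\<^sub>R v) - u x) /\<^sub>R t - D v = (u (x + t *\<^sub>R v) - u x - t *\<^sub>R D v) /\<^sub>R t"
        using that by (simp add: scaleR_right_diff_distrib)
      then show ?thesis by simp
    qed
    then show ?thesis by (auto simp: eventually_at_filter)
  qed
  ultimately have "((\<lambda>t. norm ((u (x + t *\<^sub>R v) - u x) /\<^sub>R t - D v)) \<longlongrightarrow> 0) (at 0)"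
    by (rule Lim_transform_eventually)
  then show ?thesis by (rule LIM_zero_cancel[OF tendsto_norm_zero_cancel])
qed

text \<open>An inequality of Bernstein type. The increment bound is linear in \<open>norm h\<close>,
  so it passes to difference quotients and to their limit.\<close>

lemma poly_degree_le_partial_deriv_bound:
  fixes q :: "real^'n::finite \<Rightarrow> complex"
  assumes q: "poly_degree_le n q" and "\<delta> > 0"
    and bound: "\<And>y. norm (y - x) \<le> \<delta> \<Longrightarrow> norm (q y) \<le> M"
  shows "norm (partial_deriv i q x) \<le> 4 * (real n + 1)\<^sup>2 * M / \<delta>"
proof -
  have "q differentiable (at x)"
    using q by (auto simp: poly_degree_le_def intro: differentiable_at_polynomial_function)
  then obtain D where D: "(q has_derivative D) (at x)" by (auto simp: differentiable_def)
  have "norm (D (axis i 1)) \<le> 4 * (real n + 1)\<^sup>2 * M / \<delta>"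
  proof (rule tendsto_upperbound[OF tendsto_norm[OF has_derivative_imp_line[OF D]]])
    have "norm ((q (x + t *\<^sub>R axis i 1) - q x) /\<^sub>R t) \<le> 4 * (real n + 1)\<^sup>2 * M / \<delta>"
      if "t \<noteq> 0" "\<bar>t\<bar> \<le> \<delta>/2" for t
    proof -
      have "norm (q (x + t *\<^sub>R axis i 1) - q x) \<le> 4 * (real n + 1)\<^sup>2 * M * (norm (t *\<^sub>R axis i (1::real) :: real^'n) / \<delta>)"
        using that by (intro poly_degree_le_increment[OF q \<open>\<delta> > 0\<close> bound]) auto
      then have "norm (q (x + t *\<^sub>R axis i 1) - q x) / \<bar>t\<bar> \<le> 4 * (real n + 1)\<^sup>2 * M / \<delta>"
        using that \<open>\<delta> > 0\<close> by (simp add: pos_divide_le_eq mult_ac)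
      then show ?thesis by (simp add: divide_inverse mult.commute)
    qed
    moreover have "\<forall>\<^sub>F t in at 0. t \<noteq> 0 \<and> \<bar>t\<bar> \<le> \<delta>/2"
      unfolding eventually_at using \<open>\<delta> > 0\<close> by (intro exI[of _ "\<delta>/2"]) auto
    ultimately show "\<forall>\<^sub>F t in at 0. norm ((q (x + t *\<^sub>R axis i 1) - q x) /\<^sub>R t) \<le> 4 * (real n + 1)\<^sup>2 * M / \<delta>"
      by (rule_tac eventually_mono[where P = "\<lambda>t. t \<noteq> 0 \<and> \<bar>t\<bar> \<le> \<delta>/2"]) blast+
  qed simp
  then show ?thesis by (simp add: partial_deriv_eq[OF D])
qed

text \<open>On the unit ball around \<open>x\<close> one has
  \<open>1 + norm y \<le> 2 (1 + norm x)\<close>, which costs a constant factor for fixed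
  \<open>n\<close>. Keeping \<open>n\<close> instead of lowering it to \<open>n - 1\<close> leaves
  the degree parameter of \<open>poly_series\<close> unchanged under differentiation.\<close>

lemma poly_degree_le_partial_deriv:
  fixes q :: "real^'n::finite \<Rightarrow> complex"
  assumes q: "poly_degree_le n q"
  shows "poly_degree_le n (partial_deriv i q)"
proof -
  obtain C where C: "\<And>x. norm (q x) \<le> C * (1 + norm x) ^ n" and p: "polynomial_function q"
    using q by (auto simp: poly_degree_le_def)
  have "C \<ge> 0" using order_trans[OF norm_ge_zero C[of 0]] by simp
  have "norm (partial_deriv i q x) \<le> (4 * (real n + 1)\<^sup>2 * C * 2 ^ n) * (1 + norm x) ^ n" for x
  proof -
    have "norm (partial_deriv i q x) \<le> 4 * (real n + 1)\<^sup>2 * (C * (2 * (1 + norm x)) ^ n) / 1"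
    proof (rule poly_degree_le_partial_deriv_bound[OF q])
      fix y assume "norm (y - x) \<le> 1"
      then have "norm y \<le> norm x + 1" using norm_triangle_sub[of y x] by simp
      then have "1 + norm y \<le> 2 * (1 + norm x)" using norm_ge_zero[of x]
        by (simp add: distrib_left del: norm_ge_zero)
      then have "(1 + norm y) ^ n \<le> (2 * (1 + norm x)) ^ n" by (intro power_mono) auto
      then have "C * (1 + norm y) ^ n \<le> C * (2 * (1 + norm x)) ^ n" using \<open>C \<ge> 0\<close> by (rule mult_left_mono)
      then show "norm (q y) \<le> C * (2 * (1 + norm x)) ^ n" using C[of y] by linarith
    qed simp
    then show ?thesis unfolding power_mult_distrib by (simp only: mult.assoc div_by_1)
  qed
  then show ?thesis using polynomial_function_partial_deriv[OF p] by (auto simp: poly_degree_le_def)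
qed

section \<open>Homogeneous functions and their maximum on the sphere\<close>

definition homogeneous :: "nat \<Rightarrow> ('a::real_normed_vector \<Rightarrow> complex) \<Rightarrow> bool" where
  "homogeneous k q \<longleftrightarrow> (\<forall>t x. q (t *\<^sub>R x) = of_real t ^ k * q x)"

lemma homogeneous_bound:
  assumes q: "homogeneous k q" and M: "\<And>\<theta>. norm \<theta> = 1 \<Longrightarrow> norm (q \<theta>) \<le> M" and "norm (x::'a) \<le> r"
    and "\<exists>\<theta>::'a::real_normed_vector. norm \<theta> = 1"
  shows "norm (q x) \<le> r ^ k * M"
proof -
  from assms(4) obtain \<theta>\<^sub>0 :: 'a where \<theta>\<^sub>0: "norm \<theta>\<^sub>0 = 1" by blast
  \<comment> \<open>The origin has no direction of its own. Any unit vector satisfies the identity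
    there, and the convention \<open>0 ^ 0 = 1\<close> makes the case \<open>k = 0\<close> come out
    right.\<close>
  have "\<exists>\<theta>. norm \<theta> = 1 \<and> x = norm x *\<^sub>R \<theta>"
    by (cases "x = 0") (auto intro: exI[of _ \<theta>\<^sub>0] exI[of _ "x /\<^sub>R norm x"] simp: \<theta>\<^sub>0)
  then obtain \<theta> where \<theta>: "norm \<theta> = 1" "x = norm x *\<^sub>R \<theta>" by blast
  have "norm (q x) = norm x ^ k * norm (q \<theta>)"
  proof -
    have "q (norm x *\<^sub>R \<theta>) = of_real (norm x) ^ k * q \<theta>" using q by (simp add: homogeneous_def)
    then show ?thesis using \<theta>(2) by (simp add: norm_mult norm_power)
  qed
  also have "\<dots> \<le> r ^ k * M"
    using M[OF \<theta>(1)] assms(3) order_trans[OF norm_ge_zero assms(3)] by (intro mult_mono power_mono) auto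
  finally show ?thesis .
qed

lemma sphere_bound_exists:
  fixes q :: "real^'n::finite \<Rightarrow> complex"
  assumes "continuous_on UNIV q"
  obtains \<theta>\<^sub>0 where "norm \<theta>\<^sub>0 = 1" "\<And>\<theta>. norm \<theta> = 1 \<Longrightarrow> norm (q \<theta>) \<le> norm (q \<theta>\<^sub>0)"
proof -
  have ne: "axis undefined 1 \<in> sphere (0::real^'n) 1" by simp
  have "\<exists>\<theta>\<^sub>0\<in>sphere (0::real^'n) 1. \<forall>\<theta>\<in>sphere 0 1. norm (q \<theta>) \<le> norm (q \<theta>\<^sub>0)"
  proof (rule continuous_attains_sup)
    show "continuous_on (sphere 0 1) (\<lambda>x. norm (q x))"
      using assms by (intro continuous_intros) (auto elim: continuous_on_subset)
  qed (use ne in auto)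
  then show ?thesis using that by auto
qed

lemma unit_vector_exists: "\<exists>\<theta>::real^'n::finite. norm \<theta> = 1"
  by (rule exI[of _ "axis undefined 1"]) simp

lemma polynomial_function_continuous: "polynomial_function q \<Longrightarrow> continuous_on S q"
  for q :: "'a::real_normed_vector \<Rightarrow> complex"
  by (rule continuous_on_polymonial_function)

lemma homogeneous_poly_degree_le:
  fixes q :: "real^'n::finite \<Rightarrow> complex"
  assumes "polynomial_function q" "homogeneous k q"
  shows "poly_degree_le k q"
proof -
  obtain \<theta>\<^sub>0 where "\<And>\<theta>. norm \<theta> = 1 \<Longrightarrow> norm (q \<theta>) \<le> norm (q \<theta>\<^sub>0)"
    using sphere_bound_exists[OF polynomial_function_continuous[OF assms(1)]] by blast
  then have "norm (q x) \<le> (1 + norm x) ^ k * norm (q \<theta>\<^sub>0)" for x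
    by (intro homogeneous_bound[OF assms(2)] unit_vector_exists) auto
  then show ?thesis using assms(1) by (auto simp: poly_degree_le_def mult.commute)
qed

section \<open>The sphere measure\<close>

lemma sets_sphere_measure [simp, measurable_cong]: "sets sphere_measure = sets borel"
  by (simp add: sphere_measure_def)

lemma space_sphere_measure [simp]: "space sphere_measure = UNIV"
  by (simp add: sphere_measure_def space_scale_measure)

text \<open>The definition through cones turns integrals over the sphere into Lebesgue integrals of
  radially constant functions over the ball. The estimates below start from this formula and not
  from polar coordinates.\<close>

lemma nn_integral_sphere_measure:
  fixes g :: "real^'n::finite \<Rightarrow> ennreal"
  assumes [measurable]: "g \<in> borel_measurable borel"
  shows "nn_integral sphere_measure g =
    ennreal (real CARD('n)) * (\<integral>\<^sup>+x\<in>ball 0 1. g (x /\<^sub>R norm x) \<partial>lborel)"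
proof -
  have [measurable]: "(\<lambda>x::real^'n. x /\<^sub>R norm x) \<in> borel_measurable (restrict_space lborel (ball 0 1))"
    by (rule measurable_restrict_space1) simp
  show ?thesis
    unfolding sphere_measure_def
    by (subst nn_integral_scale_measure, simp, subst nn_integral_distr)
       (auto simp: nn_integral_restrict_space)
qed

lemma finite_sphere_measure: "finite_measure (sphere_measure :: (real^'n::finite) measure)"
proof
  have "emeasure sphere_measure (UNIV :: (real^'n) set) = nn_integral sphere_measure (\<lambda>_::real^'n. 1)"
    by (simp add: sets_eq_imp_space_eq)
  also have "\<dots> = ennreal (real CARD('n)) * emeasure lborel (ball (0::real^'n) 1)"
    by (subst nn_integral_sphere_measure) simp_all
  also have "\<dots> < \<infinity>"
    using emeasure_bounded_finite[of "ball (0::real^'n) 1"] by (auto simp: ennreal_mult_less_top)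
  finally show "emeasure sphere_measure (space (sphere_measure :: (real^'n) measure)) \<noteq> \<infinity>" by simp
qed

text \<open>The inequality holds for every \<open>x /\<^sub>R norm x\<close>, including the origin,
  which is sent to 0; equality would fail there and require a null set. A bound on the closed ball
  is enough to integrate continuous functions.\<close>

lemma AE_sphere_measure: "AE x in (sphere_measure :: (real^'n::finite) measure). norm x \<le> 1"
proof -
  have "nn_integral sphere_measure (indicator {x::real^'n. \<not> norm x \<le> 1} :: real^'n \<Rightarrow> ennreal) = 0"
  proof (subst nn_integral_sphere_measure)
    have "indicator {x::real^'n. \<not> norm x \<le> 1} (x /\<^sub>R norm x) = (0::ennreal)" for x :: "real^'n"
      by (cases "x = 0") auto
    then show "ennreal (real CARD('n)) *
      (\<integral>\<^sup>+x\<in>ball 0 1. indicator {x::real^'n. \<not> norm x \<le> 1} (x /\<^sub>R norm x) \<partial>lborel) = 0" by simp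
  qed simp
  then have "emeasure sphere_measure {x::real^'n. \<not> norm x \<le> 1} = 0"
    by (subst (asm) nn_integral_indicator) auto
  then show ?thesis by (subst AE_iff_measurable[OF _ refl]) auto
qed

lemma integrable_sphere_measure:
  fixes g :: "real^'n::finite \<Rightarrow> 'a::{second_countable_topology, banach}"
  assumes g: "continuous_on UNIV g"
  shows "integrable sphere_measure g"
proof -
  have "compact (g ` cball 0 1)"
    by (intro compact_continuous_image continuous_on_subset[OF g]) auto
  then obtain B where "\<And>x. norm x \<le> 1 \<Longrightarrow> norm (g x) \<le> B"
    by (fastforce dest: compact_imp_bounded simp: bounded_iff)
  then have "AE x in sphere_measure. norm (g x) \<le> B"
    using AE_sphere_measure by (auto elim!: eventually_mono)
  moreover have "g \<in> borel_measurable sphere_measure"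
    using borel_measurable_continuous_onI[OF g] by simp
  ultimately show ?thesis
    by (intro finite_measure.integrable_const_bound[OF finite_sphere_measure])
qed

text \<open>A homogeneous function is largest on the sphere along each ray, so its mean square over the
  ball is controlled by the one over the sphere.\<close>

lemma nn_integral_ball_le_sphere:
  fixes q :: "real^'n::finite \<Rightarrow> complex"
  assumes "continuous_on UNIV q" "homogeneous k q"
  shows "(\<integral>\<^sup>+x\<in>ball 0 1. ennreal ((norm (q x))\<^sup>2) \<partial>lborel) \<le> ennreal (LINT x|sphere_measure. (norm (q x))\<^sup>2)"
proof -
  have [measurable]: "q \<in> borel_measurable borel"
    using assms(1) by (rule borel_measurable_continuous_onI)
  have "(\<integral>\<^sup>+x\<in>ball 0 1. ennreal ((norm (q x))\<^sup>2) \<partial>lborel) \<le>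
        (\<integral>\<^sup>+x\<in>ball 0 1. ennreal ((norm (q (x /\<^sub>R norm x)))\<^sup>2) \<partial>lborel)"
  proof (rule nn_integral_mono)
    fix x :: "real^'n"
    have "norm (q x) \<le> norm (q (x /\<^sub>R norm x))" if "norm x < 1"
    proof (cases "x = 0")
      case False
      have "q x = of_real (norm x) ^ k * q (x /\<^sub>R norm x)"
      proof -
        have "q (norm x *\<^sub>R (x /\<^sub>R norm x)) = of_real (norm x) ^ k * q (x /\<^sub>R norm x)"
          using assms(2) unfolding homogeneous_def by blast
        then show ?thesis using False by simp
      qed
      then have "norm (q x) = norm x ^ k * norm (q (x /\<^sub>R norm x))"
        by (simp add: norm_mult norm_power)
      then show ?thesis using that by (simp add: mult_left_le_one_le power_le_one)
    qed simp
    then show "ennreal ((norm (q x))\<^sup>2) * indicator (ball 0 1) x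
      \<le> ennreal ((norm (q (x /\<^sub>R norm x)))\<^sup>2) * indicator (ball 0 1) x"
      by (auto simp: indicator_def intro!: ennreal_leI power_mono)
  qed
  also have "\<dots> \<le> ennreal (real CARD('n)) * (\<integral>\<^sup>+x\<in>ball 0 1. ennreal ((norm (q (x /\<^sub>R norm x)))\<^sup>2) \<partial>lborel)"
  proof -
    have "1 \<le> ennreal (real CARD('n))" by (simp add: Suc_leI)
    from mult_right_mono[OF this] show ?thesis by fastforce
  qed
  also have "\<dots> = nn_integral sphere_measure (\<lambda>x::real^'n. ennreal ((norm (q x))\<^sup>2))"
    by (subst nn_integral_sphere_measure) auto
  also have "\<dots> = ennreal (LINT x|sphere_measure. (norm (q x))\<^sup>2)"
    by (intro nn_integral_eq_integral integrable_sphere_measure continuous_intros assms(1)) auto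
  finally show ?thesis .
qed

text \<open>Let \<open>M\<close> be the maximum on the sphere. Close to a point where it is attained
  there is a ball of radius \<open>\<eta>\<close> inside the unit ball on which
  \<open>norm (q x)\<close> is at least \<open>M / 4\<close>. So the integral of the square over the
  unit ball is at least \<open>(M / 4)^2\<close> times the volume of the small ball, and
  \<open>nn_integral_ball_le_sphere\<close> passes to the sphere. The exponent comes from that
  volume, \<open>\<eta>\<close> being of order \<open>(k + 1) ^ (-3)\<close>.\<close>

lemma homogeneous_sphere_bound:
  obtains A :: real where "A \<ge> 0"
    "\<And>k (q :: real^'n::finite \<Rightarrow> complex) \<theta>. \<lbrakk>polynomial_function q; homogeneous k q; norm \<theta> = 1\<rbrakk> \<Longrightarrow>
       (norm (q \<theta>))\<^sup>2 \<le> A * (real k + 1) ^ (3 * CARD('n)) * (LINT x|sphere_measure. (norm (q x))\<^sup>2)"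
proof
  define V where "V = unit_ball_vol (real CARD('n))"
  have V: "V > 0" by (simp add: V_def)
  show "16 * 32 ^ CARD('n) / V \<ge> 0" using V by simp
  fix k and q :: "real^'n \<Rightarrow> complex" and \<theta> :: "real^'n"
  assume q: "polynomial_function q" "homogeneous k q" and \<theta>: "norm \<theta> = 1"
  let ?I = "LINT x|sphere_measure. (norm (q x))\<^sup>2"
  have I: "?I \<ge> 0" by simp
  have cont: "continuous_on UNIV q" by (rule polynomial_function_continuous[OF q(1)])
  obtain \<theta>\<^sub>0 where \<theta>\<^sub>0: "norm \<theta>\<^sub>0 = 1" "\<And>\<theta>. norm \<theta> = 1 \<Longrightarrow> norm (q \<theta>) \<le> norm (q \<theta>\<^sub>0)"
    using sphere_bound_exists[OF cont] by blast
  define M where "M = norm (q \<theta>\<^sub>0)"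
  \<comment> \<open>Bernoulli's inequality gives \<open>(1 - \<delta>) ^ k \<ge> 1/2\<close>, so at
    most half of \<open>M\<close> is lost at \<open>y\<close>, while the ball of radius
    \<open>\<delta>\<close> around \<open>y\<close> stays in the closed unit ball. With
    \<open>\<eta>\<close> the increment bound \<open>4 (k + 1)^2 M \<eta> / \<delta>\<close> is
    exactly \<open>M / 4\<close>.\<close>
  define \<delta> where "\<delta> = 1 / (2 * (real k + 1))"
  define \<eta> where "\<eta> = 1 / (32 * (real k + 1) ^ 3)"
  define y where "y = (1 - \<delta>) *\<^sub>R \<theta>\<^sub>0"
  have "M \<ge> 0" by (simp add: M_def)
  have \<delta>: "0 < \<delta>" "\<delta> \<le> 1/2" by (auto simp: \<delta>_def divide_simps)
  have "\<eta> > 0" by (auto simp: \<eta>_def)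
  have \<eta>: "\<eta> \<le> \<delta> / 2"
  proof -
    have "real k + 1 \<le> (real k + 1) ^ 3" by (rule self_le_power) auto
    moreover have "0 \<le> (real k + 1) ^ 3" by simp
    moreover have "4 * x \<le> 32 * y" if "x \<le> y" "0 \<le> y" for x y :: real using that by linarith
    ultimately have "4 * (real k + 1) \<le> 32 * (real k + 1) ^ 3" by blast
    then have "1 / (32 * (real k + 1) ^ 3) \<le> 1 / (4 * (real k + 1))" by (intro divide_left_mono) auto
    then show ?thesis by (simp add: \<eta>_def \<delta>_def)
  qed
  have qM: "norm (q x) \<le> M" if "norm x \<le> 1" for x
    using homogeneous_bound[OF q(2) \<theta>\<^sub>0(2) that unit_vector_exists] by (simp add: M_def)
  have y: "norm y = 1 - \<delta>" using \<delta> by (simp add: y_def \<theta>\<^sub>0(1))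
  have "M / 2 \<le> (1 - \<delta>) ^ k * M"
  proof -
    have "1/2 \<le> 1 + real k * (- \<delta>)" by (simp add: \<delta>_def field_simps)
    also have "\<dots> \<le> (1 + (- \<delta>)) ^ k" using \<delta> by (intro Bernoulli_inequality) auto
    finally show ?thesis using mult_right_mono[OF _ \<open>M \<ge> 0\<close>, of "1/2" "(1 - \<delta>) ^ k"] by simp
  qed
  also have "(1 - \<delta>) ^ k * M = norm (q y)"
    using q(2) \<delta> by (simp add: y_def homogeneous_def norm_mult norm_power M_def flip: of_real_diff
        del: of_real_diff)
  finally have qy: "M / 2 \<le> norm (q y)" .
  have lower: "M / 4 \<le> norm (q x)" if "x \<in> ball y \<eta>" for x
  proof -
    have d: "norm (x - y) \<le> \<eta>" using that by (simp add: dist_norm norm_minus_commute)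
    have "norm (q (y + (x - y)) - q y) \<le> 4 * (real k + 1)\<^sup>2 * M * (norm (x - y) / \<delta>)"
    proof (rule poly_degree_le_increment[OF homogeneous_poly_degree_le[OF q] \<delta>(1)])
      fix z assume "norm (z - y) \<le> \<delta>"
      then have "norm z \<le> 1" using y norm_triangle_sub[of z y] by linarith
      then show "norm (q z) \<le> M" by (rule qM)
    qed (use d \<eta> in linarith)
    also have "\<dots> \<le> 4 * (real k + 1)\<^sup>2 * M * (\<eta> / \<delta>)"
      using d \<delta>(1) \<open>M \<ge> 0\<close> by (intro mult_left_mono divide_right_mono) auto
    also have "\<dots> = M / 4"
    proof -
      have "4 * K\<^sup>2 * M * (1 / (32 * K ^ 3) / (1 / (2 * K))) = M / 4" if "K > 0" for K :: real
        using that by (simp add: power2_eq_square power3_eq_cube)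
      from this[of "real k + 1"] show ?thesis by (simp add: \<eta>_def \<delta>_def)
    qed
    finally have "norm (q x - q y) \<le> M / 4" by simp
    with qy norm_triangle_sub[of "q y" "q x"] show ?thesis
      by (simp add: norm_minus_commute)
  qed
  have sub: "ball y \<eta> \<subseteq> ball 0 1"
  proof
    fix x assume "x \<in> ball y \<eta>"
    then have "norm (x - y) < \<eta>" by (simp add: dist_norm norm_minus_commute)
    then show "x \<in> ball 0 1" using y \<eta> \<delta> norm_triangle_sub[of x y] by simp
  qed
  have "ennreal ((M/4)\<^sup>2 * (V * \<eta> ^ CARD('n))) = ennreal ((M/4)\<^sup>2) * emeasure lborel (ball y \<eta>)"
    using \<open>\<eta> > 0\<close> by (simp add: emeasure_ball V_def ennreal_mult)
  also have "\<dots> = (\<integral>\<^sup>+x\<in>ball y \<eta>. ennreal ((M/4)\<^sup>2) \<partial>lborel)"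
    by (simp add: nn_integral_cmult_indicator)
  also have "\<dots> \<le> (\<integral>\<^sup>+x\<in>ball 0 1. ennreal ((norm (q x))\<^sup>2) \<partial>lborel)"
  proof (rule nn_integral_mono)
    fix x
    show "ennreal ((M/4)\<^sup>2) * indicator (ball y \<eta>) x \<le> ennreal ((norm (q x))\<^sup>2) * indicator (ball 0 1) x"
      using lower[of x] sub \<open>M \<ge> 0\<close>
      by (cases "x \<in> ball y \<eta>") (auto intro!: ennreal_leI power_mono)
  qed
  also have "\<dots> \<le> ennreal ?I" by (rule nn_integral_ball_le_sphere[OF cont q(2)])
  finally have "(M/4)\<^sup>2 * (V * \<eta> ^ CARD('n)) \<le> ?I" using I by (simp add: ennreal_le_iff)
  moreover have "(M/4)\<^sup>2 * (V * \<eta> ^ CARD('n)) = M\<^sup>2 / (16 * 32 ^ CARD('n) / V * (real k + 1) ^ (3 * CARD('n)))"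
  proof -
    have "\<eta> ^ CARD('n) = 1 / (32 ^ CARD('n) * (real k + 1) ^ (3 * CARD('n)))"
      by (simp add: \<eta>_def power_divide power_mult_distrib power_mult)
    then show ?thesis using V by (simp add: power_divide)
  qed
  ultimately have "M\<^sup>2 \<le> ?I * (16 * 32 ^ CARD('n) / V * (real k + 1) ^ (3 * CARD('n)))"
    using V by (simp add: pos_divide_le_eq pos_le_divide_eq)
  moreover have "(norm (q \<theta>))\<^sup>2 \<le> M\<^sup>2" using qM[of \<theta>] \<theta> by (intro power_mono) auto
  ultimately show "(norm (q \<theta>))\<^sup>2 \<le> 16 * 32 ^ CARD('n) / V * (real k + 1) ^ (3 * CARD('n)) * ?I"
    by (simp add: mult.commute)
qed

section \<open>Orthonormal systems of spherical harmonics of a fixed degree\<close>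

lemma orthonormal_harmonics_mem:
  fixes Y :: "nat \<Rightarrow> nat \<Rightarrow> real^'n::finite \<Rightarrow> complex"
  assumes "orthonormal_harmonics Y" "l \<in> {1..harmonic_dim TYPE('n) k}"
  shows "Y k l \<in> harmonic_space k"
  using assms fun_space.span_base[of "Y k l" "Y k ` {1..harmonic_dim TYPE('n) k}"]
  by (auto simp: orthonormal_harmonics_def)

lemma harmonic_spaceD:
  assumes "q \<in> harmonic_space k"
  shows "polynomial_function q" "homogeneous k q" "laplacian q x = 0"
  using assms by (auto simp: harmonic_space_def homogeneous_def)

lemma polynomial_function_cmult:
  fixes f :: "'a::real_normed_vector \<Rightarrow> complex"
  assumes "polynomial_function f"
  shows "polynomial_function (\<lambda>x. c * f x)"
proof -
  have "polynomial_function ((*) c \<circ> f)"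
    by (intro polynomial_function_compose assms polynomial_function_bounded_linear bounded_linear_mult_right)
  then show ?thesis by (simp add: o_def)
qed

text \<open>Parseval's identity within one degree, proved in the complex numbers, where the squared
  modulus factors with the conjugate.\<close>

lemma orthonormal_harmonics_norm:
  fixes Y :: "nat \<Rightarrow> nat \<Rightarrow> real^'n::finite \<Rightarrow> complex"
  assumes Y: "orthonormal_harmonics Y"
  shows "(LINT \<theta>|sphere_measure. (norm (\<Sum>l=1..harmonic_dim TYPE('n) k. a l * Y k l \<theta>))\<^sup>2) =
    (\<Sum>l=1..harmonic_dim TYPE('n) k. (norm (a l))\<^sup>2)"
proof -
  let ?L = "{1..harmonic_dim TYPE('n) k}"
  have cont: "continuous_on UNIV (Y k l)" if "l \<in> ?L" for l
    using harmonic_spaceD(1)[OF orthonormal_harmonics_mem[OF Y that]] by (rule polynomial_function_continuous)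
  have int: "integrable sphere_measure (\<lambda>\<theta>. a l * cnj (a m) * (Y k l \<theta> * cnj (Y k m \<theta>)))"
    if "l \<in> ?L" "m \<in> ?L" for l m
    using that by (intro integrable_sphere_measure continuous_intros cont)
  have "complex_of_real (LINT \<theta>|sphere_measure. (norm (\<Sum>l\<in>?L. a l * Y k l \<theta>))\<^sup>2) =
     (LINT \<theta>|sphere_measure. complex_of_real ((norm (\<Sum>l\<in>?L. a l * Y k l \<theta>))\<^sup>2))"
    by (rule integral_complex_of_real[symmetric])
  also have "\<dots> = (LINT \<theta>|sphere_measure. (\<Sum>l\<in>?L. \<Sum>m\<in>?L. a l * cnj (a m) * (Y k l \<theta> * cnj (Y k m \<theta>))))"
    by (simp only: complex_norm_square cnj_sum sum_product complex_cnj_mult mult_ac)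
  also have "\<dots> = (\<Sum>l\<in>?L. \<Sum>m\<in>?L. a l * cnj (a m) * (if l = m then 1 else 0))"
  proof -
    have "(LINT \<theta>|sphere_measure. (\<Sum>l\<in>?L. \<Sum>m\<in>?L. a l * cnj (a m) * (Y k l \<theta> * cnj (Y k m \<theta>)))) =
      (\<Sum>l\<in>?L. (LINT \<theta>|sphere_measure. (\<Sum>m\<in>?L. a l * cnj (a m) * (Y k l \<theta> * cnj (Y k m \<theta>)))))"
      by (intro Bochner_Integration.integral_sum Bochner_Integration.integrable_sum int)
    also have "\<dots> = (\<Sum>l\<in>?L. \<Sum>m\<in>?L. (LINT \<theta>|sphere_measure. a l * cnj (a m) * (Y k l \<theta> * cnj (Y k m \<theta>))))"
      by (intro sum.cong refl Bochner_Integration.integral_sum int)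
    also have "\<dots> = (\<Sum>l\<in>?L. \<Sum>m\<in>?L. a l * cnj (a m) * (if l = m then 1 else 0))"
    proof (intro sum.cong refl)
      fix l m assume "l \<in> ?L" "m \<in> ?L"
      then have "(LINT \<theta>|sphere_measure. Y k l \<theta> * cnj (Y k m \<theta>)) = (if l = m then 1 else 0)"
        using Y by (simp add: orthonormal_harmonics_def)
      then show "(LINT \<theta>|sphere_measure. a l * cnj (a m) * (Y k l \<theta> * cnj (Y k m \<theta>))) =
        a l * cnj (a m) * (if l = m then 1 else 0)" by simp
    qed
    finally show ?thesis .
  qed
  also have "\<dots> = of_real (\<Sum>l\<in>?L. (norm (a l))\<^sup>2)"
    by (simp add: complex_norm_square if_distrib del: of_real_power cong: if_cong)
  finally show ?thesis using of_real_eq_iff by blast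
qed

lemma harmonic_sum:
  fixes Y :: "nat \<Rightarrow> nat \<Rightarrow> real^'n::finite \<Rightarrow> complex"
  assumes Y: "orthonormal_harmonics Y"
  shows "polynomial_function (\<lambda>x. \<Sum>l=1..harmonic_dim TYPE('n) k. a l * Y k l x)"
    and "homogeneous k (\<lambda>x. \<Sum>l=1..harmonic_dim TYPE('n) k. a l * Y k l x)"
  using harmonic_spaceD[OF orthonormal_harmonics_mem[OF Y, of _ k]]
  by (auto intro!: polynomial_function_sum polynomial_function_cmult sum.cong
      simp: homogeneous_def sum_distrib_left mult_ac)

text \<open>The sum over \<open>l\<close> is treated as a single homogeneous polynomial whose
  integral Parseval's identity evaluates. Estimating every \<open>Y k l\<close> separately would
  bring in the number of terms \<open>harmonic_dim\<close>.\<close>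

lemma harmonic_sum_bound:
  obtains A :: real where "A \<ge> 0"
    "\<And>(Y :: nat \<Rightarrow> nat \<Rightarrow> real^'n::finite \<Rightarrow> complex) k a \<theta>. \<lbrakk>orthonormal_harmonics Y; norm \<theta> = 1\<rbrakk> \<Longrightarrow>
       norm (\<Sum>l=1..harmonic_dim TYPE('n) k. a l * Y k l \<theta>) \<le>
       A * (real k + 1) ^ (3 * CARD('n)) * sqrt (\<Sum>l=1..harmonic_dim TYPE('n) k. (norm (a l))\<^sup>2)"
proof -
  obtain A :: real where A: "A \<ge> 0"
    "\<And>k (q :: real^'n \<Rightarrow> complex) \<theta>. \<lbrakk>polynomial_function q; homogeneous k q; norm \<theta> = 1\<rbrakk> \<Longrightarrow>
       (norm (q \<theta>))\<^sup>2 \<le> A * (real k + 1) ^ (3 * CARD('n)) * (LINT x|sphere_measure. (norm (q x))\<^sup>2)"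
    by (rule homogeneous_sphere_bound[where 'n = 'n]) blast
  have "norm (\<Sum>l=1..harmonic_dim TYPE('n) k. a l * Y k l \<theta>) \<le>
       sqrt A * (real k + 1) ^ (3 * CARD('n)) * sqrt (\<Sum>l=1..harmonic_dim TYPE('n) k. (norm (a l))\<^sup>2)"
    if Y: "orthonormal_harmonics Y" and \<theta>: "norm \<theta> = 1"
    for Y :: "nat \<Rightarrow> nat \<Rightarrow> real^'n \<Rightarrow> complex" and k a \<theta>
  proof (rule power2_le_imp_le)
    let ?S = "\<Sum>l=1..harmonic_dim TYPE('n) k. (norm (a l))\<^sup>2" and ?K = "(real k + 1) ^ (3 * CARD('n))"
    have "(norm (\<Sum>l=1..harmonic_dim TYPE('n) k. a l * Y k l \<theta>))\<^sup>2 \<le> A * ?K * ?S"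
      using A(2)[OF harmonic_sum[OF Y] \<theta>] by (simp only: orthonormal_harmonics_norm[OF Y])
    \<comment> \<open>Enlarging \<open>?K\<close> to its square gives a perfect square and avoids
      half-integer exponents.\<close>
    also have "\<dots> \<le> A * ?K\<^sup>2 * ?S"
    proof -
      have "?K \<le> ?K\<^sup>2" by (rule self_le_power) auto
      then show ?thesis using A(1) by (intro mult_right_mono mult_left_mono sum_nonneg) auto
    qed
    also have "\<dots> = (sqrt A * ?K * sqrt ?S)\<^sup>2"
      using A(1) by (simp add: power_mult_distrib sum_nonneg)
    finally show "(norm (\<Sum>l=1..harmonic_dim TYPE('n) k. a l * Y k l \<theta>))\<^sup>2 \<le> (sqrt A * ?K * sqrt ?S)\<^sup>2" .
  qed (use A(1) in \<open>auto intro!: mult_nonneg_nonneg sum_nonneg\<close>)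
  then show ?thesis using that[of "sqrt A"] A(1) by auto
qed

section \<open>Series of polynomials\<close>

text \<open>Induction on \<open>m\<close>: one factor \<open>k + 1\<close> is absorbed by raising
  the ratio from \<open>\<sigma>\<close> to the midpoint \<open>\<upsilon>\<close> between
  \<open>\<sigma>\<close> and 1, because
  \<open>(k + 1) x^k \<le> 1 + x + ... + x^k \<le> 1 / (1 - x)\<close> at
  \<open>x = \<sigma> / \<upsilon>\<close>.\<close>

lemma polynomial_geometric_bound:
  fixes \<tau> :: real
  assumes "0 \<le> \<tau>" "\<tau> < 1"
  obtains C \<sigma> where "0 \<le> \<sigma>" "\<sigma> < 1" "0 \<le> C" "\<And>k. (real k + 1) ^ m * \<tau> ^ k \<le> C * \<sigma> ^ k"
proof -
  have "\<exists>C \<sigma>. 0 \<le> \<sigma> \<and> \<sigma> < 1 \<and> 0 \<le> C \<and> (\<forall>k. (real k + 1) ^ m * \<tau> ^ k \<le> C * \<sigma> ^ k)"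
  proof (induction m)
    case 0
    then show ?case using assms by (intro exI[of _ 1] exI[of _ \<tau>]) auto
  next
    case (Suc m)
    then obtain C \<sigma> where \<sigma>: "0 \<le> \<sigma>" "\<sigma> < 1" "0 \<le> C" and le: "\<And>k. (real k + 1) ^ m * \<tau> ^ k \<le> C * \<sigma> ^ k"
      by blast
    define \<upsilon> where "\<upsilon> = (1 + \<sigma>) / 2"
    have \<upsilon>: "0 < \<upsilon>" "\<upsilon> < 1" "\<sigma> < \<upsilon>" using \<sigma> by (auto simp: \<upsilon>_def)
    define c where "c = 1 - \<sigma> / \<upsilon>"
    have c: "0 < c" "c \<le> 1" using \<upsilon> \<sigma> by (auto simp: c_def)
    have "(real k + 1) ^ Suc m * \<tau> ^ k \<le> (C / c) * \<upsilon> ^ k" for k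
    proof -
      have "(real k + 1) * \<sigma> ^ k \<le> (1 / c) * \<upsilon> ^ k"
      proof -
        have "(real k + 1) * (c * (\<sigma> / \<upsilon>) ^ k) \<le> (\<Sum>i<Suc k. c * (\<sigma> / \<upsilon>) ^ i)"
        proof -
          have "(\<Sum>i<Suc k. c * (\<sigma> / \<upsilon>) ^ k) \<le> (\<Sum>i<Suc k. c * (\<sigma> / \<upsilon>) ^ i)"
            using \<sigma> \<upsilon> c by (intro sum_mono mult_left_mono power_decreasing) auto
          then show ?thesis by (simp add: algebra_simps)
        qed
        also have "\<dots> = 1 - (\<sigma> / \<upsilon>) ^ Suc k"
        proof -
          have "\<sigma> / \<upsilon> \<noteq> 1" using \<upsilon> by auto
          then show ?thesis
            unfolding sum_distrib_left[symmetric]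
            using one_diff_power_eq[of "\<sigma> / \<upsilon>" "Suc k"] by (simp add: c_def)
        qed
        also have "\<dots> \<le> 1" using \<sigma> \<upsilon> by simp
        finally have "(real k + 1) * (c * (\<sigma> / \<upsilon>) ^ k) \<le> 1" .
        then show ?thesis using c \<upsilon> by (simp add: power_divide field_simps)
      qed
      then have *: "C * ((real k + 1) * \<sigma> ^ k) \<le> C * ((1 / c) * \<upsilon> ^ k)" using \<sigma>(3) by (rule mult_left_mono)
      have "(real k + 1) ^ Suc m * \<tau> ^ k = (real k + 1) * ((real k + 1) ^ m * \<tau> ^ k)" by simp
      also have "\<dots> \<le> (real k + 1) * (C * \<sigma> ^ k)" using le[of k] by (rule mult_left_mono) auto
      also have "\<dots> = C * ((real k + 1) * \<sigma> ^ k)" by (simp only: mult_ac)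
      also note *
      finally show ?thesis by simp
    qed
    then show ?case using \<upsilon> c \<sigma>(3) by (intro exI[of _ "C / c"] exI[of _ \<upsilon>]) auto
  qed
  then show ?thesis using that by blast
qed

text \<open>The bound on the degrees of the terms, growing linearly in \<open>k\<close>, makes the class closed under
  termwise differentiation.\<close>

definition poly_series :: "real \<Rightarrow> nat \<Rightarrow> (nat \<Rightarrow> real^'n::finite \<Rightarrow> complex) \<Rightarrow> bool" where
  "poly_series b D q \<longleftrightarrow> (\<forall>k. poly_degree_le (k + D) (q k)) \<and>
     (\<forall>\<rho><b. \<exists>C \<tau>. 0 \<le> \<tau> \<and> \<tau> < 1 \<and> (\<forall>k x. norm x \<le> \<rho> \<longrightarrow> norm (q k x) \<le> C * \<tau> ^ k))"

lemma poly_seriesE: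
  assumes "poly_series b D q" "\<rho> < b"
  obtains C \<tau> where "0 \<le> \<tau>" "\<tau> < 1" "0 \<le> C" "\<And>k x. norm x \<le> \<rho> \<Longrightarrow> norm (q k x) \<le> C * \<tau> ^ k"
proof -
  from assms obtain C \<tau> where 1: "0 \<le> \<tau>" "\<tau> < 1" "\<And>k x. norm x \<le> \<rho> \<Longrightarrow> norm (q k x) \<le> C * \<tau> ^ k"
    unfolding poly_series_def by blast
  have "norm (q k x) \<le> \<bar>C\<bar> * \<tau> ^ k" if "norm x \<le> \<rho>" for k x
    using 1(3)[OF that, of k] mult_right_mono[OF abs_ge_self[of C] zero_le_power[OF 1(1), of k]] by linarith
  then show ?thesis using that[of \<tau> "\<bar>C\<bar>"] 1 by auto
qed

lemma poly_series_summable: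
  assumes "poly_series b D q" "x \<in> ball 0 b"
  shows "summable (\<lambda>k. norm (q k x))"
proof -
  have "norm x < b" using assms(2) by simp
  then obtain C \<tau> where 1: "0 \<le> \<tau>" "\<tau> < 1" "0 \<le> C" "\<And>k. norm (q k x) \<le> C * \<tau> ^ k"
    by (rule poly_seriesE[OF assms(1)]) blast
  have "summable (\<lambda>k. C * \<tau> ^ k)" using 1 by (intro summable_mult summable_geometric) auto
  then show ?thesis by (rule summable_comparison_test') (use 1 in auto)
qed

text \<open>The derivatives for radius \<open>\<rho>\<close> are controlled by the terms on the
  radius half way to \<open>b\<close>. The cost \<open>(k + D + 1)^2\<close> is polynomial in
  \<open>k\<close>, precisely because the degrees grow linearly, and a larger geometric ratio
  absorbs it.\<close>

lemma poly_series_partial_deriv: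
  assumes ps: "poly_series b D q"
  shows "poly_series b D (\<lambda>k. partial_deriv i (q k))"
  unfolding poly_series_def
proof (intro conjI allI impI)
  fix k show "poly_degree_le (k + D) (partial_deriv i (q k))"
    using ps by (auto simp: poly_series_def intro: poly_degree_le_partial_deriv)
next
  fix \<rho> assume "\<rho> < b"
  define \<delta> where "\<delta> = (b - \<rho>) / 2"
  have \<delta>: "\<delta> > 0" "\<rho> + \<delta> < b" using \<open>\<rho> < b\<close> by (auto simp: \<delta>_def field_simps)
  obtain C \<tau> where C: "0 \<le> \<tau>" "\<tau> < 1" "0 \<le> C" "\<And>k x. norm x \<le> \<rho> + \<delta> \<Longrightarrow> norm (q k x) \<le> C * \<tau> ^ k"
    by (rule poly_seriesE[OF ps \<delta>(2)]) blast
  obtain C' \<sigma> where \<sigma>: "0 \<le> \<sigma>" "\<sigma> < 1" "0 \<le> C'" "\<And>k. (real k + 1) ^ 2 * \<tau> ^ k \<le> C' * \<sigma> ^ k"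
    by (rule polynomial_geometric_bound[OF C(1,2)]) blast
  have "norm (partial_deriv i (q k) x) \<le> (4 * (real D + 1)\<^sup>2 * C / \<delta> * C') * \<sigma> ^ k" if "norm x \<le> \<rho>" for k x
  proof -
    have "norm (partial_deriv i (q k) x) \<le> 4 * (real (k + D) + 1)\<^sup>2 * (C * \<tau> ^ k) / \<delta>"
    proof (rule poly_degree_le_partial_deriv_bound[OF _ \<delta>(1)])
      show "poly_degree_le (k + D) (q k)" using ps by (auto simp: poly_series_def)
      fix y assume "norm (y - x) \<le> \<delta>"
      then show "norm (q k y) \<le> C * \<tau> ^ k" using that norm_triangle_sub[of y x] by (intro C) auto
    qed
    also have "\<dots> \<le> 4 * ((real D + 1) * (real k + 1))\<^sup>2 * (C * \<tau> ^ k) / \<delta>"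
      using C \<delta> by (intro divide_right_mono mult_right_mono mult_left_mono power_mono) (auto simp: algebra_simps)
    also have "\<dots> = 4 * (real D + 1)\<^sup>2 * C / \<delta> * ((real k + 1)\<^sup>2 * \<tau> ^ k)"
      by (simp add: power_mult_distrib)
    also have "\<dots> \<le> 4 * (real D + 1)\<^sup>2 * C / \<delta> * (C' * \<sigma> ^ k)"
      using C \<delta> \<sigma> by (intro mult_left_mono) auto
    finally show ?thesis by simp
  qed
  then show "\<exists>C \<tau>. 0 \<le> \<tau> \<and> \<tau> < 1 \<and> (\<forall>k x. norm x \<le> \<rho> \<longrightarrow> norm (partial_deriv i (q k) x) \<le> C * \<tau> ^ k)"
    using \<sigma>(1,2) by blast
qed

lemma poly_series_add:
  assumes "poly_series b D p" "poly_series b D q"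
  shows "poly_series b D (\<lambda>k x. p k x + q k x)"
  unfolding poly_series_def
proof (intro conjI allI impI)
  fix k
  from assms obtain A B where AB: "\<And>x. norm (p k x) \<le> A * (1 + norm x) ^ (k + D)" "\<And>x. norm (q k x) \<le> B * (1 + norm x) ^ (k + D)"
    "polynomial_function (p k)" "polynomial_function (q k)"
    unfolding poly_series_def poly_degree_le_def by metis
  have "norm (p k x + q k x) \<le> (A + B) * (1 + norm x) ^ (k + D)" for x
    using norm_triangle_mono[OF AB(1) AB(2)] by (simp add: distrib_right)
  then show "poly_degree_le (k + D) (\<lambda>x. p k x + q k x)" using AB(3,4) by (auto simp: poly_degree_le_def)
next
  fix \<rho> assume \<rho>: "\<rho> < b"
  obtain A \<sigma> where A: "0 \<le> \<sigma>" "\<sigma> < 1" "0 \<le> A" "\<And>k x. norm x \<le> \<rho> \<Longrightarrow> norm (p k x) \<le> A * \<sigma> ^ k"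
    by (rule poly_seriesE[OF assms(1) \<rho>]) blast
  obtain B \<tau> where B: "0 \<le> \<tau>" "\<tau> < 1" "0 \<le> B" "\<And>k x. norm x \<le> \<rho> \<Longrightarrow> norm (q k x) \<le> B * \<tau> ^ k"
    by (rule poly_seriesE[OF assms(2) \<rho>]) blast
  have "norm (p k x + q k x) \<le> (A + B) * max \<sigma> \<tau> ^ k" if "norm x \<le> \<rho>" for k x
  proof -
    have "norm (p k x + q k x) \<le> A * \<sigma> ^ k + B * \<tau> ^ k"
      by (rule norm_triangle_mono[OF A(4)[OF that] B(4)[OF that]])
    also have "\<dots> \<le> A * max \<sigma> \<tau> ^ k + B * max \<sigma> \<tau> ^ k"
      using A B by (intro add_mono mult_left_mono power_mono) auto
    finally show ?thesis by (simp add: distrib_right)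
  qed
  then show "\<exists>C \<tau>. 0 \<le> \<tau> \<and> \<tau> < 1 \<and> (\<forall>k x. norm x \<le> \<rho> \<longrightarrow> norm (p k x + q k x) \<le> C * \<tau> ^ k)"
    using A B by (intro exI[of _ "A + B"] exI[of _ "max \<sigma> \<tau>"]) auto
qed

lemma poly_series_zero: "poly_series b D (\<lambda>k x. 0)"
  unfolding poly_series_def poly_degree_le_def
proof (intro conjI allI impI)
  show "\<exists>C. \<forall>x. norm (0::complex) \<le> C * (1 + norm x) ^ (k + D)" for k by (rule exI[of _ 0]) simp
  show "\<exists>C \<tau>. 0 \<le> \<tau> \<and> \<tau> < 1 \<and> (\<forall>k x. norm x \<le> \<rho> \<longrightarrow> norm (0::complex) \<le> C * \<tau> ^ k)" for \<rho>
    by (rule exI[of _ 0], rule exI[of _ 0]) simp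
qed simp

lemma poly_series_sum:
  assumes "finite I" "\<And>i. i \<in> I \<Longrightarrow> poly_series b D (q i)"
  shows "poly_series b D (\<lambda>k x. \<Sum>i\<in>I. q i k x)"
  using assms by (induction I rule: finite_induct) (auto simp: poly_series_zero intro: poly_series_add)

lemma poly_series_laplacian:
  assumes "poly_series b D q"
  shows "poly_series b D (\<lambda>k. laplacian (q k))"
  unfolding laplacian_def[abs_def] using assms by (intro poly_series_sum poly_series_partial_deriv) auto

section \<open>Termwise differentiation of such series\<close>

lemma has_derivative_partial_deriv:
  assumes "(u has_derivative D) (at x)"
  shows "D h = (\<Sum>i\<in>UNIV. h $ i *\<^sub>R partial_deriv i u x)"
proof -
  have lin: "linear D" using assms by (simp add: has_derivative_linear)
  have "D h = D (\<Sum>i\<in>UNIV. h $ i *\<^sub>R axis i 1)"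
    using basis_expansion[of h] by (simp add: scalar_mult_eq_scaleR)
  also have "\<dots> = (\<Sum>i\<in>UNIV. h $ i *\<^sub>R D (axis i 1))"
    using lin by (simp add: linear_sum linear_scale)
  finally show ?thesis by (simp add: partial_deriv_eq[OF assms])
qed

text \<open>Weierstrass's test for the differentials. The finitely many partial derivatives have
  geometric bounds, whose sum \<open>w k\<close> dominates the operator norm of the
  \<open>k\<close>-th differential on a ball \<open>S\<close> of radius between
  \<open>norm x\<close> and \<open>b\<close>; the tails of \<open>w\<close> give uniform convergence
  on \<open>S\<close>.\<close>

lemma poly_series_has_derivative:
  fixes q :: "nat \<Rightarrow> real^'n::finite \<Rightarrow> complex"
  assumes ps: "poly_series b D q" and x: "x \<in> ball 0 b"
  shows "((\<lambda>x. \<Sum>k. q k x) has_derivative (\<lambda>h. \<Sum>k. frechet_derivative (q k) (at x) h)) (at x)"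
proof -
  obtain \<rho> where \<rho>: "norm x < \<rho>" "\<rho> < b" using x dense by (metis mem_ball_0)
  define S where "S = ball (0::real^'n) \<rho>"
  have "\<forall>i. \<exists>C \<tau>. 0 \<le> \<tau> \<and> \<tau> < 1 \<and> (\<forall>k x. norm x \<le> \<rho> \<longrightarrow> norm (partial_deriv i (q k) x) \<le> C * \<tau> ^ k)"
    using poly_series_partial_deriv[OF ps] \<rho>(2) unfolding poly_series_def by blast
  then obtain C \<tau> where C: "\<And>i. 0 \<le> \<tau> i" "\<And>i. \<tau> i < 1"
    "\<And>i k x. norm x \<le> \<rho> \<Longrightarrow> norm (partial_deriv i (q k) x) \<le> C i * \<tau> i ^ k" by metis
  define w where "w k = (\<Sum>i\<in>UNIV. C i * \<tau> i ^ k)" for k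
  have w: "summable w"
    unfolding w_def using C by (intro summable_sum summable_mult summable_geometric) auto
  have der: "(q k has_derivative frechet_derivative (q k) (at y)) (at y)" for k y
    using ps by (auto simp: poly_series_def poly_degree_le_def frechet_derivative_works[symmetric]
        intro: differentiable_at_polynomial_function)
  have bound: "norm (frechet_derivative (q k) (at y) h) \<le> w k * norm h" if "y \<in> S" for k y h
  proof -
    have "norm (frechet_derivative (q k) (at y) h) \<le> (\<Sum>i\<in>UNIV. norm h * (C i * \<tau> i ^ k))"
      unfolding has_derivative_partial_deriv[OF der]
    proof (rule sum_norm_le)
      fix i
      have "norm (h $ i *\<^sub>R partial_deriv i (q k) y) = \<bar>h $ i\<bar> * norm (partial_deriv i (q k) y)" by simp
      also have "\<dots> \<le> norm h * (C i * \<tau> i ^ k)"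
        using that by (intro mult_mono component_le_norm_cart C(3)) (auto simp: S_def)
      finally show "norm (h $ i *\<^sub>R partial_deriv i (q k) y) \<le> norm h * (C i * \<tau> i ^ k)" .
    qed
    then show ?thesis by (simp add: w_def sum_distrib_left mult.commute)
  qed
  have sm: "summable (\<lambda>k. frechet_derivative (q k) (at y) h)" if "y \<in> S" for y h
    by (rule summable_comparison_test'[OF summable_mult2[OF w, of "norm h"]]) (use bound that in auto)
  have "\<exists>g. \<forall>x\<in>S. (\<lambda>k. q k x) sums g x \<and>
      (g has_derivative (\<lambda>h. \<Sum>k. frechet_derivative (q k) (at x) h)) (at x within S)"
  proof (rule has_derivative_series)
    show "convex S" by (simp add: S_def)
    show "(q k has_derivative frechet_derivative (q k) (at y)) (at y within S)" for k y
      using der by (rule has_derivative_at_withinI)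
    show "x \<in> S" using \<rho> by (simp add: S_def)
    show "(\<lambda>k. q k x) sums (\<Sum>k. q k x)"
      by (rule summable_sums[OF summable_norm_cancel[OF poly_series_summable[OF ps x]]])
    fix e :: real assume "e > 0"
    then obtain M where M: "\<And>n. n \<ge> M \<Longrightarrow> norm (\<Sum>i. w (i + n)) < e"
      using suminf_exist_split[OF _ w] by blast
    have "norm ((\<Sum>i<n. frechet_derivative (q i) (at y) h) - (\<Sum>k. frechet_derivative (q k) (at y) h)) \<le> e * norm h"
      if n: "n \<ge> M" and y: "y \<in> S" for n y h
    proof -
      have "(\<Sum>i<n. frechet_derivative (q i) (at y) h) - (\<Sum>k. frechet_derivative (q k) (at y) h) =
        - (\<Sum>k. frechet_derivative (q (k + n)) (at y) h)"
        using suminf_minus_initial_segment[OF sm[OF y, of h], of n] by simp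
      also have "norm \<dots> \<le> (\<Sum>k. w (k + n) * norm h)"
        unfolding norm_minus_cancel
        by (intro norm_suminf_le bound y summable_mult2 summable_ignore_initial_segment w)
      also have "\<dots> = (\<Sum>k. w (k + n)) * norm h"
        by (intro suminf_mult2[symmetric] summable_ignore_initial_segment w)
      also have "\<dots> \<le> e * norm h" using M[OF n] by (intro mult_right_mono) auto
      finally show ?thesis .
    qed
    then show "\<forall>\<^sub>F n in sequentially. \<forall>y\<in>S. \<forall>h. norm ((\<Sum>i<n. frechet_derivative (q i) (at y) h)
        - (\<Sum>k. frechet_derivative (q k) (at y) h)) \<le> e * norm h"
      by (intro eventually_sequentiallyI[of M]) blast
  qed
  then obtain g where g: "\<And>y. y \<in> S \<Longrightarrow> (\<lambda>k. q k y) sums g y"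
    "\<And>y. y \<in> S \<Longrightarrow> (g has_derivative (\<lambda>h. \<Sum>k. frechet_derivative (q k) (at y) h)) (at y within S)" by blast
  have xS: "x \<in> S" "open S" using \<rho> by (auto simp: S_def)
  have "(g has_derivative (\<lambda>h. \<Sum>k. frechet_derivative (q k) (at x) h)) (at x)"
    using g(2)[OF xS(1)] unfolding at_within_open[OF xS] .
  then show ?thesis
    by (rule has_derivative_transform_within_open[OF _ xS(2,1)]) (rule sums_unique[OF g(1)])
qed

lemma poly_series_partial_deriv_sum:
  assumes "poly_series b D q" "x \<in> ball 0 b"
  shows "partial_deriv i (\<lambda>x. \<Sum>k. q k x) x = (\<Sum>k. partial_deriv i (q k) x)"
  using partial_deriv_eq[OF poly_series_has_derivative[OF assms]] by (simp add: partial_deriv_def)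

text \<open>\<open>frechet_derivative\<close> chooses among the derivatives at a point. Functions
  that agree near the point have the same ones, so the choices coincide, even where no derivative
  exists.\<close>

lemma partial_deriv_cong_open:
  assumes "open S" "x \<in> S" "\<And>y. y \<in> S \<Longrightarrow> u y = v y"
  shows "partial_deriv i u x = partial_deriv i v x"
proof -
  have "(u has_derivative D) (at x) \<longleftrightarrow> (v has_derivative D) (at x)" for D
    using has_derivative_transform_within_open[OF _ assms(1,2), of u D _ v]
      has_derivative_transform_within_open[OF _ assms(1,2), of v D _ u] assms(3) by auto
  then show ?thesis by (simp add: partial_deriv_def frechet_derivative_def)
qed

lemma laplacian_cong_open:
  assumes "open S" "x \<in> S" "\<And>y. y \<in> S \<Longrightarrow> u y = v y"
  shows "laplacian u x = laplacian v x"
  unfolding laplacian_def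
  using assms by (intro sum.cong refl partial_deriv_cong_open[OF assms(1,2)] partial_deriv_cong_open[OF assms(1)]) auto

text \<open>\<open>partial_deriv\<close> is a total function, whereas the formula for the partial
  derivatives of a series holds only inside the ball of convergence. Iterated derivatives are
  therefore exchanged by locality on an open set.\<close>

lemma times_cont_diff_on_cong:
  assumes "open S" "\<And>y. y \<in> S \<Longrightarrow> u y = v y"
  shows "times_cont_diff_on m u S \<longleftrightarrow> times_cont_diff_on m v S"
  using assms(2)
proof (induction m arbitrary: u v)
  case 0
  then show ?case by (simp cong: continuous_on_cong)
next
  case (Suc m)
  have "u differentiable_on S \<longleftrightarrow> v differentiable_on S"
    using Suc.prems unfolding differentiable_on_def
    by (metis differentiable_transform_within zero_less_one)
  moreover have "times_cont_diff_on m (partial_deriv i u) S \<longleftrightarrow> times_cont_diff_on m (partial_deriv i v) S" for i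
    using Suc.prems by (intro Suc.IH partial_deriv_cong_open[OF assms(1)]) auto
  ultimately show ?case by simp
qed

lemma poly_series_times_cont_diff_on:
  assumes "poly_series b D q"
  shows "times_cont_diff_on m (\<lambda>x. \<Sum>k. q k x) (ball 0 b)"
  using assms
proof (induction m arbitrary: q)
  case (0 q)
  then show ?case
    using has_derivative_continuous[OF poly_series_has_derivative[OF 0]]
    by (auto intro!: continuous_at_imp_continuous_on)
next
  case (Suc m q)
  have "(\<lambda>x. \<Sum>k. q k x) differentiable_on ball 0 b"
    unfolding differentiable_on_def differentiable_def
    using has_derivative_at_withinI[OF poly_series_has_derivative[OF Suc.prems]] by blast
  moreover have "times_cont_diff_on m (partial_deriv i (\<lambda>x. \<Sum>k. q k x)) (ball 0 b)" for i
    using Suc.IH[OF poly_series_partial_deriv[OF Suc.prems]]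
    by (subst times_cont_diff_on_cong[OF open_ball]) (auto simp: poly_series_partial_deriv_sum[OF Suc.prems])
  ultimately show ?case by simp
qed

lemma poly_series_laplacian_sum:
  assumes ps: "poly_series b D q" and x: "x \<in> ball 0 b"
  shows "laplacian (\<lambda>x. \<Sum>k. q k x) x = (\<Sum>k. laplacian (q k) x)"
proof -
  have "laplacian (\<lambda>x. \<Sum>k. q k x) x = (\<Sum>i\<in>UNIV. partial_deriv i (\<lambda>x. \<Sum>k. partial_deriv i (q k) x) x)"
    unfolding laplacian_def
    using poly_series_partial_deriv_sum[OF ps]
    by (intro sum.cong refl partial_deriv_cong_open[OF open_ball x])
  also have "\<dots> = (\<Sum>i\<in>UNIV. \<Sum>k. partial_deriv i (partial_deriv i (q k)) x)"
    by (intro sum.cong refl poly_series_partial_deriv_sum[OF poly_series_partial_deriv[OF ps] x])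
  also have "\<dots> = (\<Sum>k. \<Sum>i\<in>UNIV. partial_deriv i (partial_deriv i (q k)) x)"
    by (rule suminf_sum[symmetric],
        rule summable_norm_cancel[OF poly_series_summable[OF poly_series_partial_deriv[OF poly_series_partial_deriv[OF ps]] x]])
  finally show ?thesis by (simp add: laplacian_def)
qed

lemma poly_series_laplacian_power:
  assumes ps: "poly_series b D q"
  shows "poly_series b D (\<lambda>k. (laplacian ^^ m) (q k))"
    and "x \<in> ball 0 b \<Longrightarrow> (laplacian ^^ m) (\<lambda>x. \<Sum>k. q k x) x = (\<Sum>k. (laplacian ^^ m) (q k) x)"
proof -
  show *: "poly_series b D (\<lambda>k. (laplacian ^^ m) (q k))" for m
    by (induction m) (auto simp: ps intro: poly_series_laplacian)
  show "x \<in> ball 0 b \<Longrightarrow> (laplacian ^^ m) (\<lambda>x. \<Sum>k. q k x) x = (\<Sum>k. (laplacian ^^ m) (q k) x)"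
  proof (induction m arbitrary: x)
    case (Suc m)
    have "(laplacian ^^ Suc m) (\<lambda>x. \<Sum>k. q k x) x = laplacian (\<lambda>x. \<Sum>k. (laplacian ^^ m) (q k) x) x"
      unfolding funpow.simps comp_apply by (rule laplacian_cong_open[OF open_ball Suc.prems Suc.IH])
    also have "\<dots> = (\<Sum>k. (laplacian ^^ Suc m) (q k) x)"
      using poly_series_laplacian_sum[OF * Suc.prems] by simp
    finally show ?case .
  qed simp
qed

lemma poly_series_polyharmonic:
  assumes "poly_series b D q" "\<And>k x. (laplacian ^^ m) (q k) x = 0"
  shows "polyharmonic_on m (ball 0 b) (\<lambda>x. \<Sum>k. q k x)"
  using poly_series_times_cont_diff_on[OF assms(1)] poly_series_laplacian_power(2)[OF assms(1)]
  by (simp add: polyharmonic_on_def assms(2))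

section \<open>Powers of the Laplacian of an Almansi expansion\<close>

lemma polynomial_has_derivative:
  fixes q :: "real^'n::finite \<Rightarrow> complex"
  assumes "polynomial_function q"
  obtains D where "(q has_derivative D) (at x)"
  using differentiable_at_polynomial_function[OF assms] unfolding differentiable_def by blast

lemma partial_deriv_add:
  fixes f g :: "real^'n::finite \<Rightarrow> complex"
  assumes "polynomial_function f" "polynomial_function g"
  shows "partial_deriv i (\<lambda>x. f x + g x) = (\<lambda>x. partial_deriv i f x + partial_deriv i g x)"
proof
  fix x
  obtain D where D: "(f has_derivative D) (at x)" by (rule polynomial_has_derivative[OF assms(1)])
  obtain E where E: "(g has_derivative E) (at x)" by (rule polynomial_has_derivative[OF assms(2)])
  show "partial_deriv i (\<lambda>x. f x + g x) x = partial_deriv i f x + partial_deriv i g x"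
    by (simp add: partial_deriv_eq[OF has_derivative_add[OF D E]] partial_deriv_eq[OF D] partial_deriv_eq[OF E])
qed

lemma partial_deriv_mult:
  fixes f g :: "real^'n::finite \<Rightarrow> complex"
  assumes "polynomial_function f" "polynomial_function g"
  shows "partial_deriv i (\<lambda>x. f x * g x) = (\<lambda>x. f x * partial_deriv i g x + partial_deriv i f x * g x)"
proof
  fix x
  obtain D where D: "(f has_derivative D) (at x)" by (rule polynomial_has_derivative[OF assms(1)])
  obtain E where E: "(g has_derivative E) (at x)" by (rule polynomial_has_derivative[OF assms(2)])
  show "partial_deriv i (\<lambda>x. f x * g x) x = f x * partial_deriv i g x + partial_deriv i f x * g x"
    by (simp add: partial_deriv_eq[OF has_derivative_mult[OF D E]] partial_deriv_eq[OF D] partial_deriv_eq[OF E])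
qed

lemma partial_deriv_const: "partial_deriv i (\<lambda>x. c) = (\<lambda>x. 0)"
  by (rule ext, subst partial_deriv_eq[OF has_derivative_const]) simp

text \<open>The first factor is split into its real and imaginary parts, which act on
  \<open>g\<close> and on \<open>\<i> * g\<close> as real polynomial scalars.\<close>

lemma polynomial_function_times:
  fixes f g :: "'a::real_normed_vector \<Rightarrow> complex"
  assumes "polynomial_function f" "polynomial_function g"
  shows "polynomial_function (\<lambda>x. f x * g x)"
proof -
  have "polynomial_function (\<lambda>x. Re (f x))" "polynomial_function (\<lambda>x. Im (f x))"
    using polynomial_function_compose[OF assms(1) polynomial_function_bounded_linear[OF bounded_linear_Re]]
      polynomial_function_compose[OF assms(1) polynomial_function_bounded_linear[OF bounded_linear_Im]]
    by (simp_all add: o_def)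
  then have "polynomial_function (\<lambda>x. Re (f x) *\<^sub>R g x + Im (f x) *\<^sub>R (\<i> * g x))"
    using assms(2) by (intro polynomial_function_add polynomial_function_mult polynomial_function_cmult)
  moreover have "(\<lambda>x. f x * g x) = (\<lambda>x. Re (f x) *\<^sub>R g x + Im (f x) *\<^sub>R (\<i> * g x))"
    by (auto simp: complex_eq_iff)
  ultimately show ?thesis by simp
qed

lemma polynomial_function_laplacian:
  fixes f :: "real^'n::finite \<Rightarrow> complex"
  assumes "polynomial_function f"
  shows "polynomial_function (laplacian f)"
  unfolding laplacian_def[abs_def]
  using assms by (intro polynomial_function_sum polynomial_function_partial_deriv) auto

lemma polynomial_function_laplacian_power:
  fixes f :: "real^'n::finite \<Rightarrow> complex"
  assumes "polynomial_function f"
  shows "polynomial_function ((laplacian ^^ m) f)"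
  by (induction m) (auto simp: assms polynomial_function_laplacian)

lemma laplacian_add:
  fixes f g :: "real^'n::finite \<Rightarrow> complex"
  assumes "polynomial_function f" "polynomial_function g"
  shows "laplacian (\<lambda>x. f x + g x) = (\<lambda>x. laplacian f x + laplacian g x)"
  by (simp add: fun_eq_iff laplacian_def assms partial_deriv_add polynomial_function_partial_deriv sum.distrib)

lemma laplacian_cmult:
  fixes f :: "real^'n::finite \<Rightarrow> complex"
  assumes "polynomial_function f"
  shows "laplacian (\<lambda>x. c * f x) = (\<lambda>x. c * laplacian f x)"
  by (simp add: fun_eq_iff laplacian_def assms partial_deriv_mult partial_deriv_const
      polynomial_function_partial_deriv sum_distrib_left)

lemma laplacian_power_cmult:
  fixes f :: "real^'n::finite \<Rightarrow> complex"
  assumes "polynomial_function f"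
  shows "(laplacian ^^ m) (\<lambda>x. c * f x) = (\<lambda>x. c * (laplacian ^^ m) f x)"
  by (induction m) (simp_all add: laplacian_cmult polynomial_function_laplacian_power assms)

lemma laplacian_power_add:
  fixes f g :: "real^'n::finite \<Rightarrow> complex"
  assumes "polynomial_function f" "polynomial_function g"
  shows "(laplacian ^^ m) (\<lambda>x. f x + g x) = (\<lambda>x. (laplacian ^^ m) f x + (laplacian ^^ m) g x)"
  by (induction m) (simp_all add: laplacian_add polynomial_function_laplacian_power assms)

lemma laplacian_zero: "laplacian (\<lambda>x. 0) = (\<lambda>x. 0)"
  by (simp add: laplacian_def[abs_def] partial_deriv_const)

lemma laplacian_power_zero: "(laplacian ^^ m) (\<lambda>x. 0) = (\<lambda>x. 0)"
  by (induction m) (simp_all add: laplacian_zero)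

lemma laplacian_power_sum:
  fixes f :: "'i \<Rightarrow> real^'n::finite \<Rightarrow> complex"
  assumes "finite I" "\<And>i. i \<in> I \<Longrightarrow> polynomial_function (f i)"
  shows "(laplacian ^^ m) (\<lambda>x. \<Sum>i\<in>I. f i x) = (\<lambda>x. \<Sum>i\<in>I. (laplacian ^^ m) (f i) x)"
  using assms
proof (induction I rule: finite_induct)
  case (insert i I)
  then show ?case
    by (simp add: laplacian_power_add polynomial_function_sum)
qed (simp add: laplacian_power_zero)

text \<open>Complex-valued, so that complex polynomials can be evaluated at the squared radius:
  \<open>poly p (sqnorm x) * q x\<close> with harmonic \<open>q\<close> is a term of an Almansi
  expansion.\<close>

definition sqnorm :: "real^'n::finite \<Rightarrow> complex" where
  "sqnorm x = of_real ((norm x)\<^sup>2)"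

lemma sqnorm_partial_deriv: "partial_deriv i sqnorm = (\<lambda>x. of_real (2 * x $ i))"
proof
  fix x :: "real^'a"
  have "((\<lambda>x. complex_of_real (x \<bullet> x)) has_derivative (\<lambda>h. of_real (x \<bullet> h + h \<bullet> x))) (at x)"
    by (rule has_derivative_of_real[OF has_derivative_inner[OF has_derivative_ident has_derivative_ident]])
  then have "(sqnorm has_derivative (\<lambda>h. of_real (x \<bullet> h + h \<bullet> x))) (at x)"
    by (simp add: sqnorm_def[abs_def] power2_norm_eq_inner)
  from partial_deriv_eq[OF this, of i] show "partial_deriv i sqnorm x = of_real (2 * x $ i)"
    by (simp add: inner_axis inner_commute[of "axis i 1"])
qed

text \<open>The factor 2 stays because the coordinate occurs as the partial derivative of
  \<open>sqnorm\<close>.\<close>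

lemma coordinate_partial_deriv: "partial_deriv i (\<lambda>x. of_real (2 * x $ i)) = (\<lambda>x. 2)"
proof
  fix x :: "real^'a"
  have "((\<lambda>x. complex_of_real (2 * x $ i)) has_derivative (\<lambda>h. of_real (2 * h $ i))) (at x)"
    by (intro has_derivative_of_real bounded_linear_imp_has_derivative bounded_linear_const_mult bounded_linear_vec_nth)
  from partial_deriv_eq[OF this, of i] show "partial_deriv i (\<lambda>x. complex_of_real (2 * x $ i)) x = 2"
    by simp
qed

lemma coordinate_polynomial_function: "polynomial_function (\<lambda>x::real^'n::finite. complex_of_real (2 * x $ i))"
  by (intro polynomial_function_bounded_linear bounded_linear_compose[OF bounded_linear_of_real]
        bounded_linear_const_mult bounded_linear_vec_nth)

lemma sqnorm_polynomial_function: "polynomial_function (sqnorm :: real^'n::finite \<Rightarrow> complex)"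
proof -
  have "sqnorm x = (\<Sum>i\<in>UNIV. (1/4) * (of_real (2 * x $ i) * of_real (2 * x $ i)))" for x :: "real^'n"
    by (simp add: sqnorm_def power2_norm_eq_inner inner_vec_def)
  then have "sqnorm = (\<lambda>x::real^'n. \<Sum>i\<in>UNIV. (1/4) * (of_real (2 * x $ i) * of_real (2 * x $ i)))" by blast
  moreover have "polynomial_function (\<lambda>x::real^'n. \<Sum>i\<in>UNIV. (1/4) * (complex_of_real (2 * x $ i) * of_real (2 * x $ i)))"
    by (intro polynomial_function_sum polynomial_function_cmult polynomial_function_times coordinate_polynomial_function) simp
  ultimately show ?thesis by simp
qed

text \<open>Euler's identity, from differentiating \<open>t \<mapsto> q (t x) = t^m q x\<close> at
  \<open>t = 1\<close> in two ways.\<close>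

lemma homogeneous_euler:
  fixes q :: "real^'n::finite \<Rightarrow> complex"
  assumes "polynomial_function q" "homogeneous m q"
  shows "(\<Sum>i\<in>UNIV. of_real (x $ i) * partial_deriv i q x) = of_nat m * q x"
proof -
  obtain D where D: "(q has_derivative D) (at x)" by (rule polynomial_has_derivative[OF assms(1)])
  have "((\<lambda>t::real. q (t *\<^sub>R x)) has_derivative (\<lambda>t. D (t *\<^sub>R x))) (at 1)"
    by (rule has_derivative_compose[of "\<lambda>t. t *\<^sub>R x", where g = q])
       (auto intro!: derivative_eq_intros D)
  moreover have "linear D" using D by (simp add: has_derivative_linear)
  ultimately have "((\<lambda>t::real. q (t *\<^sub>R x)) has_vector_derivative D x) (at 1)"
    by (simp add: has_vector_derivative_def linear_scale)
  moreover have "((\<lambda>t::real. q (t *\<^sub>R x)) has_vector_derivative (of_nat m * q x)) (at 1)"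
  proof -
    have "((\<lambda>t::real. of_real t ^ m * q x) has_vector_derivative (of_nat m * q x)) (at 1)"
      by (rule has_vector_derivative_real_field[where f = "\<lambda>z. z ^ m * q x", of _ 1, simplified])
         (auto intro!: derivative_eq_intros)
    then show ?thesis using assms(2) by (simp add: homogeneous_def)
  qed
  ultimately have "D x = of_nat m * q x" by (rule vector_derivative_unique_at)
  then show ?thesis using has_derivative_partial_deriv[OF D, of x] by (simp add: scaleR_conv_of_real)
qed

text \<open>\<open>2 * CARD('n)\<close> is the Laplacian of \<open>sqnorm\<close>. The mixed term is
  twice the product of the gradients; since the gradient of \<open>sqnorm\<close> is
  \<open>2 x\<close>, Euler's identity evaluates it as \<open>4 * m\<close> times
  \<open>q\<close>.\<close>

lemma laplacian_sqnorm_mult: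
  fixes q :: "real^'n::finite \<Rightarrow> complex"
  assumes "polynomial_function q" "homogeneous m q"
  shows "laplacian (\<lambda>x. sqnorm x * q x) x = of_nat (2 * CARD('n) + 4 * m) * q x + sqnorm x * laplacian q x"
proof -
  have pq: "polynomial_function (partial_deriv i q)" for i by (rule polynomial_function_partial_deriv[OF assms(1)])
  have "partial_deriv i (partial_deriv i (\<lambda>x. sqnorm x * q x)) x =
    sqnorm x * partial_deriv i (partial_deriv i q) x + 4 * (of_real (x $ i) * partial_deriv i q x) + 2 * q x" for i
    by (simp only: partial_deriv_mult[OF sqnorm_polynomial_function assms(1)] sqnorm_partial_deriv
        partial_deriv_add[OF polynomial_function_times[OF sqnorm_polynomial_function pq]
          polynomial_function_times[OF coordinate_polynomial_function assms(1)]]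
        partial_deriv_mult[OF sqnorm_polynomial_function pq]
        partial_deriv_mult[OF coordinate_polynomial_function assms(1)] coordinate_partial_deriv) simp
  then have "laplacian (\<lambda>x. sqnorm x * q x) x = sqnorm x * laplacian q x +
      4 * (\<Sum>i\<in>UNIV. of_real (x $ i) * partial_deriv i q x) + of_nat CARD('n) * (2 * q x)"
    by (simp only: laplacian_def sum.distrib sum_distrib_left sum_constant)
  then show ?thesis unfolding homogeneous_euler[OF assms] by (simp add: algebra_simps)
qed

lemma sqnorm_power_mult:
  fixes q :: "real^'n::finite \<Rightarrow> complex"
  assumes "polynomial_function q" "homogeneous k q"
  shows "polynomial_function (\<lambda>x. sqnorm x ^ j * q x)" "homogeneous (k + 2 * j) (\<lambda>x. sqnorm x ^ j * q x)"
proof -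
  show "polynomial_function (\<lambda>x. sqnorm x ^ j * q x)"
    by (induction j) (auto simp: assms(1) mult.assoc intro: polynomial_function_times sqnorm_polynomial_function)
  show "homogeneous (k + 2 * j) (\<lambda>x. sqnorm x ^ j * q x)"
    using assms(2) by (auto simp: homogeneous_def sqnorm_def power_mult_distrib power_add power_mult
        simp flip: of_real_power)
qed

text \<open>Each stage applies \<open>laplacian_sqnorm_mult\<close> to the homogeneous product of
  the stage before, and the constants add up to \<open>2 (j + 1) (d + 2 k + 2 j)\<close> in
  dimension \<open>d\<close>. What the sequel takes from this is the drop of the power by
  one.\<close>

lemma laplacian_sqnorm_power_mult:
  fixes q :: "real^'n::finite \<Rightarrow> complex"
  assumes "polynomial_function q" "homogeneous k q" "\<And>x. laplacian q x = 0"
  shows "\<exists>c. laplacian (\<lambda>x. sqnorm x ^ Suc j * q x) = (\<lambda>x. c * (sqnorm x ^ j * q x))"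
proof (induction j)
  case 0
  have "laplacian (\<lambda>x. sqnorm x * q x) = (\<lambda>x. of_nat (2 * CARD('n) + 4 * k) * q x)"
    using laplacian_sqnorm_mult[OF assms(1,2)] assms(3) by auto
  then show ?case by auto
next
  case (Suc j)
  then obtain c where c: "laplacian (\<lambda>x. sqnorm x ^ Suc j * q x) = (\<lambda>x. c * (sqnorm x ^ j * q x))" by blast
  have "laplacian (\<lambda>x. sqnorm x ^ Suc (Suc j) * q x) x =
    (of_nat (2 * CARD('n) + 4 * (k + 2 * Suc j)) + c) * (sqnorm x ^ Suc j * q x)" for x
    using laplacian_sqnorm_mult[OF sqnorm_power_mult[OF assms(1,2), of "Suc j"], of x] fun_cong[OF c, of x]
    by (simp add: mult.assoc distrib_right)
  then show ?case by blast
qed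

text \<open>Each Laplacian removes one factor \<open>sqnorm\<close> up to a constant. After
  \<open>j\<close> of them a multiple of the harmonic \<open>q\<close> is left, and one more gives
  zero.\<close>

lemma laplacian_power_sqnorm_power_mult:
  fixes q :: "real^'n::finite \<Rightarrow> complex"
  assumes "polynomial_function q" "homogeneous k q" "\<And>x. laplacian q x = 0"
  shows "j < m \<Longrightarrow> (laplacian ^^ m) (\<lambda>x. sqnorm x ^ j * q x) = (\<lambda>x. 0)"
proof (induction j arbitrary: m)
  case 0
  then obtain n where "m = Suc n" using gr0_implies_Suc by blast
  moreover have "laplacian q = (\<lambda>x. 0)" using assms(3) by blast
  ultimately show ?case by (simp add: funpow_swap1 laplacian_power_zero)
next
  case (Suc j)
  then obtain n where n: "m = Suc n" "j < n" by (cases m) auto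
  obtain c where c: "laplacian (\<lambda>x. sqnorm x ^ Suc j * q x) = (\<lambda>x. c * (sqnorm x ^ j * q x))"
    using laplacian_sqnorm_power_mult[OF assms] by blast
  have "(laplacian ^^ m) (\<lambda>x. sqnorm x ^ Suc j * q x) = (laplacian ^^ n) (\<lambda>x. c * (sqnorm x ^ j * q x))"
    unfolding n(1) funpow_Suc_right comp_apply c ..
  also have "\<dots> = (\<lambda>x. 0)"
    using Suc.IH[OF n(2)] by (simp add: laplacian_power_cmult sqnorm_power_mult[OF assms(1,2)])
  finally show ?case .
qed

text \<open>The easy half of Almansi's theorem, together with the degree bound that membership in
  \<open>poly_series\<close> with offset \<open>2 * N\<close> demands. Both are read off from the
  expansion into finitely many terms \<open>sqnorm x ^ j * q i x\<close> with
  \<open>j \<le> N\<close>.\<close>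

lemma laplacian_power_poly_sqnorm:
  fixes q :: "'i \<Rightarrow> real^'n::finite \<Rightarrow> complex"
  assumes "finite I" "\<And>i. i \<in> I \<Longrightarrow> q i \<in> harmonic_space k" "\<And>i. i \<in> I \<Longrightarrow> degree (p i) \<le> N"
  shows "(laplacian ^^ Suc N) (\<lambda>x. \<Sum>i\<in>I. poly (p i) (sqnorm x) * q i x) x = 0"
    and "poly_degree_le (k + 2 * N) (\<lambda>x. \<Sum>i\<in>I. poly (p i) (sqnorm x) * q i x)"
proof -
  note q = harmonic_spaceD[OF assms(2)]
  let ?f = "\<lambda>(i, j) x. coeff (p i) j * (sqnorm x ^ j * q i x)"
  have eq: "(\<lambda>x. \<Sum>i\<in>I. poly (p i) (sqnorm x) * q i x) = (\<lambda>x. \<Sum>ij\<in>I \<times> {..N}. ?f ij x)"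
    by (simp add: poly_eq_sum_atMost[OF assms(3)] sum_distrib_right mult.assoc sum.cartesian_product split_beta)
  have pf: "polynomial_function (?f ij)" if "ij \<in> I \<times> {..N}" for ij
    using that by (auto intro!: polynomial_function_cmult sqnorm_power_mult(1)[OF q(1,2)])
  have "(laplacian ^^ Suc N) (?f ij) x = 0" if ij_mem: "ij \<in> I \<times> {..N}" for ij x
  proof -
    from ij_mem obtain i j where ij: "ij = (i, j)" "i \<in> I" "j \<le> N" by auto
    have "(laplacian ^^ Suc N) (\<lambda>x. coeff (p i) j * (sqnorm x ^ j * q i x)) =
        (\<lambda>x. coeff (p i) j * (laplacian ^^ Suc N) (\<lambda>x. sqnorm x ^ j * q i x) x)"
      using ij by (intro laplacian_power_cmult sqnorm_power_mult(1)[OF q(1,2)])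
    moreover have "(laplacian ^^ Suc N) (\<lambda>x. sqnorm x ^ j * q i x) = (\<lambda>x. 0)"
      using ij by (intro laplacian_power_sqnorm_power_mult[OF q]) auto
    ultimately show ?thesis by (simp only: ij(1) prod.case) simp
  qed
  then show "(laplacian ^^ Suc N) (\<lambda>x. \<Sum>i\<in>I. poly (p i) (sqnorm x) * q i x) x = 0"
    unfolding eq using assms(1) pf by (subst laplacian_power_sum) auto
  have "\<exists>C. \<forall>x. norm (?f ij x) \<le> C * (1 + norm x) ^ (k + 2 * N)" if ij_mem: "ij \<in> I \<times> {..N}" for ij
  proof -
    from ij_mem obtain i j where ij: "ij = (i, j)" "i \<in> I" "j \<le> N" by auto
    have "poly_degree_le (k + 2 * j) (\<lambda>x. sqnorm x ^ j * q i x)"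
      using ij by (intro homogeneous_poly_degree_le sqnorm_power_mult[OF q(1,2)])
    then obtain C where C: "\<And>x. norm (sqnorm x ^ j * q i x) \<le> C * (1 + norm x) ^ (k + 2 * j)"
      unfolding poly_degree_le_def by blast
    have "C \<ge> 0" using order_trans[OF norm_ge_zero C[of 0]] by simp
    have "norm (?f ij x) \<le> (norm (coeff (p i) j) * C) * (1 + norm x) ^ (k + 2 * N)" for x
    proof -
      have "C * (1 + norm x) ^ (k + 2 * j) \<le> C * (1 + norm x) ^ (k + 2 * N)"
        using \<open>C \<ge> 0\<close> ij(3) by (intro mult_left_mono power_increasing) auto
      then have "norm (sqnorm x ^ j * q i x) \<le> C * (1 + norm x) ^ (k + 2 * N)" using C[of x] by linarith
      from mult_left_mono[OF this norm_ge_zero, of "coeff (p i) j"] show ?thesis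
        unfolding ij(1) prod.case norm_mult[of "coeff (p i) j"] by (simp only: mult.assoc)
    qed
    then show ?thesis by blast
  qed
  then have "\<forall>ij\<in>I \<times> {..N}. \<exists>C. \<forall>x. norm (?f ij x) \<le> C * (1 + norm x) ^ (k + 2 * N)" ..
  from bchoice[OF this] obtain C where
    "\<forall>ij\<in>I \<times> {..N}. \<forall>x. norm (?f ij x) \<le> C ij * (1 + norm x) ^ (k + 2 * N)" ..
  then have C: "norm (?f ij x) \<le> C ij * (1 + norm x) ^ (k + 2 * N)" if "ij \<in> I \<times> {..N}" for ij x
    using that by blast
  have "norm (\<Sum>ij\<in>I \<times> {..N}. ?f ij x) \<le> (\<Sum>ij\<in>I \<times> {..N}. C ij) * (1 + norm x) ^ (k + 2 * N)" for x
    unfolding sum_distrib_right by (rule sum_norm_le) (rule C)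
  moreover have "polynomial_function (\<lambda>x. \<Sum>ij\<in>I \<times> {..N}. ?f ij x)"
    using assms(1) pf by (intro polynomial_function_sum) auto
  ultimately show "poly_degree_le (k + 2 * N) (\<lambda>x. \<Sum>i\<in>I. poly (p i) (sqnorm x) * q i x)"
    unfolding eq poly_degree_le_def by blast
qed

section \<open>The maximum principle\<close>

text \<open>A maximum at 0 forces \<open>\<phi>' 0 = 0\<close>. A positive derivative of
  \<open>\<phi>'\<close> makes \<open>\<phi>'\<close> positive just to the right of 0, so
  \<open>\<phi>\<close> increases there.\<close>

lemma no_local_max:
  fixes \<phi> \<phi>' :: "real \<Rightarrow> real"
  assumes "e > 0" "\<And>t. \<bar>t\<bar> < e \<Longrightarrow> (\<phi> has_real_derivative \<phi>' t) (at t)"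
    and "(\<phi>' has_real_derivative D) (at 0)" "D > 0" "\<And>t. \<bar>t\<bar> < e \<Longrightarrow> \<phi> t \<le> \<phi> 0"
  shows False
proof -
  have "\<phi>' 0 = 0"
    by (rule DERIV_local_max[OF assms(2)[of 0] \<open>e > 0\<close>]) (use assms in auto)
  obtain d where d: "d > 0" "\<And>h. 0 < h \<Longrightarrow> h < d \<Longrightarrow> \<phi>' 0 < \<phi>' h"
    using DERIV_pos_inc_right[OF assms(3,4)] by auto
  define t where "t = min d e / 2"
  have t: "0 < t" "t < d" "t < e" using d \<open>e > 0\<close> by (auto simp: t_def)
  have "\<phi> 0 < \<phi> t"
  proof (rule DERIV_pos_imp_increasing_open[OF t(1)])
    fix x assume "0 < x" "x < t"
    then show "\<exists>y. (\<phi> has_real_derivative y) (at x) \<and> y > 0"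
      using assms(2)[of x] d(2)[of x] t \<open>\<phi>' 0 = 0\<close> by auto
  next
    show "continuous_on {0..t} \<phi>"
    proof (intro continuous_at_imp_continuous_on ballI)
      fix x assume "x \<in> {0..t}"
      then show "isCont \<phi> x" using DERIV_isCont[OF assms(2)[of x]] t by auto
    qed
  qed
  with assms(5)[of t] t show False by auto
qed

lemma differentiable_imp_line_derivative:
  fixes u :: "real^'n::finite \<Rightarrow> complex"
  assumes "u differentiable (at (y + t *\<^sub>R axis i 1))"
  shows "((\<lambda>t. Re (a * u (y + t *\<^sub>R axis i 1))) has_real_derivative
    Re (a * partial_deriv i u (y + t *\<^sub>R axis i 1))) (at t)"
proof -
  obtain D where D: "(u has_derivative D) (at (y + t *\<^sub>R axis i 1))" using assms by (auto simp: differentiable_def)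
  have "((\<lambda>t::real. u (y + t *\<^sub>R axis i 1)) has_derivative (\<lambda>t. D (t *\<^sub>R axis i 1))) (at t)"
    by (rule has_derivative_compose[of "\<lambda>t. y + t *\<^sub>R axis i 1", where g = u])
       (auto intro!: derivative_eq_intros D)
  moreover have "linear D" using D by (simp add: has_derivative_linear)
  ultimately have "((\<lambda>t::real. u (y + t *\<^sub>R axis i 1)) has_derivative (\<lambda>t'. t' *\<^sub>R partial_deriv i u (y + t *\<^sub>R axis i 1))) (at t)"
    by (simp add: partial_deriv_eq[OF D] linear_scale)
  then have "((\<lambda>t::real. Re (a * u (y + t *\<^sub>R axis i 1))) has_derivative (\<lambda>t'. Re (a * (t' *\<^sub>R partial_deriv i u (y + t *\<^sub>R axis i 1))))) (at t)"
    by (intro has_derivative_Re has_derivative_mult_right) (simp add: partial_deriv_eq[OF D])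
  then show ?thesis
    by (simp add: has_field_derivative_def mult_commute_abs)
qed

text \<open>Multiplication by the conjugate of \<open>u x\<^sub>0\<close> gives a real part that is
  positive at \<open>x\<^sub>0\<close>. A small multiple of the squared norm makes it strictly
  subharmonic: at an interior maximum every pure second derivative would be at most 0, while their
  sum is \<open>2 \<epsilon>\<close> times the dimension.\<close>

lemma harmonic_zero_boundary:
  fixes u :: "real^'n::finite \<Rightarrow> complex"
  assumes cont: "continuous_on (cball 0 1) u" and C2: "times_cont_diff_on 2 u (ball 0 1)"
    and lap: "\<And>x. x \<in> ball 0 1 \<Longrightarrow> laplacian u x = 0"
    and bd: "\<And>x. norm x = 1 \<Longrightarrow> u x = 0" and x0: "x\<^sub>0 \<in> ball 0 1"
  shows "u x\<^sub>0 = 0"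
proof (rule ccontr)
  assume "u x\<^sub>0 \<noteq> 0"
  define a where "a = cnj (u x\<^sub>0)"
  define v where "v x = Re (a * u x)" for x
  have "v x\<^sub>0 = (norm (u x\<^sub>0))\<^sup>2" by (simp add: v_def a_def cmod_power2) (simp add: power2_eq_square)
  then have v: "v x\<^sub>0 > 0" using \<open>u x\<^sub>0 \<noteq> 0\<close> by simp
  \<comment> \<open>Any positive number below \<open>v x\<^sub>0\<close> would serve: on the sphere
    \<open>g\<close> equals \<open>\<epsilon>\<close>, less than \<open>g x\<^sub>0\<close>, so the
    maximum of \<open>g\<close> lies in the interior.\<close>
  define \<epsilon> where "\<epsilon> = v x\<^sub>0 / 2"
  have \<epsilon>: "0 < \<epsilon>" "\<epsilon> < v x\<^sub>0" using v by (auto simp: \<epsilon>_def)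
  define g where "g x = v x + \<epsilon> * (norm x)\<^sup>2" for x
  have "continuous_on (cball 0 1) g"
    unfolding g_def v_def by (intro continuous_intros cont)
  then obtain y where y: "y \<in> cball 0 1" "\<And>x. x \<in> cball 0 1 \<Longrightarrow> g x \<le> g y"
    using continuous_attains_sup[of "cball 0 1" g] by fastforce
  have "g x\<^sub>0 \<le> g y" using x0 by (intro y) auto
  moreover have "v x\<^sub>0 \<le> g x\<^sub>0" using \<epsilon> by (simp add: g_def)
  moreover have "g x = \<epsilon>" if "norm x = 1" for x using that bd by (simp add: g_def v_def)
  ultimately have "norm y \<noteq> 1" using \<epsilon> by fastforce
  with y(1) have ny: "norm y < 1" by simp
  define e where "e = 1 - norm y"
  have e: "e > 0" using ny by (simp add: e_def)
  have line: "y + t *\<^sub>R axis i 1 \<in> ball 0 1" if "\<bar>t\<bar> < e" for t and i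
    using norm_triangle_ineq[of y "t *\<^sub>R axis i 1"] that by (simp add: e_def)
  have C2': "u differentiable (at x)" "partial_deriv i u differentiable (at x)" if "x \<in> ball 0 1" for i x
    using C2 that by (auto simp: numeral_2_eq_2 differentiable_on_eq_differentiable_at)
  have "Re (a * partial_deriv i (partial_deriv i u) y) + 2 * \<epsilon> \<le> 0" for i
  proof (rule ccontr)
    assume "\<not> ?thesis"
    then have pos: "Re (a * partial_deriv i (partial_deriv i u) y) + 2 * \<epsilon> > 0" by simp
    define \<phi> where "\<phi> t = g (y + t *\<^sub>R axis i 1)" for t
    have nrm: "(norm (y + t *\<^sub>R axis i 1))\<^sup>2 = (norm y)\<^sup>2 + 2 * t * y $ i + t\<^sup>2" for t
      unfolding power2_norm_eq_inner
      by (simp add: inner_add_left inner_add_right inner_axis inner_axis' power2_eq_square distrib_left)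
    define \<phi>' where "\<phi>' t = Re (a * partial_deriv i u (y + t *\<^sub>R axis i 1)) + \<epsilon> * (2 * y $ i + 2 * t)" for t
    show False
    proof (rule no_local_max[OF e])
      show "(\<phi> has_real_derivative \<phi>' t) (at t)" if "\<bar>t\<bar> < e" for t
        unfolding \<phi>_def \<phi>'_def g_def v_def nrm
        by (intro DERIV_add differentiable_imp_line_derivative C2' line[OF that] DERIV_cmult)
           (auto intro!: derivative_eq_intros)
      show "(\<phi>' has_real_derivative (Re (a * partial_deriv i (partial_deriv i u) y) + 2 * \<epsilon>)) (at 0)"
        unfolding \<phi>'_def
      proof (rule DERIV_add)
        show "((\<lambda>t. Re (a * partial_deriv i u (y + t *\<^sub>R axis i 1))) has_real_derivative
            Re (a * partial_deriv i (partial_deriv i u) y)) (at 0)"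
          using differentiable_imp_line_derivative[OF C2'(2)[OF line[of 0 i]], where a = a] e by simp
      qed (auto intro!: derivative_eq_intros)
      show "\<phi> t \<le> \<phi> 0" if "\<bar>t\<bar> < e" for t
        using y(2) line[OF that, of i] by (auto simp: \<phi>_def)
    qed (rule pos)
  qed
  then have "(\<Sum>i\<in>UNIV. Re (a * partial_deriv i (partial_deriv i u) y) + 2 * \<epsilon>) \<le> 0" by (intro sum_nonpos) auto
  moreover have "(\<Sum>i\<in>UNIV. Re (a * partial_deriv i (partial_deriv i u) y)) = Re (a * laplacian u y)"
    by (simp add: laplacian_def sum_distrib_left Re_sum[symmetric] del: Re_sum times_complex.simps)
  ultimately have "real CARD('n) * (2 * \<epsilon>) \<le> 0" using lap ny by (simp add: sum.distrib)
  then show False using \<epsilon> by (simp add: mult_le_0_iff)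
qed

section \<open>Interpolation\<close>

text \<open>One step of Newton's scheme: \<open>p = f a + (w - a) q\<close> for a node
  \<open>a\<close>, and \<open>q\<close> interpolates the difference quotient of \<open>f\<close> at
  the other nodes. On the circle of radius \<open>\<rho>\<close> the denominator is at least
  \<open>\<rho> - \<beta>\<close>, whatever the node; the larger radius \<open>\<sigma>\<close>
  keeps the quotient holomorphic across that circle.\<close>

lemma interpolation_bound:
  fixes \<beta> \<rho> \<sigma> :: real
  assumes "0 \<le> \<beta>" "\<beta> < \<rho>" "\<rho> < \<sigma>"
  obtains C where "C \<ge> 0"
    "\<And>f A p (x :: nat \<Rightarrow> complex) w. \<lbrakk>f holomorphic_on ball 0 \<sigma>; \<And>w. norm w \<le> \<rho> \<Longrightarrow> norm (f w) \<le> A;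
       inj_on x {0..N}; \<And>j. j \<le> N \<Longrightarrow> norm (x j) \<le> \<beta>; degree p \<le> N;
       \<And>j. j \<le> N \<Longrightarrow> poly p (x j) = f (x j); norm w \<le> \<beta>\<rbrakk> \<Longrightarrow> norm (poly p w) \<le> C * A"
proof -
  have "\<exists>C\<ge>0. \<forall>f A p (x :: nat \<Rightarrow> complex) w. f holomorphic_on ball 0 \<sigma> \<longrightarrow> (\<forall>w. norm w \<le> \<rho> \<longrightarrow> norm (f w) \<le> A) \<longrightarrow>
       inj_on x {0..N} \<longrightarrow> (\<forall>j\<le>N. norm (x j) \<le> \<beta>) \<longrightarrow> degree p \<le> N \<longrightarrow>
       (\<forall>j\<le>N. poly p (x j) = f (x j)) \<longrightarrow> norm w \<le> \<beta> \<longrightarrow> norm (poly p w) \<le> C * A"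
  proof (induction N)
    case 0
    show ?case
    proof (rule exI[of _ 1], intro conjI allI impI)
      fix f :: "complex \<Rightarrow> complex" and A p and x :: "nat \<Rightarrow> complex" and w :: complex
      assume f: "\<forall>w. norm w \<le> \<rho> \<longrightarrow> norm (f w) \<le> A" and x: "\<forall>j\<le>0. norm (x j) \<le> \<beta>"
        and p: "degree p \<le> 0" "\<forall>j\<le>0. poly p (x j) = f (x j)"
      obtain c where "p = [:c:]" using p(1) degree_eq_zeroE by blast
      then show "norm (poly p w) \<le> 1 * A" using p(2) x f assms by auto
    qed simp
  next
    case (Suc N)
    then obtain C where C: "C \<ge> 0"
      "\<And>f A p (x :: nat \<Rightarrow> complex) w. f holomorphic_on ball 0 \<sigma> \<Longrightarrow> (\<forall>w. norm w \<le> \<rho> \<longrightarrow> norm (f w) \<le> A) \<Longrightarrow>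
       inj_on x {0..N} \<Longrightarrow> (\<forall>j\<le>N. norm (x j) \<le> \<beta>) \<Longrightarrow> degree p \<le> N \<Longrightarrow>
       (\<forall>j\<le>N. poly p (x j) = f (x j)) \<Longrightarrow> norm w \<le> \<beta> \<Longrightarrow> norm (poly p w) \<le> C * A"
      by blast
    show ?case
    \<comment> \<open>The 1 accounts for \<open>f a\<close>, the factor \<open>2 * \<beta>\<close>
      bounds \<open>norm (w - a)\<close>, and \<open>2 / (\<rho> - \<beta>)\<close> is the loss in
      passing from \<open>f\<close> to its difference quotient.\<close>
    proof (rule exI[of _ "1 + 2 * \<beta> * C * (2 / (\<rho> - \<beta>))"], intro conjI allI impI)
      show "0 \<le> 1 + 2 * \<beta> * C * (2 / (\<rho> - \<beta>))" using assms C(1) by simp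
      fix f :: "complex \<Rightarrow> complex" and A p and x :: "nat \<Rightarrow> complex" and w :: complex
      assume f: "f holomorphic_on ball 0 \<sigma>" "\<forall>w. norm w \<le> \<rho> \<longrightarrow> norm (f w) \<le> A"
        and x: "inj_on x {0..Suc N}" "\<forall>j\<le>Suc N. norm (x j) \<le> \<beta>"
        and p: "degree p \<le> Suc N" "\<forall>j\<le>Suc N. poly p (x j) = f (x j)" and w: "norm w \<le> \<beta>"
      define a where "a = x (Suc N)"
      have a: "norm a \<le> \<beta>" using x(2) by (simp add: a_def)
      have "A \<ge> 0" using f(2) assms norm_ge_zero order_trans by (metis less_eq_real_def norm_zero)
      \<comment> \<open>The value \<open>deriv f a\<close> fills the removable singularity. It is
        never interpolated, since the remaining nodes differ from \<open>a\<close>.\<close>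
      define g where "g z = (if z = a then deriv f a else (f z - f a) / (z - a))" for z
      have holg: "g holomorphic_on ball 0 \<sigma>"
      proof (rule pole_theorem_open_0[where a = a and g = "\<lambda>z. f z - f a"])
        show "(\<lambda>z. f z - f a) holomorphic_on ball 0 \<sigma>" by (intro holomorphic_intros f(1))
        have "f field_differentiable at a"
          by (rule holomorphic_on_imp_differentiable_at[OF f(1)]) (use a assms in auto)
        then show "g a = deriv (\<lambda>z. f z - f a) a" by (simp add: g_def)
      qed (auto simp: g_def)
      have gA: "norm (g z) \<le> 2 / (\<rho> - \<beta>) * A" if "norm z \<le> \<rho>" for z
      proof (rule maximum_modulus_frontier[of g "cball 0 \<rho>"])
        show "g holomorphic_on interior (cball 0 \<rho>)"
          by (rule holomorphic_on_subset[OF holg]) (use assms in auto)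
        show "continuous_on (closure (cball 0 \<rho>)) g"
          by (rule holomorphic_on_imp_continuous_on, rule holomorphic_on_subset[OF holg]) (use assms in auto)
        fix z :: complex assume "z \<in> frontier (cball 0 \<rho>)"
        then have z: "norm z = \<rho>" using assms by auto
        then have "z \<noteq> a" using a assms by auto
        have "norm (f z - f a) \<le> A + A"
          by (rule order_trans[OF norm_triangle_ineq4 add_mono]) (use f(2) z a assms in auto)
        moreover have "\<rho> - \<beta> \<le> norm (z - a)" using norm_triangle_ineq2[of z a] z a by linarith
        ultimately have "norm (f z - f a) / norm (z - a) \<le> (A + A) / (\<rho> - \<beta>)"
          using assms \<open>A \<ge> 0\<close> by (intro frac_le) auto
        then show "norm (g z) \<le> 2 / (\<rho> - \<beta>) * A" using \<open>z \<noteq> a\<close> by (simp add: g_def norm_divide)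
      qed (use that in auto)
      have "poly (p - [:f a:]) a = 0" using p(2) by (simp add: a_def)
      then obtain q where q: "p - [:f a:] = [:- a, 1:] * q" by (metis poly_eq_0_iff_dvd dvdE)
      have pq: "poly p z = f a + (z - a) * poly q z" for z
      proof -
        have "poly (p - [:f a:]) z = (z - a) * poly q z" unfolding q by (simp add: algebra_simps)
        then show ?thesis by (simp add: algebra_simps)
      qed
      have "degree q \<le> N"
      proof (cases "q = 0")
        case False
        then have "degree (p - [:f a:]) = Suc (degree q)" unfolding q by (subst degree_mult_eq) auto
        moreover have "degree (p - [:f a:]) \<le> Suc N" by (rule degree_diff_le) (use p(1) in auto)
        ultimately show ?thesis by simp
      qed simp
      moreover have "poly q (x j) = g (x j)" if "j \<le> N" for j
      proof -
        have ne: "x j \<noteq> a" unfolding a_def using inj_onD[OF x(1), of j "Suc N"] that by auto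
        have "poly p (x j) = f (x j)" using p(2) that by simp
        then have "(x j - a) * poly q (x j) = f (x j) - f a"
          using pq[of "x j"] by (simp add: eq_diff_eq add.commute)
        then show ?thesis using ne by (simp add: g_def field_simps)
      qed
      ultimately have "norm (poly q w) \<le> C * (2 / (\<rho> - \<beta>) * A)"
        using x gA w by (intro C(2)[OF holg]) (auto intro: inj_on_subset)
      moreover have "norm (w - a) \<le> 2 * \<beta>" using norm_triangle_ineq4[of w a] w a by linarith
      ultimately have "norm (w - a) * norm (poly q w) \<le> 2 * \<beta> * (C * (2 / (\<rho> - \<beta>) * A))"
        using assms by (intro mult_mono) auto
      moreover have "norm (f a) \<le> A" using f(2) a assms by simp
      moreover have "norm (poly p w) \<le> norm (f a) + norm (w - a) * norm (poly q w)"
        unfolding pq using norm_triangle_ineq[of "f a" "(w - a) * poly q w"] by (simp add: norm_mult)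
      ultimately have "norm (poly p w) \<le> A + 2 * \<beta> * (C * (2 / (\<rho> - \<beta>) * A))" by linarith
      then show "norm (poly p w) \<le> (1 + 2 * \<beta> * C * (2 / (\<rho> - \<beta>))) * A"
        by (simp add: distrib_right mult.assoc)
    qed
  qed
  then obtain C where "C \<ge> 0" and C: "\<And>f A p (x :: nat \<Rightarrow> complex) w. f holomorphic_on ball 0 \<sigma> \<Longrightarrow> (\<forall>w. norm w \<le> \<rho> \<longrightarrow> norm (f w) \<le> A) \<Longrightarrow>
       inj_on x {0..N} \<Longrightarrow> (\<forall>j\<le>N. norm (x j) \<le> \<beta>) \<Longrightarrow> degree p \<le> N \<Longrightarrow>
       (\<forall>j\<le>N. poly p (x j) = f (x j)) \<Longrightarrow> norm w \<le> \<beta> \<Longrightarrow> norm (poly p w) \<le> C * A"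
    by blast
  show ?thesis by (rule that[OF \<open>C \<ge> 0\<close>]) (rule C, auto)
qed

section \<open>Hardy spaces on discs\<close>

lemma continuous_on_circle:
  assumes "g holomorphic_on ball 0 R" "0 \<le> r" "r < R"
  shows "continuous_on S (\<lambda>\<phi>. g (of_real r * cis \<phi>))"
proof (rule continuous_on_compose2[OF holomorphic_on_imp_continuous_on[OF assms(1)]])
  show "continuous_on S (\<lambda>\<phi>. of_real r * cis \<phi>)" by (intro continuous_intros)
qed (use assms in \<open>auto simp: norm_mult\<close>)

lemma hardy_mean_integrable:
  assumes "g holomorphic_on ball 0 R" "0 \<le> r" "r < R"
  shows "(\<lambda>\<phi>. (norm (g (of_real r * cis \<phi>)))\<^sup>2) integrable_on {a..b}"
  by (intro integrable_continuous_interval continuous_intros continuous_on_circle[OF assms])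

text \<open>True for arbitrary \<open>g\<close>, because \<open>integral\<close> is 0 on functions
  that are not integrable.\<close>

lemma hardy_mean_nonneg: "hardy_mean g r \<ge> 0"
proof (cases "(\<lambda>\<phi>. (norm (g (of_real r * cis \<phi>)))\<^sup>2) integrable_on {0..2 * pi}")
  case True
  then show ?thesis by (simp add: hardy_mean_def Henstock_Kurzweil_Integration.integral_nonneg)
qed (simp add: hardy_mean_def not_integrable_integral)

text \<open>A real \<open>SUP\<close> is meaningful for a nonempty set that is bounded above:
  \<open>R > 0\<close> gives the former, membership in \<open>hardy_disc R\<close> the
  latter.\<close>

lemma hardy_disc_norm_sup:
  assumes "R > 0" "g \<in> hardy_disc R"
  shows "(hardy_disc_norm R g)\<^sup>2 = (SUP r\<in>{0..<R}. hardy_mean g r)"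
    and "hardy_disc_norm R g \<ge> 0"
    and "0 \<le> r \<Longrightarrow> r < R \<Longrightarrow> hardy_mean g r \<le> (hardy_disc_norm R g)\<^sup>2"
proof -
  have bdd: "bdd_above (hardy_mean g ` {0..<R})" using assms(2) by (simp add: hardy_disc_def)
  have up: "hardy_mean g r \<le> (SUP r\<in>{0..<R}. hardy_mean g r)" if "0 \<le> r" "r < R" for r
    using that by (intro cSUP_upper bdd) auto
  have "0 \<le> (SUP r\<in>{0..<R}. hardy_mean g r)"
    using hardy_mean_nonneg[of g 0] up[of 0] assms(1) by linarith
  then show *: "(hardy_disc_norm R g)\<^sup>2 = (SUP r\<in>{0..<R}. hardy_mean g r)" "hardy_disc_norm R g \<ge> 0"
    by (simp_all add: hardy_disc_norm_def)
  show "0 \<le> r \<Longrightarrow> r < R \<Longrightarrow> hardy_mean g r \<le> (hardy_disc_norm R g)\<^sup>2" using up *(1) by simp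
qed

text \<open>The mean is normalised, so bounded holomorphic functions embed in the Hardy space with
  norm at most 1 and a supremum bound on the interpolants transfers with the same constant.\<close>

lemma hardy_disc_bounded:
  assumes "R > 0" "g holomorphic_on ball 0 R" "\<And>z. norm z < R \<Longrightarrow> norm (g z) \<le> A"
  shows "g \<in> hardy_disc R" "hardy_disc_norm R g \<le> A"
proof -
  have "A \<ge> 0" using order_trans[OF norm_ge_zero assms(3)[of 0]] assms(1) by simp
  have mean: "hardy_mean g r \<le> A\<^sup>2" if "0 \<le> r" "r < R" for r
  proof -
    have "integral {0..2 * pi} (\<lambda>\<phi>. (norm (g (of_real r * cis \<phi>)))\<^sup>2) \<le> integral {0..2 * pi} (\<lambda>\<phi>. A\<^sup>2)"
      using that by (intro integral_le hardy_mean_integrable[OF assms(2)] power_mono assms(3)) (auto simp: norm_mult)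
    then have "integral {0..2 * pi} (\<lambda>\<phi>. (norm (g (of_real r * cis \<phi>)))\<^sup>2) \<le> 2 * pi * A\<^sup>2" by simp
    then show ?thesis by (simp add: hardy_mean_def field_simps)
  qed
  show mem: "g \<in> hardy_disc R"
    using assms(2) mean by (auto simp: hardy_disc_def intro!: bdd_aboveI[of _ "A\<^sup>2"])
  have "(hardy_disc_norm R g)\<^sup>2 \<le> A\<^sup>2"
    unfolding hardy_disc_norm_sup(1)[OF assms(1) mem]
    using mean assms(1) by (intro cSUP_least) auto
  then show "hardy_disc_norm R g \<le> A" using \<open>A \<ge> 0\<close> by (rule power2_le_imp_le)
qed

lemma norm_le_hardy_mean:
  assumes h: "h holomorphic_on ball 0 R" and r: "0 \<le> \<rho>" "\<rho> < r" "r < R" and z: "norm z \<le> \<rho>"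
  shows "(norm (h z))\<^sup>2 \<le> r / (r - \<rho>) * hardy_mean h r"
proof -
  \<comment> \<open>Cauchy's formula for the square of \<open>h\<close> puts the squared modulus
    under the integral directly, in place of a Cauchy-Schwarz argument; the kernel is at most
    \<open>1 / (r - \<rho>)\<close>.\<close>
  define f where "f w = (h w)\<^sup>2" for w
  have hol: "f holomorphic_on cball 0 r"
    unfolding f_def using r by (intro holomorphic_intros holomorphic_on_subset[OF h]) auto
  have "((\<lambda>u. f u / (u - z)) has_contour_integral (2 * of_real pi * \<i> * f z)) (circlepath 0 r)"
    using z r hol by (intro Cauchy_integral_circlepath)
      (auto intro: holomorphic_on_imp_continuous_on holomorphic_on_subset)
  then have "2 * of_real pi * \<i> * f z = contour_integral (part_circlepath 0 r 0 (2 * pi)) (\<lambda>u. f u / (u - z))"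
    by (simp add: circlepath_def contour_integral_unique)
  also have "\<dots> = integral {0..2 * pi} (\<lambda>t. f (0 + r * cis t) / (0 + r * cis t - z) * r * \<i> * cis t)"
    by (rule contour_integral_part_circlepath_eq) simp
  finally have eq: "2 * of_real pi * \<i> * f z = integral {0..2 * pi} (\<lambda>t. f (r * cis t) / (r * cis t - z) * r * \<i> * cis t)"
    by simp
  have far: "r - \<rho> \<le> norm (of_real r * cis t - z)" for t
    using norm_triangle_ineq2[of "of_real r * cis t" z] z r by (simp add: norm_mult)
  have ne: "of_real r * cis t - z \<noteq> 0" for t using far[of t] r by auto
  have cont: "continuous_on {0..2 * pi} (\<lambda>t. h (r * cis t))" using r by (intro continuous_on_circle[OF h]) auto
  have "2 * pi * (norm (h z))\<^sup>2 = norm (2 * of_real pi * \<i> * f z)"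
    by (simp add: f_def norm_mult norm_power)
  also have "\<dots> \<le> integral {0..2 * pi} (\<lambda>t. r / (r - \<rho>) * (norm (h (of_real r * cis t)))\<^sup>2)"
    unfolding eq
  proof (rule integral_norm_bound_integral)
    show "(\<lambda>t. f (r * cis t) / (r * cis t - z) * r * \<i> * cis t) integrable_on {0..2 * pi}"
      unfolding f_def using ne
      by (intro integrable_continuous_interval continuous_intros cont) auto
    show "(\<lambda>t. r / (r - \<rho>) * (norm (h (of_real r * cis t)))\<^sup>2) integrable_on {0..2 * pi}"
      by (intro integrable_continuous_interval continuous_intros cont)
    fix t
    have "norm (f (r * cis t) / (r * cis t - z) * r * \<i> * cis t) = (norm (h (r * cis t)))\<^sup>2 * r / norm (of_real r * cis t - z)"
      using r by (simp add: f_def norm_mult norm_divide norm_power)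
    also have "\<dots> \<le> (norm (h (r * cis t)))\<^sup>2 * r / (r - \<rho>)"
      using far[of t] ne[of t] r by (intro divide_left_mono mult_pos_pos) auto
    finally show "norm (f (r * cis t) / (r * cis t - z) * r * \<i> * cis t) \<le> r / (r - \<rho>) * (norm (h (of_real r * cis t)))\<^sup>2"
      by (simp add: mult.commute)
  qed
  also have "\<dots> = r / (r - \<rho>) * (2 * pi * hardy_mean h r)"
    by (simp add: hardy_mean_def)
  finally have "2 * pi * (norm (h z))\<^sup>2 \<le> 2 * pi * (r / (r - \<rho>) * hardy_mean h r)" by (simp add: mult_ac)
  then show ?thesis by (subst (asm) mult_le_cancel_left_pos) simp_all
qed

text \<open>The factor \<open>R ^ k\<close>, and not only the smaller \<open>\<rho> ^ k\<close>, is obtained by letting the radius of the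
  circle in \<open>norm_le_hardy_mean\<close> tend to \<open>R\<close>; this makes the bound uniform in \<open>k\<close>.\<close>

lemma hardy_coefficient_bound:
  assumes R: "R > 0" and c: "c holomorphic_on ball 0 (R\<^sup>2)" and F: "(\<lambda>z. c (z\<^sup>2) * z ^ k) \<in> hardy_disc R"
    and \<rho>: "0 \<le> \<rho>" "\<rho> < R" and w: "norm w \<le> \<rho>\<^sup>2"
  shows "norm (c w) * R ^ k \<le> sqrt (R / (R - \<rho>)) * hardy_disc_norm R (\<lambda>z. c (z\<^sup>2) * z ^ k)"
proof -
  let ?F = "\<lambda>z. c (z\<^sup>2) * z ^ k"
  define h where "h z = c (z\<^sup>2)" for z
  have "h holomorphic_on ball 0 R"
    unfolding h_def
    by (rule holomorphic_on_compose_gen[OF _ c, unfolded o_def])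
       (auto intro!: holomorphic_intros power_strict_mono simp: norm_power)
  note hol = this
  \<comment> \<open>Every \<open>w\<close> with \<open>norm w \<le> \<rho>^2\<close> is a square of
    some \<open>z\<close> with \<open>norm z \<le> \<rho>\<close>, which turns the claim into one
    about the even function \<open>h\<close>.\<close>
  define z where "z = csqrt w"
  have z: "z\<^sup>2 = w" by (simp add: z_def)
  then have "(norm z)\<^sup>2 \<le> \<rho>\<^sup>2" using w by (metis norm_power)
  then have nz: "norm z \<le> \<rho>" using \<rho>(1) by (rule power2_le_imp_le)
  let ?n = "(hardy_disc_norm R ?F)\<^sup>2"
  have le: "(norm (c w))\<^sup>2 * r ^ (2 * k) \<le> r / (r - \<rho>) * ?n" if "\<rho> < r" "r < R" for r
  proof -
    have r: "r > 0" using that \<rho> by simp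
    \<comment> \<open>On a circle around 0 the factor \<open>z ^ k\<close> has constant modulus and
      leaves the mean as \<open>r ^ (2 * k)\<close>.\<close>
    have "hardy_mean ?F r = r ^ (2 * k) * hardy_mean h r"
    proof -
      have "(norm (?F (of_real r * cis t)))\<^sup>2 = r ^ (2 * k) * (norm (h (of_real r * cis t)))\<^sup>2" for t
        using r by (simp add: h_def norm_mult norm_power power_mult_distrib power_mult power2_eq_square)
      then show ?thesis by (simp add: hardy_mean_def)
    qed
    moreover have "hardy_mean ?F r \<le> ?n" using hardy_disc_norm_sup(3)[OF R F, of r] r that by simp
    ultimately have "hardy_mean h r * r ^ (2 * k) \<le> ?n" by (simp add: mult.commute)
    have "(norm (c w))\<^sup>2 * r ^ (2 * k) \<le> r / (r - \<rho>) * hardy_mean h r * r ^ (2 * k)"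
      using norm_le_hardy_mean[OF hol \<rho>(1) that nz] r by (intro mult_right_mono) (auto simp: h_def z)
    also have "\<dots> = r / (r - \<rho>) * (hardy_mean h r * r ^ (2 * k))" by simp
    also have "\<dots> \<le> r / (r - \<rho>) * ?n"
      using \<open>hardy_mean h r * r ^ (2 * k) \<le> ?n\<close> r that by (intro mult_left_mono) auto
    finally show ?thesis .
  qed
  have "(norm (c w))\<^sup>2 * R ^ (2 * k) \<le> R / (R - \<rho>) * ?n"
  proof (rule tendsto_le[where F = "at_left R"])
    show "((\<lambda>r. r / (r - \<rho>) * ?n) \<longlongrightarrow> R / (R - \<rho>) * ?n) (at_left R)"
      using \<rho> by (intro tendsto_intros) auto
    show "((\<lambda>r. (norm (c w))\<^sup>2 * r ^ (2 * k)) \<longlongrightarrow> (norm (c w))\<^sup>2 * R ^ (2 * k)) (at_left R)"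
      by (intro tendsto_intros)
    have "\<forall>\<^sub>F r in at_left R. r \<in> {\<rho><..<R}" by (rule eventually_at_leftI[OF _ \<rho>(2)])
    then show "\<forall>\<^sub>F r in at_left R. (norm (c w))\<^sup>2 * r ^ (2 * k) \<le> r / (r - \<rho>) * ?n"
      by (rule eventually_mono) (use le in auto)
  qed simp
  also have "\<dots> = (sqrt (R / (R - \<rho>)) * hardy_disc_norm R ?F)\<^sup>2"
    using \<rho> R by (simp add: power_mult_distrib)
  finally have "(norm (c w) * R ^ k)\<^sup>2 \<le> (sqrt (R / (R - \<rho>)) * hardy_disc_norm R ?F)\<^sup>2"
    unfolding power_mult_distrib[of "norm (c w)"] power_mult[symmetric] mult.commute[of k 2] .
  then show ?thesis
    by (rule power2_le_imp_le) (use hardy_disc_norm_sup(2)[OF R F] \<rho> R in auto)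
qed

section \<open>Hardy expansions\<close>

text \<open>The part of \<open>hardy_expansion\<close> that does not mention the function. It is
  separated because convergence of the series is going to be derived from it.\<close>

definition hardy_coefficients ::
  "'n::finite itself \<Rightarrow> real \<Rightarrow> (nat \<Rightarrow> nat \<Rightarrow> complex \<Rightarrow> complex) \<Rightarrow> bool" where
  "hardy_coefficients _ R c \<longleftrightarrow>
     (\<forall>k. \<forall>l\<in>{1..harmonic_dim TYPE('n) k}.
        c k l holomorphic_on ball 0 (R\<^sup>2) \<and> (\<lambda>z. c k l (z\<^sup>2) * z ^ k) \<in> hardy_disc R) \<and>
     summable (hardy_weight TYPE('n) R c)"

lemma hardy_expansion_iff:
  fixes Y :: "nat \<Rightarrow> nat \<Rightarrow> real^'n::finite \<Rightarrow> complex"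
  shows "hardy_expansion R Y f c \<longleftrightarrow> hardy_coefficients TYPE('n) R c \<and>
     (\<forall>z\<in>ball 0 R. \<forall>\<theta>\<in>sphere 0 1. quadric_term Y c z \<theta> sums f z \<theta>)"
  unfolding hardy_expansion_def hardy_coefficients_def by blast

lemma hardy_weight_nonneg: "hardy_weight TYPE('n::finite) R c k \<ge> 0"
  by (simp add: hardy_weight_def sum_nonneg)

text \<open>Each coefficient is at most \<open>B (norm z / R)^k\<close> times its Hardy norm, by
  \<open>hardy_coefficient_bound\<close>. Summed in squares over \<open>l\<close> this gives the
  weight of degree \<open>k\<close>, which is at most the total \<open>W\<close>;
  \<open>harmonic_sum_bound\<close> then returns to the sphere.\<close>

lemma quadric_term_bound:
  fixes Y :: "nat \<Rightarrow> nat \<Rightarrow> real^'n::finite \<Rightarrow> complex"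
  assumes Y: "orthonormal_harmonics Y" and R: "R > 0" and c: "hardy_coefficients TYPE('n) R c"
    and \<rho>: "0 \<le> \<rho>" "\<rho> < R"
  obtains C where "C \<ge> 0"
    "\<And>z \<theta> k. norm z \<le> \<rho> \<Longrightarrow> norm \<theta> = 1 \<Longrightarrow>
       norm (quadric_term Y c z \<theta> k) \<le> C * (real k + 1) ^ (3 * CARD('n)) * (norm z / R) ^ k"
proof -
  obtain A :: real where A: "A \<ge> 0"
    "\<And>(Y :: nat \<Rightarrow> nat \<Rightarrow> real^'n \<Rightarrow> complex) k a \<theta>. \<lbrakk>orthonormal_harmonics Y; norm \<theta> = 1\<rbrakk> \<Longrightarrow>
       norm (\<Sum>l=1..harmonic_dim TYPE('n) k. a l * Y k l \<theta>) \<le>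
       A * (real k + 1) ^ (3 * CARD('n)) * sqrt (\<Sum>l=1..harmonic_dim TYPE('n) k. (norm (a l))\<^sup>2)"
    by (rule harmonic_sum_bound[where 'n = 'n]) blast
  define B where "B = sqrt (R / (R - \<rho>))"
  have B: "B \<ge> 0" using R \<rho> by (simp add: B_def)
  define W where "W = (\<Sum>k. hardy_weight TYPE('n) R c k)"
  have W: "hardy_weight TYPE('n) R c k \<le> W" for k
  proof -
    have "(\<Sum>i\<in>{k}. hardy_weight TYPE('n) R c i) \<le> W"
      unfolding W_def using c
      by (intro sum_le_suminf) (auto simp: hardy_coefficients_def hardy_weight_nonneg)
    then show ?thesis by simp
  qed
  have "W \<ge> 0" using W[of 0] hardy_weight_nonneg order_trans by blast
  show ?thesis
  proof
    show "A * (B * sqrt W) \<ge> 0" using A(1) B \<open>W \<ge> 0\<close> by simp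
    fix z :: complex and \<theta> :: "real^'n" and k
    assume z: "norm z \<le> \<rho>" and \<theta>: "norm \<theta> = 1"
    let ?L = "{1..harmonic_dim TYPE('n) k}" and ?t = "(norm z / R) ^ k"
    let ?n = "\<lambda>l. hardy_disc_norm R (\<lambda>z. c k l (z\<^sup>2) * z ^ k)"
    have t: "?t \<ge> 0" using R by simp
    have coeff: "norm (c k l (z\<^sup>2) * z ^ k) \<le> ?t * B * ?n l" if l: "l \<in> ?L" for l
    proof -
      have "norm (c k l (z\<^sup>2)) * R ^ k \<le> B * ?n l"
        unfolding B_def
      proof (rule hardy_coefficient_bound[OF R _ _ \<rho>])
        show "norm (z\<^sup>2) \<le> \<rho>\<^sup>2" unfolding norm_power using z by (intro power_mono) auto
      qed (use c l in \<open>auto simp: hardy_coefficients_def\<close>)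
      then have "?t * (norm (c k l (z\<^sup>2)) * R ^ k) \<le> ?t * (B * ?n l)" using t by (rule mult_left_mono)
      moreover have "?t * (norm (c k l (z\<^sup>2)) * R ^ k) = norm (c k l (z\<^sup>2) * z ^ k)"
        using R by (simp add: norm_mult norm_power power_divide)
      ultimately show ?thesis by (simp add: mult.assoc)
    qed
    have "(\<Sum>l\<in>?L. (norm (c k l (z\<^sup>2) * z ^ k))\<^sup>2) \<le> (\<Sum>l\<in>?L. (?t * B * ?n l)\<^sup>2)"
      by (intro sum_mono power_mono coeff) auto
    also have "\<dots> = (?t * B)\<^sup>2 * hardy_weight TYPE('n) R c k"
      by (simp add: hardy_weight_def power_mult_distrib sum_distrib_left)
    also have "\<dots> \<le> (?t * B)\<^sup>2 * W" by (intro mult_left_mono W) auto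
    finally have "sqrt (\<Sum>l\<in>?L. (norm (c k l (z\<^sup>2) * z ^ k))\<^sup>2) \<le> sqrt ((?t * B)\<^sup>2 * W)"
      by (rule real_sqrt_le_mono)
    also have "\<dots> = ?t * B * sqrt W" using t B by (simp add: real_sqrt_mult)
    finally have sq: "sqrt (\<Sum>l\<in>?L. (norm (c k l (z\<^sup>2) * z ^ k))\<^sup>2) \<le> ?t * B * sqrt W" .
    have "norm (quadric_term Y c z \<theta> k) \<le>
        A * (real k + 1) ^ (3 * CARD('n)) * sqrt (\<Sum>l\<in>?L. (norm (c k l (z\<^sup>2) * z ^ k))\<^sup>2)"
      unfolding quadric_term_def by (rule A(2)[OF Y \<theta>])
    also have "\<dots> \<le> A * (real k + 1) ^ (3 * CARD('n)) * (?t * B * sqrt W)"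
      using A(1) by (intro mult_left_mono sq) auto
    finally show "norm (quadric_term Y c z \<theta> k) \<le> A * (B * sqrt W) * (real k + 1) ^ (3 * CARD('n)) * ?t"
      by (simp add: mult_ac)
  qed
qed

lemma quadric_term_summable:
  fixes Y :: "nat \<Rightarrow> nat \<Rightarrow> real^'n::finite \<Rightarrow> complex"
  assumes Y: "orthonormal_harmonics Y" and R: "R > 0" and c: "hardy_coefficients TYPE('n) R c"
    and z: "norm z < R" and \<theta>: "norm \<theta> = 1"
  shows "summable (quadric_term Y c z \<theta>)"
proof -
  obtain C where C: "C \<ge> 0" "\<And>k. norm (quadric_term Y c z \<theta> k) \<le> C * (real k + 1) ^ (3 * CARD('n)) * (norm z / R) ^ k"
    by (rule quadric_term_bound[OF Y R c norm_ge_zero z]) (use \<theta> in blast)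
  have "0 \<le> norm z / R" "norm z / R < 1" using z R by auto
  then obtain D \<sigma> where D: "0 \<le> \<sigma>" "\<sigma> < 1" "0 \<le> D" "\<And>k. (real k + 1) ^ (3 * CARD('n)) * (norm z / R) ^ k \<le> D * \<sigma> ^ k"
    by (rule polynomial_geometric_bound) blast
  show ?thesis
  proof (rule summable_comparison_test')
    show "summable (\<lambda>k. C * (D * \<sigma> ^ k))" using D by (intro summable_mult summable_geometric) auto
    show "norm (quadric_term Y c z \<theta> k) \<le> C * (D * \<sigma> ^ k)" for k
      using C(2)[of k] mult_left_mono[OF D(4)[of k] C(1)] by (simp add: mult.assoc)
  qed
qed

text \<open>Once the lower coefficients vanish, division by \<open>x ^ n\<close> leaves a power
  series that is 0 off the origin and whose limit at the origin is \<open>a n\<close>.\<close>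

lemma powser_zero_imp_coeff_zero:
  fixes a :: "nat \<Rightarrow> 'a::{real_normed_field, banach}"
  assumes "s > 0" "\<And>x. x \<noteq> 0 \<Longrightarrow> norm x < s \<Longrightarrow> (\<lambda>n. a n * x ^ n) sums 0"
  shows "a n = 0"
proof (induction n rule: less_induct)
  case (less n)
  have "(\<lambda>k. a (k + n) * x ^ k) sums 0" if x: "x \<noteq> 0" "norm x < s" for x
  proof -
    have "(\<lambda>k. a (k + n) * x ^ (k + n)) sums 0"
      using sums_split_initial_segment[OF assms(2)[OF x], of n] less by simp
    then have "(\<lambda>k. a (k + n) * x ^ (k + n) / x ^ n) sums (0 / x ^ n)" by (rule sums_divide)
    then show ?thesis using x by (simp add: power_add)
  qed
  then have "((\<lambda>x::'a. 0) \<longlongrightarrow> a (0 + n)) (at 0)"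
    by (intro powser_limit_0_strong[OF assms(1)]) auto
  then show "a n = 0" by (simp add: tendsto_const_iff)
qed

text \<open>For fixed \<open>z\<close> the difference of the two expansions, extended homogeneously from the sphere, is
  a harmonic function near the closed unit ball that vanishes on the sphere.\<close>

lemma hardy_expansion_unique:
  fixes Y :: "nat \<Rightarrow> nat \<Rightarrow> real^'n::finite \<Rightarrow> complex"
  assumes Y: "orthonormal_harmonics Y" and R: "R > 0"
    and c: "hardy_expansion R Y f c" and c': "hardy_expansion R Y f c'"
    and z: "norm z < R" and l: "l \<in> {1..harmonic_dim TYPE('n) k}"
  shows "c k l (z\<^sup>2) * z ^ k = c' k l (z\<^sup>2) * z ^ k"
proof -
  define a where "a k l = c k l (z\<^sup>2) * z ^ k - c' k l (z\<^sup>2) * z ^ k" for k l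
  define q where "q k x = (\<Sum>l=1..harmonic_dim TYPE('n) k. a k l * Y k l x)" for k x
  have q_eq: "q k x = quadric_term Y c z x k - quadric_term Y c' z x k" for k x
    by (simp add: q_def a_def quadric_term_def left_diff_distrib sum_subtractf)
  have pq: "polynomial_function (q k)" "homogeneous k (q k)" for k
    unfolding q_def[abs_def] by (rule harmonic_sum[OF Y])+
  note cc = c[unfolded hardy_expansion_iff] c'[unfolded hardy_expansion_iff]
  obtain C where C: "C \<ge> 0" "\<And>\<theta> k. norm \<theta> = 1 \<Longrightarrow>
      norm (quadric_term Y c z \<theta> k) \<le> C * (real k + 1) ^ (3 * CARD('n)) * (norm z / R) ^ k"
    by (rule quadric_term_bound[OF Y R cc(1)[THEN conjunct1] norm_ge_zero z]) blast
  obtain C' where C': "C' \<ge> 0" "\<And>\<theta> k. norm \<theta> = 1 \<Longrightarrow>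
      norm (quadric_term Y c' z \<theta> k) \<le> C' * (real k + 1) ^ (3 * CARD('n)) * (norm z / R) ^ k"
    by (rule quadric_term_bound[OF Y R cc(2)[THEN conjunct1] norm_ge_zero z]) blast
  have qS: "norm (q k \<theta>) \<le> (C + C') * ((real k + 1) ^ (3 * CARD('n)) * (norm z / R) ^ k)"
    if "norm \<theta> = 1" for k \<theta>
    using norm_triangle_ineq4[of "quadric_term Y c z \<theta> k" "quadric_term Y c' z \<theta> k"] C(2)[OF that, of k] C'(2)[OF that, of k]
    by (simp add: q_eq distrib_right mult.assoc)
  \<comment> \<open>Chosen so that \<open>s > 1\<close> while
    \<open>s * norm z / R = 2 * norm z / (R + norm z)\<close> is still below 1: the series converges
    on a ball larger than the unit ball, hence its sum is continuous up to the sphere.\<close>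
  define s where "s = 2 * R / (R + norm z)"
  have pos: "R + norm z > 0" using R norm_ge_zero[of z] by linarith
  have s: "s > 1" using z pos by (simp add: s_def)
  have \<tau>: "0 \<le> s * (norm z / R)" "s * (norm z / R) < 1"
    using z pos R by (auto simp: s_def field_simps)
  obtain D \<sigma> where D: "0 \<le> \<sigma>" "\<sigma> < 1" "0 \<le> D"
    "\<And>k. (real k + 1) ^ (3 * CARD('n)) * (s * (norm z / R)) ^ k \<le> D * \<sigma> ^ k"
    by (rule polynomial_geometric_bound[OF \<tau>]) blast
  have ps: "poly_series s 0 q"
    unfolding poly_series_def
  proof (intro conjI allI impI)
    show "poly_degree_le (k + 0) (q k)" for k using homogeneous_poly_degree_le[OF pq] by simp
    fix \<rho> assume \<rho>: "\<rho> < s"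
    have "norm (q k x) \<le> ((C + C') * D) * \<sigma> ^ k" if x: "norm x \<le> \<rho>" for k x
    proof -
      have "norm (q k x) \<le> s ^ k * ((C + C') * ((real k + 1) ^ (3 * CARD('n)) * (norm z / R) ^ k))"
        by (rule homogeneous_bound[OF pq(2) qS _ unit_vector_exists]) (use x \<rho> in auto)
      also have "\<dots> = (C + C') * ((real k + 1) ^ (3 * CARD('n)) * (s * (norm z / R)) ^ k)"
        unfolding power_mult_distrib[of s] by (simp only: mult_ac)
      also have "\<dots> \<le> (C + C') * (D * \<sigma> ^ k)" using C(1) C'(1) by (intro mult_left_mono D) auto
      finally show ?thesis by (simp add: mult.assoc)
    qed
    then show "\<exists>C \<tau>. 0 \<le> \<tau> \<and> \<tau> < 1 \<and> (\<forall>k x. norm x \<le> \<rho> \<longrightarrow> norm (q k x) \<le> C * \<tau> ^ k)"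
      using D(1,2) by blast
  qed
  then have ps1: "poly_series 1 0 q" using s unfolding poly_series_def by (meson less_trans)
  define U where "U x = (\<Sum>k. q k x)" for x
  have harm: "laplacian (q k) x = 0" for k x
  proof -
    \<comment> \<open>The case \<open>N = 0\<close> of the Almansi computation, with constant
      polynomials as coefficients.\<close>
    have "(laplacian ^^ Suc 0) (\<lambda>x. \<Sum>l\<in>{1..harmonic_dim TYPE('n) k}. poly [:a k l:] (sqnorm x) * Y k l x) x = 0"
      by (rule laplacian_power_poly_sqnorm) (auto intro: orthonormal_harmonics_mem[OF Y])
    then show ?thesis by (simp add: q_def[abs_def])
  qed
  have U0: "U x = 0" if x: "x \<in> ball 0 1" for x
  proof (rule harmonic_zero_boundary[OF _ _ _ _ x])
    show "continuous_on (cball 0 1) U"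
      unfolding U_def using s has_derivative_continuous[OF poly_series_has_derivative[OF ps]]
      by (intro continuous_at_imp_continuous_on) auto
    show "times_cont_diff_on 2 U (ball 0 1)"
      unfolding U_def[abs_def] by (rule poly_series_times_cont_diff_on[OF ps1])
    show "laplacian U x = 0" if "x \<in> ball 0 1" for x
      unfolding U_def[abs_def] using poly_series_laplacian_sum[OF ps1 that] by (simp add: harm)
    show "U \<theta> = 0" if "norm \<theta> = 1" for \<theta>
    proof -
      have "(\<lambda>k. q k \<theta>) sums (f z \<theta> - f z \<theta>)"
        unfolding q_eq using cc z that by (intro sums_diff) auto
      then show ?thesis by (simp add: U_def sums_iff)
    qed
  qed
  have q0: "q k \<theta> = 0" if \<theta>: "norm \<theta> = 1" for k \<theta>
  proof -
    \<comment> \<open>Along a ray the homogeneous terms form a power series in \<open>t\<close> with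
      coefficients \<open>q k \<theta>\<close>, which separates the degrees. As \<open>t\<close> is
      real, real and imaginary parts are compared one at a time.\<close>
    have sums: "(\<lambda>k. of_real t ^ k * q k \<theta>) sums 0" if "\<bar>t\<bar> < 1" for t :: real
    proof -
      have "t *\<^sub>R \<theta> \<in> ball 0 1" using that \<theta> by simp
      then have "(\<lambda>k. q k (t *\<^sub>R \<theta>)) sums U (t *\<^sub>R \<theta>)" "U (t *\<^sub>R \<theta>) = 0"
        using summable_sums[OF summable_norm_cancel[OF poly_series_summable[OF ps1]]] U0
        by (auto simp: U_def)
      then show ?thesis using pq(2) by (simp add: homogeneous_def)
    qed
    have "Re (q k \<theta>) = 0"
      by (rule powser_zero_imp_coeff_zero[where s = 1 and a = "\<lambda>k. Re (q k \<theta>)"])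
         (use sums_Re[OF sums] in \<open>auto simp flip: of_real_power simp: mult.commute\<close>)
    moreover have "Im (q k \<theta>) = 0"
      by (rule powser_zero_imp_coeff_zero[where s = 1 and a = "\<lambda>k. Im (q k \<theta>)"])
         (use sums_Im[OF sums] in \<open>auto simp flip: of_real_power simp: mult.commute\<close>)
    ultimately show ?thesis by (simp add: complex_eq_iff)
  qed
  \<comment> \<open>\<open>sphere_measure\<close> lives on the ambient space, so the integral in
    Parseval's identity is evaluated from vanishing at all \<open>x\<close>, not only on the
    sphere.\<close>
  have "q k x = 0" for x
    using homogeneous_bound[OF pq(2), where k = k and M = 0 and x = x and r = "norm x"] q0 unit_vector_exists by simp
  then have "(\<Sum>l=1..harmonic_dim TYPE('n) k. (norm (a k l))\<^sup>2) = 0"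
    using orthonormal_harmonics_norm[OF Y, where k = k and a = "a k"] by (simp add: q_def)
  then have "a k l = 0" using l by (simp add: sum_nonneg_eq_0_iff)
  then show ?thesis by (simp add: a_def)
qed

text \<open>\<open>THE\<close> requires one value for all expansions. Uniqueness concerns the
  products \<open>c k l (z^2) * z^k\<close> on the disc only, and the weights depend on nothing
  else.\<close>

lemma polyharmonic_hardy_norm_eq:
  fixes Y :: "nat \<Rightarrow> nat \<Rightarrow> real^'n::finite \<Rightarrow> complex"
  assumes Y: "orthonormal_harmonics Y" and R: "R > 0" and c: "hardy_expansion R Y f c"
  shows "polyharmonic_hardy_norm R Y f = sqrt (\<Sum>k. hardy_weight TYPE('n) R c k)"
  unfolding polyharmonic_hardy_norm_def
proof (rule the_equality)
  show "\<exists>c'. hardy_expansion R Y f c' \<and> sqrt (\<Sum>k. hardy_weight TYPE('n) R c k) = sqrt (\<Sum>k. hardy_weight TYPE('n) R c' k)"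
    using c by blast
  fix s assume "\<exists>c'. hardy_expansion R Y f c' \<and> s = sqrt (\<Sum>k. hardy_weight TYPE('n) R c' k)"
  then obtain c' where c': "hardy_expansion R Y f c'" and s: "s = sqrt (\<Sum>k. hardy_weight TYPE('n) R c' k)" by blast
  have "hardy_disc_norm R (\<lambda>z. c' k l (z\<^sup>2) * z ^ k) = hardy_disc_norm R (\<lambda>z. c k l (z\<^sup>2) * z ^ k)"
    if l: "l \<in> {1..harmonic_dim TYPE('n) k}" for k l
  proof -
    have "hardy_mean (\<lambda>z. c' k l (z\<^sup>2) * z ^ k) r = hardy_mean (\<lambda>z. c k l (z\<^sup>2) * z ^ k) r" if "r \<in> {0..<R}" for r
      unfolding hardy_mean_def using that
      by (subst hardy_expansion_unique[OF Y R c' c _ l]) (auto simp: norm_mult)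
    then have "hardy_mean (\<lambda>z. c' k l (z\<^sup>2) * z ^ k) ` {0..<R} = hardy_mean (\<lambda>z. c k l (z\<^sup>2) * z ^ k) ` {0..<R}"
      by (rule image_cong[OF refl])
    then show ?thesis by (simp only: hardy_disc_norm_def)
  qed
  then have "hardy_weight TYPE('n) R c' = hardy_weight TYPE('n) R c"
    by (simp add: hardy_weight_def fun_eq_iff)
  then show "s = sqrt (\<Sum>k. hardy_weight TYPE('n) R c k)" by (simp add: s)
qed

section \<open>Interpolation of the coefficients and the resulting expansion\<close>

lemma interpolation_hardy_bound:
  assumes "0 < b" "b < 1"
  obtains K where "K \<ge> 0"
    "\<And>c p (r :: nat \<Rightarrow> real) k w. \<lbrakk>c holomorphic_on ball 0 1; (\<lambda>z. c (z\<^sup>2) * z ^ k) \<in> hardy_disc 1;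
       r ` {0..N} \<subseteq> {0..b}; inj_on r {0..N}; degree p \<le> N;
       \<And>j. j \<in> {0..N} \<Longrightarrow> poly p ((of_real (r j))\<^sup>2) = c ((of_real (r j))\<^sup>2); norm w \<le> b\<^sup>2\<rbrakk> \<Longrightarrow>
     norm (poly p w) \<le> K * hardy_disc_norm 1 (\<lambda>z. c (z\<^sup>2) * z ^ k)"
proof -
  \<comment> \<open>Any radius strictly between \<open>b\<close> and 1 leaves room for
    \<open>interpolation_bound\<close> on one side and for the Hardy estimate on the other. As
    \<open>R = 1\<close> in the latter, its factor \<open>R ^ k\<close> is 1 and the constant is
    free of \<open>k\<close>.\<close>
  define \<rho> where "\<rho> = (b + 1) / 2"
  have \<rho>: "0 < \<rho>" "b < \<rho>" "\<rho> < 1" using assms by (auto simp: \<rho>_def)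
  have sq: "0 \<le> b\<^sup>2" "b\<^sup>2 < \<rho>\<^sup>2" "\<rho>\<^sup>2 < 1"
    using \<rho> assms by (auto simp: power_strict_mono power_less_one_iff abs_square_less_1)
  obtain C where C: "C \<ge> 0"
    "\<And>f A p (x :: nat \<Rightarrow> complex) w. \<lbrakk>f holomorphic_on ball 0 1; \<And>w. norm w \<le> \<rho>\<^sup>2 \<Longrightarrow> norm (f w) \<le> A;
       inj_on x {0..N}; \<And>j. j \<le> N \<Longrightarrow> norm (x j) \<le> b\<^sup>2; degree p \<le> N;
       \<And>j. j \<le> N \<Longrightarrow> poly p (x j) = f (x j); norm w \<le> b\<^sup>2\<rbrakk> \<Longrightarrow> norm (poly p w) \<le> C * A"
    by (rule interpolation_bound[OF sq]) blast
  show ?thesis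
  proof
    show "C * sqrt (1 / (1 - \<rho>)) \<ge> 0" using C(1) \<rho> by simp
    fix c p and r :: "nat \<Rightarrow> real" and k and w :: complex
    assume c: "c holomorphic_on ball 0 1" "(\<lambda>z. c (z\<^sup>2) * z ^ k) \<in> hardy_disc 1"
      and r: "r ` {0..N} \<subseteq> {0..b}" "inj_on r {0..N}" and p: "degree p \<le> N"
      "\<And>j. j \<in> {0..N} \<Longrightarrow> poly p ((of_real (r j))\<^sup>2) = c ((of_real (r j))\<^sup>2)" and w: "norm w \<le> b\<^sup>2"
    have rb: "0 \<le> r j" "r j \<le> b" if "j \<le> N" for j
    proof -
      have "r j \<in> r ` {0..N}" using that by simp
      then show "0 \<le> r j" "r j \<le> b" using r(1) by auto
    qed
    have "norm (poly p w) \<le> C * (sqrt (1 / (1 - \<rho>)) * hardy_disc_norm 1 (\<lambda>z. c (z\<^sup>2) * z ^ k))"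
    proof (rule C(2)[of c _ "\<lambda>j. (of_real (r j))\<^sup>2"])
      show "norm (c w) \<le> sqrt (1 / (1 - \<rho>)) * hardy_disc_norm 1 (\<lambda>z. c (z\<^sup>2) * z ^ k)" if "norm w \<le> \<rho>\<^sup>2" for w
        using hardy_coefficient_bound[of 1 c k \<rho> w] c \<rho> that by simp
      \<comment> \<open>Nonnegative nodes stay distinct after squaring.\<close>
      show "inj_on (\<lambda>j. (complex_of_real (r j))\<^sup>2) {0..N}"
      proof (rule inj_onI)
        fix i j assume ij: "i \<in> {0..N}" "j \<in> {0..N}" "(complex_of_real (r i))\<^sup>2 = (complex_of_real (r j))\<^sup>2"
        then have "(r i)\<^sup>2 = (r j)\<^sup>2" by (metis of_real_eq_iff of_real_power)
        then have "r i = r j" using rb ij by (auto simp: power2_eq_iff_nonneg)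
        then show "i = j" using r(2) ij by (auto dest: inj_onD)
      qed
      show "norm ((complex_of_real (r j))\<^sup>2) \<le> b\<^sup>2" if "j \<le> N" for j
        using rb[OF that] by (simp add: norm_power power_mono)
    qed (use c p w in auto)
    then show "norm (poly p w) \<le> C * sqrt (1 / (1 - \<rho>)) * hardy_disc_norm 1 (\<lambda>z. c (z\<^sup>2) * z ^ k)"
      by (simp add: mult.assoc)
  qed
qed

text \<open>Homogeneity rewrites the polar terms \<open>p (s^2) s^k Y \<theta>\<close> as
  \<open>p (|x|^2) Y x\<close>. These are polynomials in \<open>x\<close>, so the apparent
  singularity of polar coordinates at the origin disappears and the results on
  \<open>poly_series\<close> apply.\<close>

lemma polyharmonic_poly_expansion:
  fixes Y :: "nat \<Rightarrow> nat \<Rightarrow> real^'n::finite \<Rightarrow> complex" and p :: "nat \<Rightarrow> nat \<Rightarrow> complex poly"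
  assumes Y: "orthonormal_harmonics Y" and b: "0 < b"
    and p: "hardy_coefficients TYPE('n) b (\<lambda>k l. poly (p k l))"
    and deg: "\<And>k l. l \<in> {1..harmonic_dim TYPE('n) k} \<Longrightarrow> degree (p k l) \<le> N"
  obtains u where "polyharmonic_on (N + 1) (ball 0 b) u"
    "\<And>s \<theta>. 0 \<le> s \<Longrightarrow> norm \<theta> = 1 \<Longrightarrow> u (s *\<^sub>R \<theta>) = (\<Sum>k. quadric_term Y (\<lambda>k l. poly (p k l)) (of_real s) \<theta> k)"
proof -
  define q where "q k x = (\<Sum>l\<in>{1..harmonic_dim TYPE('n) k}. poly (p k l) (sqnorm x) * Y k l x)" for k x
  have q: "q k (s *\<^sub>R \<theta>) = quadric_term Y (\<lambda>k l. poly (p k l)) (of_real s) \<theta> k" if "norm \<theta> = 1" for k s \<theta>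
  proof -
    have "Y k l (s *\<^sub>R \<theta>) = of_real s ^ k * Y k l \<theta>" if "l \<in> {1..harmonic_dim TYPE('n) k}" for l
      using harmonic_spaceD(2)[OF orthonormal_harmonics_mem[OF Y that]] by (simp add: homogeneous_def)
    then show ?thesis
      using that by (auto simp: q_def quadric_term_def sqnorm_def intro!: sum.cong)
  qed
  have ps: "poly_series b (2 * N) q"
    unfolding poly_series_def
  proof (intro conjI allI impI)
    show "poly_degree_le (k + 2 * N) (q k)" for k
      unfolding q_def[abs_def]
      by (rule laplacian_power_poly_sqnorm(2)) (auto intro: orthonormal_harmonics_mem[OF Y] deg)
    fix \<rho>' assume "\<rho>' < b"
    \<comment> \<open>\<open>poly_series\<close> quantifies over all radii below \<open>b\<close>,
      negative ones included, whereas \<open>quadric_term_bound\<close> takes a nonnegative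
      radius.\<close>
    define \<rho> where "\<rho> = max \<rho>' 0"
    have \<rho>: "0 \<le> \<rho>" "\<rho> < b" "\<rho>' \<le> \<rho>" using \<open>\<rho>' < b\<close> b by (auto simp: \<rho>_def)
    obtain C where C: "C \<ge> 0" "\<And>z \<theta> k. norm z \<le> \<rho> \<Longrightarrow> norm \<theta> = 1 \<Longrightarrow>
       norm (quadric_term Y (\<lambda>k l. poly (p k l)) z \<theta> k) \<le> C * (real k + 1) ^ (3 * CARD('n)) * (norm z / b) ^ k"
      by (rule quadric_term_bound[OF Y b p \<rho>(1,2)]) blast
    have "0 \<le> \<rho> / b" "\<rho> / b < 1" using \<rho> b by auto
    then obtain D \<sigma> where D: "0 \<le> \<sigma>" "\<sigma> < 1" "0 \<le> D"
      "\<And>k. (real k + 1) ^ (3 * CARD('n)) * (\<rho> / b) ^ k \<le> D * \<sigma> ^ k"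
      by (rule polynomial_geometric_bound) blast
    have "norm (q k x) \<le> (C * D) * \<sigma> ^ k" if x: "norm x \<le> \<rho>'" for k x
    proof -
      obtain \<theta>\<^sub>0 :: "real^'n" where \<theta>\<^sub>0: "norm \<theta>\<^sub>0 = 1" using unit_vector_exists by blast
      define \<theta> where "\<theta> = (if x = 0 then \<theta>\<^sub>0 else x /\<^sub>R norm x)"
      have \<theta>: "norm \<theta> = 1" "x = norm x *\<^sub>R \<theta>" by (auto simp: \<theta>_def \<theta>\<^sub>0)
      have "norm (q k x) = norm (quadric_term Y (\<lambda>k l. poly (p k l)) (of_real (norm x)) \<theta> k)"
        using q[OF \<theta>(1), of k "norm x"] \<theta>(2) by simp
      also have "\<dots> \<le> C * (real k + 1) ^ (3 * CARD('n)) * (norm (complex_of_real (norm x)) / b) ^ k"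
        using x \<rho> by (intro C(2) \<theta>(1)) simp
      also have "\<dots> \<le> C * (real k + 1) ^ (3 * CARD('n)) * (\<rho> / b) ^ k"
        using x \<rho> b C(1) by (intro mult_left_mono power_mono divide_right_mono) auto
      also have "\<dots> \<le> C * (D * \<sigma> ^ k)"
        using mult_left_mono[OF D(4)[of k] C(1)] by (simp add: mult.assoc)
      finally show ?thesis by (simp add: mult.assoc)
    qed
    then show "\<exists>C \<tau>. 0 \<le> \<tau> \<and> \<tau> < 1 \<and> (\<forall>k x. norm x \<le> \<rho>' \<longrightarrow> norm (q k x) \<le> C * \<tau> ^ k)"
      using D(1,2) by blast
  qed
  have "(laplacian ^^ Suc N) (q k) x = 0" for k x
    unfolding q_def[abs_def]
    by (rule laplacian_power_poly_sqnorm(1)) (auto intro: orthonormal_harmonics_mem[OF Y] deg)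
  then have "polyharmonic_on (N + 1) (ball 0 b) (\<lambda>x. \<Sum>k. q k x)"
    by (intro poly_series_polyharmonic[OF ps]) simp
  then show ?thesis by (rule that) (simp add: q)
qed

theorem theorem26:
  fixes N :: nat and b :: real
  assumes "CARD('n::finite) \<ge> 2" and "0 < b" and "b < 1"
  shows "\<exists>C::real. \<forall>(Y :: nat \<Rightarrow> nat \<Rightarrow> real^'n \<Rightarrow> complex) (f :: complex \<Rightarrow> real^'n \<Rightarrow> complex)
      (c :: nat \<Rightarrow> nat \<Rightarrow> complex \<Rightarrow> complex) (r :: nat \<Rightarrow> nat \<Rightarrow> nat \<Rightarrow> real)
      (p :: nat \<Rightarrow> nat \<Rightarrow> complex poly).
    orthonormal_harmonics Y \<and>
    f \<in> polyharmonic_hardy 1 Y \<and>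
    hardy_expansion 1 Y f c \<and>
    (\<forall>k. \<forall>l\<in>{1..harmonic_dim TYPE('n) k}.
       r k l ` {0..N} \<subseteq> {0..b} \<and> inj_on (r k l) {0..N} \<and>
       degree (p k l) \<le> N \<and>
       (\<forall>j\<in>{0..N}. poly (p k l) ((of_real (r k l j))\<^sup>2) = c k l ((of_real (r k l j))\<^sup>2)))
    \<longrightarrow>
    (let P = (\<lambda>z \<theta>. \<Sum>k. \<Sum>l = 1..harmonic_dim TYPE('n) k. poly (p k l) (z\<^sup>2) * z ^ k * Y k l \<theta>) in
       (\<exists>u. polyharmonic_on (N + 1) (ball 0 b) u \<and>
          (\<forall>s\<in>{0..<b}. \<forall>\<theta>\<in>sphere 0 1. u (s *\<^sub>R \<theta>) = P (of_real s) \<theta>)) \<and>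
       P \<in> polyharmonic_hardy b Y \<and>
       hardy_expansion b Y P (\<lambda>k l. poly (p k l)) \<and>
       polyharmonic_hardy_norm b Y P \<le> C * polyharmonic_hardy_norm 1 Y f)"
proof -
  obtain K where K: "K \<ge> 0"
    "\<And>c p (r :: nat \<Rightarrow> real) k w. \<lbrakk>c holomorphic_on ball 0 1; (\<lambda>z. c (z\<^sup>2) * z ^ k) \<in> hardy_disc 1;
       r ` {0..N} \<subseteq> {0..b}; inj_on r {0..N}; degree p \<le> N;
       \<And>j. j \<in> {0..N} \<Longrightarrow> poly p ((of_real (r j))\<^sup>2) = c ((of_real (r j))\<^sup>2); norm w \<le> b\<^sup>2\<rbrakk> \<Longrightarrow>
     norm (poly p w) \<le> K * hardy_disc_norm 1 (\<lambda>z. c (z\<^sup>2) * z ^ k)"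
    by (rule interpolation_hardy_bound[OF assms(2,3)]) blast
  show ?thesis
  \<comment> \<open>\<open>K\<close> was obtained from \<open>N\<close> and \<open>b\<close> before
    the basis, the function and the nodes are introduced, so it is uniform in all of them. The
    dimension enters only the convergence and smoothness of the series.\<close>
  proof (rule exI[of _ K], intro allI impI, elim conjE)
    fix Y :: "nat \<Rightarrow> nat \<Rightarrow> real^'n \<Rightarrow> complex" and f :: "complex \<Rightarrow> real^'n \<Rightarrow> complex"
      and c :: "nat \<Rightarrow> nat \<Rightarrow> complex \<Rightarrow> complex" and r :: "nat \<Rightarrow> nat \<Rightarrow> nat \<Rightarrow> real"
      and p :: "nat \<Rightarrow> nat \<Rightarrow> complex poly"
    assume Y: "orthonormal_harmonics Y" and c: "hardy_expansion 1 Y f c"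
      and rp: "\<forall>k. \<forall>l\<in>{1..harmonic_dim TYPE('n) k}.
       r k l ` {0..N} \<subseteq> {0..b} \<and> inj_on (r k l) {0..N} \<and>
       degree (p k l) \<le> N \<and>
       (\<forall>j\<in>{0..N}. poly (p k l) ((of_real (r k l j))\<^sup>2) = c k l ((of_real (r k l j))\<^sup>2))"
    let ?P = "\<lambda>z \<theta>. \<Sum>k. \<Sum>l = 1..harmonic_dim TYPE('n) k. poly (p k l) (z\<^sup>2) * z ^ k * Y k l \<theta>"
    let ?c = "\<lambda>k l. poly (p k l)"
    have P: "?P z \<theta> = (\<Sum>k. quadric_term Y ?c z \<theta> k)" for z \<theta> by (simp add: quadric_term_def)
    have cc: "c k l holomorphic_on ball 0 1" "(\<lambda>z. c k l (z\<^sup>2) * z ^ k) \<in> hardy_disc 1"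
      if "l \<in> {1..harmonic_dim TYPE('n) k}" for k l
      using c that by (auto simp: hardy_expansion_def)
    \<comment> \<open>Here \<open>b < 1\<close> makes \<open>norm z ^ k\<close> at most 1, which
      disposes of the factor \<open>z ^ k\<close> uniformly in \<open>k\<close>.\<close>
    have bound: "norm (?c k l (z\<^sup>2) * z ^ k) \<le> K * hardy_disc_norm 1 (\<lambda>z. c k l (z\<^sup>2) * z ^ k)"
      if l: "l \<in> {1..harmonic_dim TYPE('n) k}" and z: "norm z < b" for k l z
    proof -
      have "norm (?c k l (z\<^sup>2)) \<le> K * hardy_disc_norm 1 (\<lambda>z. c k l (z\<^sup>2) * z ^ k)"
        using rp l z by (intro K(2)[where r = "r k l"] cc) (auto simp: norm_power power_mono)
      moreover have "norm z ^ k \<le> 1" using z assms(3) by (intro power_le_one) auto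
      then have "norm (?c k l (z\<^sup>2)) * norm z ^ k \<le> norm (?c k l (z\<^sup>2))" by (intro mult_right_le_one_le) auto
      ultimately show ?thesis by (simp add: norm_mult norm_power)
    qed
    have hol: "(\<lambda>z. ?c k l (z\<^sup>2) * z ^ k) holomorphic_on ball 0 b" for k l
      by (intro holomorphic_intros)
    note hd = hardy_disc_bounded[OF assms(2) hol bound]
    \<comment> \<open>Interpolation acts on each \<open>(k, l)\<close> separately, so the squared
      norms are compared entry by entry with the single factor \<open>K\<^sup>2\<close>.\<close>
    have weight: "hardy_weight TYPE('n) b ?c k \<le> K\<^sup>2 * hardy_weight TYPE('n) 1 c k" for k
      unfolding hardy_weight_def sum_distrib_left power_mult_distrib[symmetric]
      by (intro sum_mono power_mono hd(2) hardy_disc_norm_sup(2)[OF assms(2) hd(1)])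
    have sumc: "summable (\<lambda>k. K\<^sup>2 * hardy_weight TYPE('n) 1 c k)"
      using c by (intro summable_mult) (simp add: hardy_expansion_def)
    have sump: "summable (hardy_weight TYPE('n) b ?c)"
      by (rule summable_comparison_test'[OF sumc]) (simp add: weight hardy_weight_nonneg)
    have coeffs: "hardy_coefficients TYPE('n) b ?c"
      unfolding hardy_coefficients_def using sump hd(1) by (auto intro: holomorphic_intros)
    \<comment> \<open>That the series defining \<open>?P\<close> converges is deduced here from the
      summability of the weights.\<close>
    have exp: "hardy_expansion b Y ?P ?c"
      unfolding hardy_expansion_iff P
      using coeffs quadric_term_summable[OF Y assms(2) coeffs] by (auto intro: summable_sums)
    have "polyharmonic_hardy_norm b Y ?P = sqrt (\<Sum>k. hardy_weight TYPE('n) b ?c k)"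
      by (rule polyharmonic_hardy_norm_eq[OF Y assms(2) exp])
    also have "\<dots> \<le> sqrt (\<Sum>k. K\<^sup>2 * hardy_weight TYPE('n) 1 c k)"
      by (intro real_sqrt_le_mono suminf_le weight sump sumc)
    also have "\<dots> = sqrt (K\<^sup>2 * (\<Sum>k. hardy_weight TYPE('n) 1 c k))"
      using c by (subst suminf_mult) (auto simp: hardy_expansion_def)
    also have "\<dots> = K * polyharmonic_hardy_norm 1 Y f"
      using K(1) polyharmonic_hardy_norm_eq[OF Y zero_less_one c] by (simp add: real_sqrt_mult)
    finally have norm_le: "polyharmonic_hardy_norm b Y ?P \<le> K * polyharmonic_hardy_norm 1 Y f" .
    obtain u where u: "polyharmonic_on (N + 1) (ball 0 b) u"
      "\<And>s \<theta>. 0 \<le> s \<Longrightarrow> norm \<theta> = 1 \<Longrightarrow> u (s *\<^sub>R \<theta>) = (\<Sum>k. quadric_term Y ?c (of_real s) \<theta> k)"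
      by (rule polyharmonic_poly_expansion[OF Y assms(2) coeffs, of N]) (use rp in auto)
    show "let P = ?P in
       (\<exists>u. polyharmonic_on (N + 1) (ball 0 b) u \<and>
          (\<forall>s\<in>{0..<b}. \<forall>\<theta>\<in>sphere 0 1. u (s *\<^sub>R \<theta>) = P (of_real s) \<theta>)) \<and>
       P \<in> polyharmonic_hardy b Y \<and>
       hardy_expansion b Y P ?c \<and>
       polyharmonic_hardy_norm b Y P \<le> K * polyharmonic_hardy_norm 1 Y f"
      unfolding Let_def
    proof (intro conjI)
      show "\<exists>u. polyharmonic_on (N + 1) (ball 0 b) u \<and>
          (\<forall>s\<in>{0..<b}. \<forall>\<theta>\<in>sphere 0 1. u (s *\<^sub>R \<theta>) = ?P (of_real s) \<theta>)"
        unfolding P using u by (intro exI[of _ u]) auto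
      show "?P \<in> polyharmonic_hardy b Y" using exp by (auto simp: polyharmonic_hardy_def)
    qed (rule exp, rule norm_le)
  qed
qed

end
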